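(* Let $X$ be a Euclidean polyhedral space of pure dimension $n$, $U\subset X$ a balanced open subset, and $f$ a weakly concave function on $U$. Then $f$ is continuous.
   Context: Polyhedral spaces. Let $X$ be a second countable topological space. A polyhedral structure $\Pi$ on $X$ is a locally finite covering of $X$ by distinct closed subsets $\sigma$ (polyhedra), each with a finite-dimensional vector space $M_\sigma$ of continuous real functions on $\sigma$ such that, with $N_\sigma=\operatorname{Hom}(M_\sigma,\mathbb{R})$, the evaluation map $\phi_\sigma\colon\sigma\to N_\sigma$ is a homeomorphism onto a full-dimensional convex polyhedron of an affine hyperplane of $N_\sigma$ not containing $0$. Faces of $\sigma$ are preimages of faces of $\phi_\sigma(\sigma)$ (including the empty face); every face of a polyhedron is a polyhedron of $\Pi$ with function space the restrictions of $M_\sigma$; any two polyhedra meet in a common face. Each polyhedron has an affine structure, dimension, facets. $\Pi'$ subdivides $\Pi$ if each polyhedron of $\Pi'$ lies in one of $\Pi$ with affine inclusion; structures are equivalent if they have a common subdivision. A polyhedral space is $X$ with an equivalence class of structures; a polyhedral complex on $X$ is a member; $X$ has pure dimension $n$ if all maximal polyhedra have dimension $n$. $\tau\prec\sigma$ means $\tau$ is a face of $\sigma$. A Euclidean polyhedral space is a polyhedral space $X$ with a finite-dimensional Euclidean vector space $N_X$ and a map $\iota\colon X\to N_X$ with image in an affine hyperplane $H_X\not\ni0$ such that some polyhedral complex has $\iota$ injective and affine on each polyhedron; only such complexes are considered. For a nonempty facet $\tau$ of $\sigma$, $v_{\sigma\setminus\tau}$ is the unit vector orthogonal to the affine span of $\iota(\tau)$,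 parallel to that of $\iota(\sigma)$, pointing towards $\iota(\sigma)$. Weights and cycles. $\Pi|_W$: polyhedra meeting an open $W$; $\Pi|_W(k)$: those of dimension $k$. A $k$-dimensional weight $c\colon\Pi|_W(k)\to\mathbb{R}$ is positive if $c\ge0$, a Minkowski weight if $\sum_{\sigma\in\Pi|_W(k),\sigma\succ\tau}c(\sigma)v_{\sigma\setminus\tau}=0$ for all $\tau\in\Pi|_W(k-1)$. A piecewise affine function on $W$ defined on $\Pi$ is affine on each $\sigma\cap W$; with $g=g_\sigma\circ\iota$ there ($g_\sigma$ linear), $(g\cdot c)(\tau)=-\sum_{\sigma\succ\tau}c(\sigma)g_\sigma(v_{\sigma\setminus\tau})$. Minkowski cycles: Minkowski weights modulo pullback to subdivisions ($c_{\Pi'}(\sigma')=c(\sigma)$ if $\sigma'\subset\sigma$ of equal dimension, else $0$); positive if represented by a positive weight; $g\cdot[c]=[g\cdot c]$. A balancing condition on $U$ is an $n$-dimensional Minkowski cycle $\beta_U$ represented by a weight $b$ with $b(\sigma)>0$ for all $\sigma\in\Pi|_U(n)$; $U$ with $\beta_U$ is balanced. A piecewise affine $g$ on $U$ is concave (PA sense) if $g\cdot\gamma$ is positive for every open $W\subset U$ and every positive Minkowski cycle $\gamma$ on $W$. A $k$-dimensional Minkowski cycle on $U$ is $\beta_U$-positive if it is $\sum_j\alpha_jg_{1,j}\cdots g_{n-k,j}\cdot\beta_U$ with $\alpha_j>0$, $g_{i,j}$ concave piecewise affine; a weight is $\beta_U$-positive if it represents one. Weak concavity. A convex combination in $U$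 is $(x,(x_i)_{i\in I},(\nu_i)_{i\in I})$, $I$ finite, $x,x_i\in U$, $\nu_i\ge0$, $\sum\nu_i=1$, $\sum\nu_i\iota(x_i)=\iota(x)$. It is balanced if there are a polyhedral complex $\Pi$, $\tau\in\Pi$ with $x\in\tau$, and $\sigma_i\in\Pi$ with $\sigma_i\succ\tau$, $\sigma_i\subset U$, $x_i\in\sigma_i$, such that, with $k=\dim\tau+1$, the $\sigma_i$ are the distinct $k$-dimensional polyhedra of $\Pi$ having $\tau$ as a face, and there is a $\beta_U$-positive $k$-dimensional Minkowski weight $c$ on $\Pi|_U$ with $\nu_i\,d(x_i,\tau)=c(\sigma_i)$ ($d$ = distance from $\iota(x_i)$ to the affine span of $\iota(\tau)$). A function $f\colon U\to\mathbb{R}$ is weakly concave if $f(x)\ge\sum\nu_if(x_i)$ for every balanced convex combination in $U$. *)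

theory Defs
  imports "HOL-Analysis.Analysis"
begin

definition pdim :: "('a \<Rightarrow> 'v::euclidean_space) \<Rightarrow> 'a set \<Rightarrow> int" where
  "pdim \<iota> \<sigma> = aff_dim (\<iota> ` \<sigma>)"

definition epc_complex :: "'a topology \<Rightarrow> ('a \<Rightarrow> 'v::euclidean_space) \<Rightarrow> 'a set set \<Rightarrow> bool" where
  "epc_complex T \<iota> PP \<longleftrightarrow>
     (\<forall>\<sigma>\<in>PP. closedin T \<sigma>) \<and>
     \<Union>PP = topspace T \<and>
     locally_finite_in T PP \<and>
     (\<forall>\<sigma>\<in>PP. inj_on \<iota> \<sigma> \<and> polyhedron (\<iota> ` \<sigma>) \<and>
               homeomorphic_map (subtopology T \<sigma>) (top_of_set (\<iota> ` \<sigma>)) \<iota>) \<and>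
     (\<forall>\<sigma>\<in>PP. \<forall>F. F face_of (\<iota> ` \<sigma>) \<longrightarrow> \<sigma> \<inter> \<iota> -` F \<in> PP) \<and>
     (\<forall>\<sigma>\<in>PP. \<forall>\<sigma>'\<in>PP. (\<iota> ` (\<sigma> \<inter> \<sigma>')) face_of (\<iota> ` \<sigma>) \<and>
                         (\<iota> ` (\<sigma> \<inter> \<sigma>')) face_of (\<iota> ` \<sigma>'))"

definition is_face :: "('a \<Rightarrow> 'v::euclidean_space) \<Rightarrow> 'a set \<Rightarrow> 'a set \<Rightarrow> bool" where
  "is_face \<iota> \<tau> \<sigma> \<longleftrightarrow> \<tau> \<subseteq> \<sigma> \<and> (\<iota> ` \<tau>) face_of (\<iota> ` \<sigma>)"

text \<open>Pi' subdivides Pi (affine inclusion is automatic, as both are affine via iota).\<close>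
definition subdivides :: "'a set set \<Rightarrow> 'a set set \<Rightarrow> bool" where
  "subdivides PP' PP \<longleftrightarrow> (\<forall>\<sigma>'\<in>PP'. \<exists>\<sigma>\<in>PP. \<sigma>' \<subseteq> \<sigma>)"

definition equiv_complexes ::
  "'a topology \<Rightarrow> ('a \<Rightarrow> 'v::euclidean_space) \<Rightarrow> 'a set set \<Rightarrow> 'a set set \<Rightarrow> bool" where
  "equiv_complexes T \<iota> PP1 PP2 \<longleftrightarrow>
     (\<exists>PP'. epc_complex T \<iota> PP' \<and> subdivides PP' PP1 \<and> subdivides PP' PP2)"

text \<open>The polyhedral complexes (considered) of the Euclidean polyhedral space whose
  structure is the equivalence class of the complex Pi0.\<close>
definition in_class ::
  "'a topology \<Rightarrow> ('a \<Rightarrow> 'v::euclidean_space) \<Rightarrow> 'a set set \<Rightarrow> 'a set set \<Rightarrow> bool" where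
  "in_class T \<iota> PP0 PP \<longleftrightarrow> epc_complex T \<iota> PP \<and> equiv_complexes T \<iota> PP PP0"

definition euclidean_polyhedral_space ::
  "'a topology \<Rightarrow> ('a \<Rightarrow> 'v::euclidean_space) \<Rightarrow> 'a set set \<Rightarrow> bool" where
  "euclidean_polyhedral_space T \<iota> PP0 \<longleftrightarrow>
     second_countable T \<and>
     (\<exists>a b. a \<noteq> 0 \<and> b \<noteq> 0 \<and> \<iota> ` topspace T \<subseteq> {y. a \<bullet> y = b}) \<and>
     epc_complex T \<iota> PP0"

definition pure_dimension ::
  "('a \<Rightarrow> 'v::euclidean_space) \<Rightarrow> 'a set set \<Rightarrow> nat \<Rightarrow> bool" where
  "pure_dimension \<iota> PP0 n \<longleftrightarrow>
     (\<forall>\<sigma>\<in>PP0. (\<forall>\<sigma>'\<in>PP0. \<sigma> \<subseteq> \<sigma>' \<longrightarrow> \<sigma>' = \<sigma>) \<longrightarrow> pdim \<iota> \<sigma> = int n)"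

definition restr :: "'a set set \<Rightarrow> 'a set \<Rightarrow> 'a set set" where
  "restr PP W = {\<sigma>\<in>PP. \<sigma> \<inter> W \<noteq> {}}"

definition restr_dim ::
  "('a \<Rightarrow> 'v::euclidean_space) \<Rightarrow> 'a set set \<Rightarrow> 'a set \<Rightarrow> int \<Rightarrow> 'a set set" where
  "restr_dim \<iota> PP W k = {\<sigma>\<in>restr PP W. pdim \<iota> \<sigma> = k}"

definition nvec :: "('a \<Rightarrow> 'v::euclidean_space) \<Rightarrow> 'a set \<Rightarrow> 'a set \<Rightarrow> 'v" where
  "nvec \<iota> \<sigma> \<tau> = (THE v. norm v = 1 \<and>
      v \<in> span {p - q | p q. p \<in> \<iota> ` \<sigma> \<and> q \<in> \<iota> ` \<sigma>} \<and>
      (\<forall>p\<in>\<iota> ` \<tau>. \<forall>q\<in>\<iota> ` \<tau>. v \<bullet> (p - q) = 0) \<and>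
      (\<forall>p\<in>\<iota> ` \<sigma>. \<forall>q\<in>\<iota> ` \<tau>. v \<bullet> (p - q) \<ge> 0))"

definition cofaces ::
  "('a \<Rightarrow> 'v::euclidean_space) \<Rightarrow> 'a set set \<Rightarrow> 'a set \<Rightarrow> int \<Rightarrow> 'a set \<Rightarrow> 'a set set" where
  "cofaces \<iota> PP W k \<tau> = {\<sigma>\<in>restr_dim \<iota> PP W k. is_face \<iota> \<tau> \<sigma>}"

definition minkowski ::
  "('a \<Rightarrow> 'v::euclidean_space) \<Rightarrow> 'a set set \<Rightarrow> 'a set \<Rightarrow> int \<Rightarrow> ('a set \<Rightarrow> real) \<Rightarrow> bool" where
  "minkowski \<iota> PP W k c \<longleftrightarrow>
     (\<forall>\<tau>\<in>restr_dim \<iota> PP W (k - 1).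
        (\<Sum>\<sigma>\<in>cofaces \<iota> PP W k \<tau>. c \<sigma> *\<^sub>R nvec \<iota> \<sigma> \<tau>) = 0)"

definition positive_weight ::
  "('a \<Rightarrow> 'v::euclidean_space) \<Rightarrow> 'a set set \<Rightarrow> 'a set \<Rightarrow> int \<Rightarrow> ('a set \<Rightarrow> real) \<Rightarrow> bool" where
  "positive_weight \<iota> PP W k c \<longleftrightarrow> (\<forall>\<sigma>\<in>restr_dim \<iota> PP W k. c \<sigma> \<ge> 0)"

definition pa_on ::
  "('a \<Rightarrow> 'v::euclidean_space) \<Rightarrow> 'a set set \<Rightarrow> 'a set \<Rightarrow> ('a \<Rightarrow> real) \<Rightarrow> bool" where
  "pa_on \<iota> PP W g \<longleftrightarrow>
     (\<forall>\<sigma>\<in>PP. \<exists>l. linear l \<and> (\<forall>x\<in>\<sigma> \<inter> W. g x = l (\<iota> x)))"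

definition pa_lin ::
  "('a \<Rightarrow> 'v::euclidean_space) \<Rightarrow> 'a set \<Rightarrow> ('a \<Rightarrow> real) \<Rightarrow> 'a set \<Rightarrow> 'v \<Rightarrow> real" where
  "pa_lin \<iota> W g \<sigma> = (SOME l. linear l \<and> (\<forall>x\<in>\<sigma> \<inter> W. g x = l (\<iota> x)))"

definition pa_mult ::
  "('a \<Rightarrow> 'v::euclidean_space) \<Rightarrow> 'a set set \<Rightarrow> 'a set \<Rightarrow> ('a \<Rightarrow> real)
     \<Rightarrow> ('a set \<Rightarrow> real) \<Rightarrow> 'a set \<Rightarrow> real" where
  "pa_mult \<iota> PP W g c \<tau> =
     - (\<Sum>\<sigma>\<in>cofaces \<iota> PP W (pdim \<iota> \<tau> + 1) \<tau>. c \<sigma> * pa_lin \<iota> W g \<sigma> (nvec \<iota> \<sigma> \<tau>))"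

fun pa_mult_list ::
  "('a \<Rightarrow> 'v::euclidean_space) \<Rightarrow> 'a set set \<Rightarrow> 'a set \<Rightarrow> ('a \<Rightarrow> real) list
     \<Rightarrow> ('a set \<Rightarrow> real) \<Rightarrow> 'a set \<Rightarrow> real" where
  "pa_mult_list \<iota> PP W [] c = c"
| "pa_mult_list \<iota> PP W (g # gs) c = pa_mult \<iota> PP W g (pa_mult_list \<iota> PP W gs c)"

definition pullback ::
  "('a \<Rightarrow> 'v::euclidean_space) \<Rightarrow> 'a set set \<Rightarrow> ('a set \<Rightarrow> real) \<Rightarrow> 'a set \<Rightarrow> real" where
  "pullback \<iota> PP c \<sigma>' =
     (if \<exists>\<sigma>\<in>PP. \<sigma>' \<subseteq> \<sigma> \<and> pdim \<iota> \<sigma> = pdim \<iota> \<sigma>'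
      then c (THE \<sigma>. \<sigma> \<in> PP \<and> \<sigma>' \<subseteq> \<sigma> \<and> pdim \<iota> \<sigma> = pdim \<iota> \<sigma>') else 0)"

definition same_cycle ::
  "'a topology \<Rightarrow> ('a \<Rightarrow> 'v::euclidean_space) \<Rightarrow> 'a set set \<Rightarrow> 'a set \<Rightarrow> int
     \<Rightarrow> 'a set set \<Rightarrow> ('a set \<Rightarrow> real) \<Rightarrow> 'a set set \<Rightarrow> ('a set \<Rightarrow> real) \<Rightarrow> bool" where
  "same_cycle T \<iota> PP0 W k PP1 c1 PP2 c2 \<longleftrightarrow>
     (\<exists>PP'. in_class T \<iota> PP0 PP' \<and> subdivides PP' PP1 \<and> subdivides PP' PP2 \<and>
        (\<forall>\<sigma>'\<in>restr_dim \<iota> PP' W k. pullback \<iota> PP1 c1 \<sigma>' = pullback \<iota> PP2 c2 \<sigma>'))"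

definition positive_cycle ::
  "'a topology \<Rightarrow> ('a \<Rightarrow> 'v::euclidean_space) \<Rightarrow> 'a set set \<Rightarrow> 'a set \<Rightarrow> int
     \<Rightarrow> 'a set set \<Rightarrow> ('a set \<Rightarrow> real) \<Rightarrow> bool" where
  "positive_cycle T \<iota> PP0 W k PP c \<longleftrightarrow>
     (\<exists>PP' c'. in_class T \<iota> PP0 PP' \<and> minkowski \<iota> PP' W k c' \<and>
        positive_weight \<iota> PP' W k c' \<and> same_cycle T \<iota> PP0 W k PP c PP' c')"

definition concave_pa ::
  "'a topology \<Rightarrow> ('a \<Rightarrow> 'v::euclidean_space) \<Rightarrow> 'a set set \<Rightarrow> 'a set \<Rightarrow> ('a \<Rightarrow> real) \<Rightarrow> bool" where
  "concave_pa T \<iota> PP0 U g \<longleftrightarrow>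
     (\<exists>PP. in_class T \<iota> PP0 PP \<and> pa_on \<iota> PP U g) \<and>
     (\<forall>W PP k c. openin T W \<and> W \<subseteq> U \<and> in_class T \<iota> PP0 PP \<and> pa_on \<iota> PP W g \<and>
        minkowski \<iota> PP W k c \<and> positive_cycle T \<iota> PP0 W k PP c \<longrightarrow>
        positive_cycle T \<iota> PP0 W (k - 1) PP (pa_mult \<iota> PP W g c))"

definition balancing ::
  "'a topology \<Rightarrow> ('a \<Rightarrow> 'v::euclidean_space) \<Rightarrow> 'a set set \<Rightarrow> nat \<Rightarrow> 'a set
     \<Rightarrow> 'a set set \<Rightarrow> ('a set \<Rightarrow> real) \<Rightarrow> bool" where
  "balancing T \<iota> PP0 n U PPb b \<longleftrightarrow>
     in_class T \<iota> PP0 PPb \<and> minkowski \<iota> PPb U (int n) b \<and>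
     (\<forall>\<sigma>\<in>restr_dim \<iota> PPb U (int n). b \<sigma> > 0)"

definition beta_positive ::
  "'a topology \<Rightarrow> ('a \<Rightarrow> 'v::euclidean_space) \<Rightarrow> 'a set set \<Rightarrow> nat \<Rightarrow> 'a set
     \<Rightarrow> 'a set set \<Rightarrow> ('a set \<Rightarrow> real) \<Rightarrow> int \<Rightarrow> 'a set set \<Rightarrow> ('a set \<Rightarrow> real) \<Rightarrow> bool" where
  "beta_positive T \<iota> PP0 n U PPb b k PP c \<longleftrightarrow>
     k \<le> int n \<and>
     (\<exists>PP' (J::nat set) \<alpha> G.
        in_class T \<iota> PP0 PP' \<and> subdivides PP' PPb \<and>
        finite J \<and> J \<noteq> {} \<and> (\<forall>j\<in>J. \<alpha> j > (0::real)) \<and>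
        (\<forall>j\<in>J. length (G j) = nat (int n - k) \<and>
           (\<forall>g\<in>set (G j). concave_pa T \<iota> PP0 U g \<and> pa_on \<iota> PP' U g)) \<and>
        same_cycle T \<iota> PP0 U k PP c PP'
          (\<lambda>\<sigma>. \<Sum>j\<in>J. \<alpha> j * pa_mult_list \<iota> PP' U (G j) (pullback \<iota> PPb b) \<sigma>))"

definition balanced_cc ::
  "'a topology \<Rightarrow> ('a \<Rightarrow> 'v::euclidean_space) \<Rightarrow> 'a set set \<Rightarrow> nat \<Rightarrow> 'a set
     \<Rightarrow> 'a set set \<Rightarrow> ('a set \<Rightarrow> real) \<Rightarrow> 'a \<Rightarrow> nat set \<Rightarrow> (nat \<Rightarrow> 'a) \<Rightarrow> (nat \<Rightarrow> real) \<Rightarrow> bool" where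
  "balanced_cc T \<iota> PP0 n U PPb b x I xs \<nu> \<longleftrightarrow>
     finite I \<and> x \<in> U \<and> (\<forall>i\<in>I. xs i \<in> U \<and> \<nu> i \<ge> 0) \<and>
     (\<Sum>i\<in>I. \<nu> i) = 1 \<and> (\<Sum>i\<in>I. \<nu> i *\<^sub>R \<iota> (xs i)) = \<iota> x \<and>
     (\<exists>PP \<tau> \<sigma>s c.
        in_class T \<iota> PP0 PP \<and> \<tau> \<in> PP \<and> x \<in> \<tau> \<and>
        (\<forall>i\<in>I. \<sigma>s i \<in> PP \<and> is_face \<iota> \<tau> (\<sigma>s i) \<and> \<sigma>s i \<subseteq> U \<and> xs i \<in> \<sigma>s i) \<and>
        bij_betw \<sigma>s I {\<sigma>\<in>PP. pdim \<iota> \<sigma> = pdim \<iota> \<tau> + 1 \<and> is_face \<iota> \<tau> \<sigma>} \<and>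
        minkowski \<iota> PP U (pdim \<iota> \<tau> + 1) c \<and>
        beta_positive T \<iota> PP0 n U PPb b (pdim \<iota> \<tau> + 1) PP c \<and>
        (\<forall>i\<in>I. \<nu> i * infdist (\<iota> (xs i)) (affine hull (\<iota> ` \<tau>)) = c (\<sigma>s i)))"

definition weakly_concave ::
  "'a topology \<Rightarrow> ('a \<Rightarrow> 'v::euclidean_space) \<Rightarrow> 'a set set \<Rightarrow> nat \<Rightarrow> 'a set
     \<Rightarrow> 'a set set \<Rightarrow> ('a set \<Rightarrow> real) \<Rightarrow> ('a \<Rightarrow> real) \<Rightarrow> bool" where
  "weakly_concave T \<iota> PP0 n U PPb b f \<longleftrightarrow>
     (\<forall>x I xs \<nu>. balanced_cc T \<iota> PP0 n U PPb b x I xs \<nu> \<longrightarrow>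
        f x \<ge> (\<Sum>i\<in>I. \<nu> i * f (xs i)))"

end

(* Fix x0 in U and refine the complex so that x0 is a vertex whose star is a small union of polytopes
   contained in U. Refine once more along all linear forms w that define the cells of the star; then
   g = sum of min(0, w) is concave and bends along every cell around x0, so the products of copies of g
   with the balancing condition are weights of every dimension, strictly positive around x0.
   Lower semicontinuity at x0: cutting an n-cell through an interior point y shows that f is concave
   there, so f(y) is at least the average of f over the vertices, whose coefficient at x0 tends to one.
   The strictly positive weights carry this bound down to the smaller cells.
   Upper semicontinuity: climbing up in dimension, a point y of a cell near x0 takes part in a balanced
   convex combination centered on a facet, with all other points fixed and of vanishing coefficient. *)

theory Submission
  imports Defs
begin

section \<open>Faces of convex polyhedra\<close>

text \<open>Weak concavity controls \<open>f\<close> through all cofaces of a cell at once, and a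
  coface of weight zero cannot contribute a point off the cell with a positive coefficient. So every
  coface must have strictly positive weight, and the weight must be a product of concave functions
  with the balancing condition; the bending function is built for this. As \<iota> takes values in a
  hyperplane off the origin, the inequalities defining the cells can be made linear, so they serve
  both as cuts and as summands of a piecewise affine function. Multiplying by it lowers the
  dimension by one, and balancing turns a bend along one coface into positivity on the face. The two
  bounds need different arguments. A concave function on a polytope is lower semicontinuous but may
  drop at the boundary, so no single cell yields the upper bound: it needs points in the cells on
  the other sides of a facet. These points stay fixed while \<open>y\<close> moves, so the center
  must remain in the facet; hence their weighted mean has to see the whole cell through that
  facet.\<close>

definition dirs :: "'v::euclidean_space set \<Rightarrow> 'v set" where
  "dirs S = span {p - q | p q. p \<in> S \<and> q \<in> S}"

lemma diff_in_dirs: "p \<in> S \<Longrightarrow> q \<in> S \<Longrightarrow> p - q \<in> dirs S"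
  unfolding dirs_def by (rule span_base) auto

lemma dirs_mono: "S \<subseteq> S' \<Longrightarrow> dirs S \<subseteq> dirs S'"
  unfolding dirs_def by (rule span_mono) auto

lemma subspace_dirs [simp]: "subspace (dirs S)"
  unfolding dirs_def by simp

lemma dirs_eq_span_at:
  assumes "q \<in> S" shows "dirs S = span ((\<lambda>x. x - q) ` S)"
proof
  have "p - r \<in> span ((\<lambda>x. x - q) ` S)" if "p \<in> S" "r \<in> S" for p r
  proof -
    have "p - r = (p - q) - (r - q)" by simp
    then show ?thesis using that by (metis imageI span_base span_diff)
  qed
  then show "dirs S \<subseteq> span ((\<lambda>x. x - q) ` S)"
    unfolding dirs_def by (intro span_minimal) auto
  show "span ((\<lambda>x. x - q) ` S) \<subseteq> dirs S"
    by (rule span_minimal) (auto intro: diff_in_dirs assms)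
qed

lemma affine_hull_iff_dirs:
  assumes "q \<in> S" shows "x \<in> affine hull S \<longleftrightarrow> x - q \<in> dirs S"
proof -
  have e: "(\<lambda>x. -q + x) ` S = (\<lambda>x. x - q) ` S" by (rule image_cong) simp_all
  have h: "affine hull S = (\<lambda>v. q + v) ` dirs S"
    unfolding dirs_eq_span_at[OF assms] e[symmetric]
    by (rule affine_hull_span_gen) (rule hull_inc[OF assms])
  show ?thesis
  proof
    assume "x \<in> affine hull S"
    then obtain v where "v \<in> dirs S" "x = q + v" unfolding h by blast
    then show "x - q \<in> dirs S" by simp
  next
    assume "x - q \<in> dirs S"
    then have "q + (x - q) \<in> affine hull S" unfolding h by (rule imageI)
    then show "x \<in> affine hull S" by simp
  qed
qed

lemma aff_dim_dirs:
  assumes "S \<noteq> {}" shows "aff_dim S = int (dim (dirs S))"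
proof -
  obtain q where q: "q \<in> S" using assms by auto
  have e: "(\<lambda>x. -q + x) ` S = (\<lambda>x. x - q) ` S" by (rule image_cong) simp_all
  have "aff_dim S = int (dim ((\<lambda>x. - q + x) ` S))"
    by (rule aff_dim_eq_dim) (rule hull_inc[OF q])
  then show ?thesis unfolding dirs_eq_span_at[OF q] e by simp
qed

lemma span_dirs [simp]: "span (dirs S) = dirs S"
  unfolding dirs_def by (simp add: span_span)

lemma dirs_eqI:
  assumes "S \<subseteq> S'" "S \<noteq> {}" "aff_dim S = aff_dim S'"
  shows "dirs S = dirs S'"
proof -
  have "S' \<noteq> {}" using assms by auto
  then show ?thesis
    using assms by (intro subspace_dim_equal dirs_mono) (simp_all add: aff_dim_dirs)
qed

lemma rel_interior_extend:
  assumes "z \<in> rel_interior S" "d \<in> dirs S"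
  shows "\<exists>e>0. \<forall>t. \<bar>t\<bar> \<le> e \<longrightarrow> z + t *\<^sub>R d \<in> S"
proof -
  from assms(1) obtain e where z: "z \<in> S" and e: "e > 0" "cball z e \<inter> affine hull S \<subseteq> S"
    by (auto simp: mem_rel_interior_cball)
  show ?thesis
  proof (intro exI[of _ "e / (norm d + 1)"] conjI allI impI)
    show "0 < e / (norm d + 1)" using e(1)
      by (intro divide_pos_pos) (auto intro: add_nonneg_pos)
    fix t assume t: "\<bar>t\<bar> \<le> e / (norm d + 1)"
    have "\<bar>t\<bar> * norm d \<le> e / (norm d + 1) * norm d" using t by (intro mult_right_mono) auto
    also have "\<dots> = e * (norm d / (norm d + 1))" by simp
    also have "\<dots> \<le> e * 1" using e(1) by (intro mult_left_mono divide_le_eq_1_pos[THEN iffD2]) (auto intro: add_nonneg_pos)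
    finally have "z + t *\<^sub>R d \<in> cball z e" by (simp add: dist_norm)
    moreover have "z + t *\<^sub>R d \<in> affine hull S"
      using assms(2) by (simp add: affine_hull_iff_dirs[OF z] subspace_scale)
    ultimately show "z + t *\<^sub>R d \<in> S" using e(2) by auto
  qed
qed

text \<open>If one can step from \<open>z\<close> away from every \<open>p\<close> without leaving
  \<open>S\<close>, then \<open>z\<close> lies strictly between \<open>p\<close> and another point
  of \<open>S\<close>, so a face through \<open>z\<close> absorbs \<open>p\<close>. This form of
  relative interiority is easy to check for explicit inequalities.\<close>

lemma face_of_rel_interior_eq:
  assumes F: "F face_of S" and z: "z \<in> F"
    and "\<And>p. p \<in> S \<Longrightarrow> \<exists>t>0. z - t *\<^sub>R (p - z) \<in> S"
  shows "F = S"
proof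
  show "F \<subseteq> S" using F face_of_imp_subset by auto
  show "S \<subseteq> F"
  proof
    fix p assume p: "p \<in> S"
    show "p \<in> F"
    proof (cases "p = z")
      case False
      obtain t where t: "t > 0" "z - t *\<^sub>R (p - z) \<in> S" using assms(3)[OF p] by auto
      have "z \<in> open_segment (z - t *\<^sub>R (p - z)) p"
        unfolding in_segment
      \<comment> \<open>The parameter solving \<open>(1 - r) (z - t (p - z)) + r p = z\<close> for
        \<open>r\<close>.\<close>
      proof (intro conjI exI[of _ "t / (1 + t)"])
        have "z - t *\<^sub>R (p - z) - p = (-1 - t) *\<^sub>R (p - z)" by (simp add: algebra_simps)
        moreover have "(-1 - t) *\<^sub>R (p - z) \<noteq> 0" using t False by (simp)
        ultimately show "z - t *\<^sub>R (p - z) \<noteq> p" by auto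
        have "1 - t / (1+t) = 1 / (1+t)" using t by (simp add: field_simps)
        moreover have "(1 / (1 + t)) *\<^sub>R (z - t *\<^sub>R (p - z)) + (t / (1 + t)) *\<^sub>R p
            = (1/(1+t)) *\<^sub>R ((1 + t) *\<^sub>R z)"
          by (simp add: algebra_simps)
        moreover have "(1/(1+t)) *\<^sub>R ((1 + t) *\<^sub>R z) = z" using t by simp
        ultimately show "z = (1 - t / (1 + t)) *\<^sub>R (z - t *\<^sub>R (p - z)) + (t / (1 + t)) *\<^sub>R p"
          by simp
      qed (use t in \<open>auto simp: field_simps\<close>)
      then show ?thesis using face_ofD[OF F _ t(2) p z] by blast
    qed (use z in simp)
  qed
qed

text \<open>Descent through facets: a point off the relative interior lies in a facet, whose
  dimension is smaller.\<close>

lemma polyhedron_minimal_face: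
  fixes P :: "'v::euclidean_space set"
  assumes "polyhedron P" "z \<in> P"
  obtains G where "G face_of P" "z \<in> rel_interior G"
proof -
  have "\<exists>G. G face_of P \<and> z \<in> rel_interior G" using assms
  proof (induction "nat (aff_dim P)" arbitrary: P rule: less_induct)
    case less
    show ?case
    proof (cases "z \<in> rel_interior P")
      case True
      then show ?thesis using face_of_refl polyhedron_imp_convex less by blast
    next
      case False
      then obtain F where F: "F facet_of P" "z \<in> F"
        using rel_boundary_of_polyhedron[OF less.prems(1)] less.prems by blast
      have "aff_dim F < aff_dim P" "\<not> aff_dim F < 0"
        using F aff_dim_negative_iff[of F] unfolding facet_of_def by auto
      then have "nat (aff_dim F) < nat (aff_dim P)" by linarith
      from less.hyps[OF this face_of_polyhedron_polyhedron[OF less.prems(1) facet_of_imp_face_of[OF F(1)]] F(2)]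
      obtain G where "G face_of F" "z \<in> rel_interior G" by blast
      then show ?thesis using F face_of_trans facet_of_imp_face_of by blast
    qed
  qed
  then show ?thesis using that by blast
qed

section \<open>Half-spaces through the origin and polyhedra cut by them\<close>

definition half :: "'v::euclidean_space \<Rightarrow> real set \<Rightarrow> 'v set" where
  "half w A = {y. w \<bullet> y \<in> A}"

text \<open>The hyperplane is listed besides the two half-spaces so that the faces created by a cut
  are cells again.\<close>

definition signs :: "real set set" where "signs = {{0..}, {..0}, {0}}"

lemma half_Int: "half w A \<inter> half w B = half w (A \<inter> B)"
  by (auto simp: half_def)

lemma signs_cases: "A \<in> signs \<Longrightarrow> (A = {0..} \<Longrightarrow> P) \<Longrightarrow> (A = {..0} \<Longrightarrow> P) \<Longrightarrow> (A = {0} \<Longrightarrow> P) \<Longrightarrow> P"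
  by (auto simp: signs_def)

lemma polyhedron_half:
  fixes w :: "'v::euclidean_space"
  shows "A \<in> signs \<Longrightarrow> polyhedron (half w A)"
  using polyhedron_halfspace_ge[where a = w and b = 0]
    polyhedron_halfspace_le[where a = w and b = 0] polyhedron_hyperplane[where a = w and b = 0]
  by (auto simp: signs_def half_def)

lemma half_face:
  fixes w :: "'v::euclidean_space"
  assumes "A \<in> signs" "B \<in> signs" shows "half w (A \<inter> B) face_of half w A"
proof -
  have 1: "half w A face_of half w A" if "A \<in> signs" for A
    using face_of_refl polyhedron_imp_convex polyhedron_half that by blast
  have 2: "half w {0} face_of half w {0..}" "half w {0} face_of half w {..0}"
    using hyperplane_face_of_halfspace_ge[of w 0] hyperplane_face_of_halfspace_le[of w 0]
    by (auto simp: half_def)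
  have e: "{0..} \<inter> {..0} = {0::real}" "{..0} \<inter> {0..} = {0::real}" by auto
  show ?thesis
    using assms 1[OF assms(1)] 2 by (auto elim!: signs_cases simp: e)
qed

text \<open>For \<open>z\<close> in the relative interior of \<open>F\<close>, take the minimal face
  of \<open>P\<close> at \<open>z\<close> and the sharpest sign condition that \<open>z\<close>
  satisfies. They cut out a face of the intersection in which \<open>z\<close> is again relatively
  interior, and this forces equality with \<open>F\<close>.\<close>

lemma face_of_Int_half:
  fixes P :: "'v::euclidean_space set"
  assumes P: "polyhedron P" and A: "A \<in> signs" and F: "F face_of (P \<inter> half w A)" "F \<noteq> {}"
  obtains G B where "G face_of P" "B \<in> signs" "F = G \<inter> half w B"
proof -
  have "convex F" using F face_of_imp_convex by auto
  then obtain z where z: "z \<in> rel_interior F" using F rel_interior_eq_empty by blast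
  have zF: "z \<in> F" using z rel_interior_subset by auto
  have zP: "z \<in> P" "w \<bullet> z \<in> A" using face_of_imp_subset[OF F(1)] zF by (auto simp: half_def)
  obtain G where G: "G face_of P" "z \<in> rel_interior G" using polyhedron_minimal_face[OF P zP(1)] .
  define B where "B = (if w \<bullet> z = 0 then A \<inter> {0} else A)"
  have B: "B \<in> signs" using A by (auto simp: B_def signs_def)
  have BA: "B = A \<inter> B" by (auto simp: B_def)
  have Gf: "(G \<inter> half w B) face_of (P \<inter> half w A)"
    by (subst BA) (rule face_of_Int_Int[OF G(1) half_face[OF A B]])
  have zG: "z \<in> G \<inter> half w B" using G(2) rel_interior_subset zP by (auto simp: B_def half_def)
  have "F \<subseteq> G \<inter> half w B"
    by (rule subset_of_face_of[OF Gf face_of_imp_subset[OF F(1)]]) (use zG z in blast)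
  then have "F face_of (G \<inter> half w B)"
    using F(1) Gf by (meson face_of_face)
  moreover have "\<exists>t>0. z - t *\<^sub>R (p - z) \<in> G \<inter> half w B" if p: "p \<in> G \<inter> half w B" for p
  proof -
    obtain e where e: "e > 0" "\<And>t. \<bar>t\<bar> \<le> e \<Longrightarrow> z + t *\<^sub>R (p - z) \<in> G"
      using rel_interior_extend[OF G(2), of "p - z"] diff_in_dirs[of p G z] p zG by blast
    \<comment> \<open>Short enough that \<open>w\<close> does not change sign along the step; the
      \<open>+ 1\<close> covers \<open>w \<bullet> (p - z) = 0\<close>.\<close>
    define t where "t = min e (\<bar>w \<bullet> z\<bar> / (\<bar>w \<bullet> (p - z)\<bar> + 1))"
    have wt: "w \<bullet> (z - t *\<^sub>R (p - z)) = w \<bullet> z - t * (w \<bullet> (p - z))" for t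
      by (simp add: algebra_simps)
    show ?thesis
    proof (cases "w \<bullet> z = 0")
      case True
      then have "w \<bullet> p = 0" using p A by (auto simp: B_def half_def)
      then have "z - e *\<^sub>R (p - z) \<in> half w B" using True zG by (auto simp: half_def algebra_simps)
      then show ?thesis using e(1) e(2)[of "-e"] by auto
    next
      case False
      then have t: "t > 0" "t \<le> e" using e(1) by (auto simp: t_def intro!: divide_pos_pos add_nonneg_pos)
      have "\<bar>t * (w \<bullet> (p - z))\<bar> \<le> \<bar>w \<bullet> z\<bar> / (\<bar>w \<bullet> (p - z)\<bar> + 1) * \<bar>w \<bullet> (p - z)\<bar>"
        unfolding abs_mult using t by (intro mult_right_mono) (auto simp: t_def)
      also have "\<dots> = \<bar>w \<bullet> z\<bar> * (\<bar>w \<bullet> (p - z)\<bar> / (\<bar>w \<bullet> (p - z)\<bar> + 1))" by simp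
      also have "\<dots> \<le> \<bar>w \<bullet> z\<bar> * 1"
        by (intro mult_left_mono divide_le_eq_1_pos[THEN iffD2]) (auto intro: add_nonneg_pos)
      finally have "z - t *\<^sub>R (p - z) \<in> half w A"
        using zP(2) A False unfolding half_def mem_Collect_eq wt by (auto elim!: signs_cases)
      moreover have "z - t *\<^sub>R (p - z) \<in> G" using e(2)[of "-t"] t by auto
      ultimately show ?thesis using t False by (auto simp: B_def)
    qed
  qed
  ultimately have "F = G \<inter> half w B" using face_of_rel_interior_eq zF by blast
  then show ?thesis using that G B by blast
qed

section \<open>Facets and their unit inner normals\<close>

definition wall :: "'v::euclidean_space set \<Rightarrow> 'v set \<Rightarrow> bool" where
  "wall S F \<longleftrightarrow> convex S \<and> F face_of S \<and> F \<noteq> {} \<and> aff_dim S = aff_dim F + 1"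

text \<open>The normal of \<open>nvec\<close>, stated for subsets of the Euclidean space so that it
  can be studied without a complex.\<close>

definition nv :: "'v::euclidean_space set \<Rightarrow> 'v set \<Rightarrow> 'v" where
  "nv S F = (THE v. norm v = 1 \<and> v \<in> span {p - q | p q. p \<in> S \<and> q \<in> S} \<and>
      (\<forall>p\<in>F. \<forall>q\<in>F. v \<bullet> (p - q) = 0) \<and> (\<forall>p\<in>S. \<forall>q\<in>F. v \<bullet> (p - q) \<ge> 0))"

lemma nvec_eq_nv: "nvec \<iota> \<sigma> \<tau> = nv (\<iota> ` \<sigma>) (\<iota> ` \<tau>)"
  by (simp add: nvec_def nv_def)

lemma orth_dirs:
  assumes "\<forall>p\<in>F. \<forall>q\<in>F. v \<bullet> (p - q) = 0" "d \<in> dirs F" shows "v \<bullet> d = 0"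
  using assms(2) unfolding dirs_def
proof (rule span_induct)
  show "subspace {d. v \<bullet> d = 0}" by (auto simp: subspace_def inner_add_right)
qed (use assms(1) in auto)

text \<open>By a dimension count \<open>v\<close> and \<open>dirs F\<close> span
  \<open>dirs S\<close>; orthogonality identifies the coefficient of \<open>v\<close>.\<close>

lemma wall_decomp:
  assumes w: "wall S F" and v: "v \<in> dirs S" "norm v = 1" "\<And>d. d \<in> dirs F \<Longrightarrow> v \<bullet> d = 0"
    and d: "d \<in> dirs S"
  shows "d - (v \<bullet> d) *\<^sub>R v \<in> dirs F"
proof -
  have FS: "F \<subseteq> S" and ne: "F \<noteq> {}" "S \<noteq> {}"
    using w by (auto simp: wall_def face_of_imp_subset)
  have vF: "v \<notin> span (dirs F)"
    using v(2) v(3)[of v] by (auto simp: norm_eq_1)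
  have "span (insert v (dirs F)) = dirs S"
  proof (rule subspace_dim_equal)
    show "span (insert v (dirs F)) \<subseteq> dirs S"
      using v(1) dirs_mono[OF FS] by (intro span_minimal) auto
    have "dim (insert v (dirs F)) = dim (dirs F) + 1" using vF by (simp add: dim_insert)
    moreover have "int (dim (dirs S)) = int (dim (dirs F)) + 1"
      using w aff_dim_dirs[OF ne(1)] aff_dim_dirs[OF ne(2)] by (simp add: wall_def)
    ultimately show "dim (dirs S) \<le> dim (span (insert v (dirs F)))" by simp
  qed simp_all
  then obtain k where k: "d - k *\<^sub>R v \<in> dirs F"
    using d span_breakdown_eq[of d v "dirs F"] by auto
  have "v \<bullet> (d - k *\<^sub>R v) = 0" using v(3) k by auto
  then have "v \<bullet> d = k" using v(2) by (simp add: inner_diff_right norm_eq_1)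
  then show ?thesis using k by simp
qed

lemma wall_orth_zero:
  assumes w: "wall S F" and v: "v \<in> dirs S" "norm v = 1" "\<And>d. d \<in> dirs F \<Longrightarrow> v \<bullet> d = 0"
    and p: "p \<in> S" "q \<in> F" "v \<bullet> (p - q) = 0"
  shows "p \<in> F"
proof -
  have qS: "q \<in> S" using w p face_of_imp_subset by (auto simp: wall_def)
  have "p - q \<in> dirs F"
    using wall_decomp[OF w v diff_in_dirs[OF p(1) qS]] p(3) by simp
  then have "p \<in> affine hull F" using affine_hull_iff_dirs[OF p(2)] by simp
  then show ?thesis using face_of_imp_eq_affine_Int[of S F] w p by (auto simp: wall_def)
qed

lemma wall_other_point:
  assumes "wall S F" obtains p where "p \<in> S" "p \<notin> F"
proof -
  have "F \<noteq> S" "F \<subseteq> S" using assms face_of_imp_subset[of F S] by (auto simp: wall_def)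
  then show ?thesis using that by blast
qed

lemma nv_unique:
  assumes w: "wall S F"
    and v: "v \<in> dirs S" "norm v = 1" "\<And>d. d \<in> dirs F \<Longrightarrow> v \<bullet> d = 0" "\<And>p q. p \<in> S \<Longrightarrow> q \<in> F \<Longrightarrow> v \<bullet> (p - q) \<ge> 0"
    and v': "v' \<in> dirs S" "norm v' = 1" "\<And>d. d \<in> dirs F \<Longrightarrow> v' \<bullet> d = 0" "\<And>p q. p \<in> S \<Longrightarrow> q \<in> F \<Longrightarrow> v' \<bullet> (p - q) \<ge> 0"
  shows "v = v'"
proof -
  have 1: "v' - (v \<bullet> v') *\<^sub>R v \<in> dirs F" (is "?d \<in> _") using wall_decomp[OF w v(1-3) v'(1)] .
  have "?d \<bullet> ?d = v' \<bullet> ?d - (v \<bullet> v') * (v \<bullet> ?d)" by (simp add: inner_diff_left)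
  also have "\<dots> = 0" using v(3)[OF 1] v'(3)[OF 1] by simp
  finally have e: "v' = (v \<bullet> v') *\<^sub>R v" by simp
  then have "norm v' = \<bar>v \<bullet> v'\<bar>" using v(2) by (metis norm_scaleR mult.right_neutral)
  then have a: "\<bar>v \<bullet> v'\<bar> = 1" using v'(2) by simp
  obtain p where p: "p \<in> S" "p \<notin> F" using wall_other_point[OF w] .
  obtain q where q: "q \<in> F" using w by (auto simp: wall_def)
  have "v \<bullet> (p - q) > 0" using v(4)[OF p(1) q] wall_orth_zero[OF w v(1-3) p(1) q] p(2) by force
  moreover have "v' \<bullet> (p - q) = (v \<bullet> v') * (v \<bullet> (p - q))" by (subst e) simp
  ultimately have "v \<bullet> v' \<ge> 0" using v'(4)[OF p(1) q] by (simp add: zero_le_mult_iff)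
  then show ?thesis using a e by simp
qed

lemma nv_exists:
  assumes w: "wall S F"
  obtains v where "v \<in> dirs S" "norm v = 1" "\<And>d. d \<in> dirs F \<Longrightarrow> v \<bullet> d = 0"
    "\<And>p q. p \<in> S \<Longrightarrow> q \<in> F \<Longrightarrow> v \<bullet> (p - q) \<ge> 0"
proof -
  have FS: "F \<subseteq> S" and ne: "F \<noteq> {}" "S \<noteq> {}" and cS: "convex S" and F: "F face_of S"
    using w by (auto simp: wall_def face_of_imp_subset)
  have "dim (dirs F) \<noteq> dim (dirs S)"
    using w aff_dim_dirs[OF ne(1)] aff_dim_dirs[OF ne(2)] by (simp add: wall_def)
  then have "span (dirs F) \<subset> span (dirs S)" using dirs_mono[OF FS] by auto
  then obtain u where u: "u \<noteq> 0" "u \<in> dirs S" "\<And>y. y \<in> dirs F \<Longrightarrow> orthogonal u y"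
    by (rule orthogonal_to_subspace_exists_gen) auto
  obtain p0 where p0: "p0 \<in> S" "p0 \<notin> F" using wall_other_point[OF w] .
  obtain q0 where q0: "q0 \<in> F" using w by (auto simp: wall_def)
  \<comment> \<open>The sign turns \<open>u\<close> towards \<open>p0\<close>, a point of
    \<open>S\<close> off \<open>F\<close>.\<close>
  define s where "s = (if u \<bullet> (p0 - q0) \<ge> 0 then 1 else -1 :: real)"
  define v where "v = (s / norm u) *\<^sub>R u"
  have v1: "v \<in> dirs S" unfolding v_def using u by (simp add: subspace_scale)
  have v2: "norm v = 1" using u by (simp add: v_def s_def)
  have v3: "v \<bullet> d = 0" if "d \<in> dirs F" for d using u(3)[OF that] by (simp add: v_def orthogonal_def)
  have vq: "v \<bullet> (p - q) = v \<bullet> (p - q0)" if "q \<in> F" for p q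
    using v3[OF diff_in_dirs[OF that q0]] by (simp add: inner_diff_right)
  have "v \<bullet> (p0 - q0) \<ge> 0" by (simp add: v_def s_def)
  then have pos0: "v \<bullet> (p0 - q0) > 0" using wall_orth_zero[OF w v1 v2 v3 p0(1) q0] p0(2) by force
  have "v \<bullet> (p - q0) \<ge> 0" if p: "p \<in> S" for p
  proof (rule ccontr)
    assume "\<not> ?thesis"
    then have neg: "v \<bullet> (p - q0) < 0" by simp
    \<comment> \<open>The segment from \<open>p0\<close> to \<open>p\<close> would cross the level
      of \<open>F\<close> at the point \<open>r\<close> where the heights \<open>a\<close> and
      \<open>-b\<close> cancel; then \<open>r\<close> lies in the face \<open>F\<close> and drags
      \<open>p0\<close> into it.\<close>
    define a where "a = v \<bullet> (p0 - q0)"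
    define b where "b = - (v \<bullet> (p - q0))"
    have ab: "a > 0" "b > 0" using pos0 neg by (auto simp: a_def b_def)
    define r where "r = (1 - a/(a+b)) *\<^sub>R p0 + (a/(a+b)) *\<^sub>R p"
    have r: "r \<in> open_segment p0 p"
      unfolding in_segment r_def
    proof (intro conjI exI[of _ "a/(a+b)"])
      show "p0 \<noteq> p" using pos0 neg by auto
    qed (use ab in \<open>auto simp: field_simps\<close>)
    have rS: "r \<in> S" using r cS p p0(1) by (meson convex_contains_open_segment subsetD)
    have r': "r - q0 = (1 - a/(a+b)) *\<^sub>R (p0 - q0) + (a/(a+b)) *\<^sub>R (p - q0)"
      by (simp add: r_def algebra_simps)
    have "v \<bullet> (r - q0) = (1 - a/(a+b)) * a + (a/(a+b)) * (- b)"
      unfolding r' by (simp add: inner_add_right a_def b_def)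
    also have "\<dots> = 0" using ab by (simp add: field_simps)
    finally have "r \<in> F" using wall_orth_zero[OF w v1 v2 v3 rS q0] by simp
    then have "p0 \<in> F" using face_ofD[OF F r p0(1) p] by simp
    then show False using p0 by simp
  qed
  then show ?thesis using that[of v] v1 v2 v3 vq by auto
qed

lemma nv_props:
  assumes w: "wall S F"
  shows "nv S F \<in> dirs S" "norm (nv S F) = 1" "\<And>d. d \<in> dirs F \<Longrightarrow> nv S F \<bullet> d = 0"
    "\<And>p q. p \<in> S \<Longrightarrow> q \<in> F \<Longrightarrow> nv S F \<bullet> (p - q) \<ge> 0"
proof -
  obtain v where v: "v \<in> dirs S" "norm v = 1" "\<And>d. d \<in> dirs F \<Longrightarrow> v \<bullet> d = 0"
    "\<And>p q. p \<in> S \<Longrightarrow> q \<in> F \<Longrightarrow> v \<bullet> (p - q) \<ge> 0" using nv_exists[OF w] by metis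
  have "nv S F = v"
    unfolding nv_def
  proof (rule the_equality)
    show "norm v = 1 \<and> v \<in> span {p - q |p q. p \<in> S \<and> q \<in> S} \<and>
      (\<forall>p\<in>F. \<forall>q\<in>F. v \<bullet> (p - q) = 0) \<and> (\<forall>p\<in>S. \<forall>q\<in>F. 0 \<le> v \<bullet> (p - q))"
      using v diff_in_dirs[of _ F] unfolding dirs_def by blast
    fix v' assume v': "norm v' = 1 \<and> v' \<in> span {p - q |p q. p \<in> S \<and> q \<in> S} \<and>
      (\<forall>p\<in>F. \<forall>q\<in>F. v' \<bullet> (p - q) = 0) \<and> (\<forall>p\<in>S. \<forall>q\<in>F. 0 \<le> v' \<bullet> (p - q))"
    show "v' = v"
      by (rule nv_unique[OF w _ _ _ _ v]) (use v' orth_dirs[of F v'] in \<open>auto simp: dirs_def\<close>)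
  qed
  then show "nv S F \<in> dirs S" "norm (nv S F) = 1" "\<And>d. d \<in> dirs F \<Longrightarrow> nv S F \<bullet> d = 0"
    "\<And>p q. p \<in> S \<Longrightarrow> q \<in> F \<Longrightarrow> nv S F \<bullet> (p - q) \<ge> 0" using v by auto
qed

lemma nv_eqI:
  assumes w: "wall S F"
    and v: "v \<in> dirs S" "norm v = 1" "\<And>d. d \<in> dirs F \<Longrightarrow> v \<bullet> d = 0" "\<And>p q. p \<in> S \<Longrightarrow> q \<in> F \<Longrightarrow> v \<bullet> (p - q) \<ge> 0"
  shows "nv S F = v"
  using nv_unique[OF w nv_props[OF w] v] .

lemma nv_decomp:
  assumes w: "wall S F" and d: "d \<in> dirs S"
  shows "d - (nv S F \<bullet> d) *\<^sub>R nv S F \<in> dirs F"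
  using wall_decomp[OF w nv_props(1-3)[OF w] d] .

lemma nv_pos:
  assumes w: "wall S F" and "p \<in> S" "p \<notin> F" "q \<in> F"
  shows "nv S F \<bullet> (p - q) > 0"
  using nv_props(4)[OF w assms(2,4)] wall_orth_zero[OF w nv_props(1-3)[OF w] assms(2,4)] assms(3) by force

text \<open>Turns the distance in \<open>balanced_cc\<close> into a height along the unit normal:
  subtracting the normal part of \<open>p - q\<close> gives a point of the affine hull, and by
  Cauchy-Schwarz no other one is closer.\<close>

lemma infdist_wall:
  assumes w: "wall S F" and p: "p \<in> S" and q: "q \<in> F"
  shows "infdist p (affine hull F) = nv S F \<bullet> (p - q)"
proof (rule antisym)
  let ?v = "nv S F" let ?t = "nv S F \<bullet> (p - q)"
  have qS: "q \<in> S" using w q face_of_imp_subset by (auto simp: wall_def)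
  have "p - ?t *\<^sub>R ?v - q \<in> dirs F"
    using nv_decomp[OF w diff_in_dirs[OF p qS]] by (simp add: algebra_simps)
  then have "p - ?t *\<^sub>R ?v \<in> affine hull F" using affine_hull_iff_dirs[OF q] by simp
  then have "infdist p (affine hull F) \<le> dist p (p - ?t *\<^sub>R ?v)" by (rule infdist_le)
  also have "\<dots> = ?t" using nv_props[OF w] p q by (simp add: dist_norm)
  finally show "infdist p (affine hull F) \<le> ?t" .
  show "?t \<le> infdist p (affine hull F)"
    unfolding infdist_def
  proof (subst if_not_P)
    show ne: "affine hull F \<noteq> {}" using q by auto
    show "?t \<le> (INF a\<in>affine hull F. dist p a)"
    proof (rule cINF_greatest[OF ne])
      fix r assume "r \<in> affine hull F"
      then have "?v \<bullet> (r - q) = 0" using affine_hull_iff_dirs[OF q] nv_props(3)[OF w] by auto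
      then have "?t = ?v \<bullet> (p - r)" by (simp add: inner_diff_right)
      also have "\<dots> \<le> norm ?v * norm (p - r)" by (rule norm_cauchy_schwarz)
      finally show "?t \<le> dist p r" using nv_props(2)[OF w] by (simp add: dist_norm)
    qed
  qed
qed

text \<open>Compare with a point \<open>p\<close> of the relative interior of \<open>S\<close>: a
  short step from \<open>z\<close> along the normal lies on a segment from a point of
  \<open>F\<close> to \<open>p\<close>, and such a segment is relatively interior except possibly at
  its start.\<close>

lemma nv_move:
  assumes w: "wall S F" and z: "z \<in> rel_interior F"
  shows "\<exists>e>0. \<forall>t. 0 < t \<and> t \<le> e \<longrightarrow> z + t *\<^sub>R nv S F \<in> rel_interior S"
proof -
  let ?v = "nv S F"
  have cS: "convex S" and FS: "F \<subseteq> S" using w by (auto simp: wall_def face_of_imp_subset)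
  have zF: "z \<in> F" using z rel_interior_subset by auto
  have neS: "S \<noteq> {}" using zF FS by auto
  obtain p where p: "p \<in> rel_interior S" using cS rel_interior_eq_empty neS by blast
  have pS: "p \<in> S" using p rel_interior_subset by auto
  have FneS: "F \<noteq> S" using w by (auto simp: wall_def)
  have pF: "p \<notin> F" using face_of_disjoint_rel_interior[of F S] w FneS p by (auto simp: wall_def)
  define a where "a = ?v \<bullet> (p - z)"
  have a: "a > 0" using nv_pos[OF w pS pF zF] by (simp add: a_def)
  define d where "d = p - z - a *\<^sub>R ?v"
  have d: "d \<in> dirs F" using nv_decomp[OF w diff_in_dirs[OF pS]] zF FS by (auto simp: d_def a_def)
  obtain e where e: "e > 0" "\<And>t. \<bar>t\<bar> \<le> e \<Longrightarrow> z + t *\<^sub>R d \<in> F"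
    using rel_interior_extend[OF z d] by auto
  show ?thesis
  proof (intro exI[of _ "a * (e / (1 + e))"] conjI allI impI)
    show "0 < a * (e / (1 + e))" using a e by simp
    fix t assume t: "0 < t \<and> t \<le> a * (e / (1 + e))"
    define l where "l = t / a"
    have l: "l > 0" "l \<le> e / (1+e)" using t a by (auto simp: l_def field_simps)
    have l1: "l < 1" using l(2) e(1) by (smt (verit) divide_less_eq_1_pos)
    have le: "l / (1 - l) \<le> e" using l l1 e(1) by (simp add: field_simps)
    \<comment> \<open>Shifted within \<open>F\<close> so that the tangential part \<open>d\<close>
      of \<open>p - z\<close> cancels in \<open>(1 - l) r + l p\<close>, leaving
      \<open>z + t v\<close> for \<open>l = t / a\<close>.\<close>
    define r where "r = z - (l/(1-l)) *\<^sub>R d"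
    have rS: "r \<in> S" using e(2)[of "- (l/(1-l))"] le l l1 FS by (auto simp: r_def)
    have "z + t *\<^sub>R ?v = r - l *\<^sub>R (r - p)"
    proof -
      have "r - l *\<^sub>R (r - p) = (1 - l) *\<^sub>R r + l *\<^sub>R p" by (simp add: algebra_simps)
      also have "(1-l) *\<^sub>R r = (1-l) *\<^sub>R z - l *\<^sub>R d" using l1 by (simp add: r_def scaleR_diff_right)
      also have "(1-l) *\<^sub>R z - l *\<^sub>R d + l *\<^sub>R p = z + l *\<^sub>R (p - z - d)" by (simp add: algebra_simps)
      also have "p - z - d = a *\<^sub>R ?v" by (simp add: d_def)
      also have "l *\<^sub>R (a *\<^sub>R ?v) = t *\<^sub>R ?v" using a by (simp add: l_def)
      finally show ?thesis by simp
    qed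
    then show "z + t *\<^sub>R ?v \<in> rel_interior S"
      using rel_interior_convex_shrink[OF cS p rS l(1)] l1 by simp
  qed
qed

text \<open>A step from \<open>R\<close> along \<open>nv F' R\<close> enters the relative interior
  of \<open>F'\<close>, which avoids the different face \<open>F\<close> of the same dimension; its
  height over \<open>F\<close> is therefore positive.\<close>

lemma nv_inner_pos:
  assumes "wall S F" "wall S F'" "wall F' R" "R \<subseteq> F" "F \<noteq> F'"
  shows "nv S F \<bullet> nv F' R > 0"
proof -
  have "convex R" "R \<noteq> {}" using assms(3) face_of_imp_convex by (auto simp: wall_def)
  then obtain z where z: "z \<in> rel_interior R" using rel_interior_eq_empty by blast
  then have zF: "z \<in> F" using rel_interior_subset assms(4) by auto
  obtain e where e: "e > 0" "z + e *\<^sub>R nv F' R \<in> rel_interior F'"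
    using nv_move[OF assms(3) z] by auto
  have fS: "F' face_of S" "F face_of S" "F' \<subseteq> S" using assms by (auto simp: wall_def face_of_imp_subset)
  then have pS: "z + e *\<^sub>R nv F' R \<in> S" using e(2) rel_interior_subset by blast
  have "z + e *\<^sub>R nv F' R \<notin> F"
  proof
    assume "z + e *\<^sub>R nv F' R \<in> F"
    then have "F' \<subseteq> F" using subset_of_face_of[OF fS(2,3)] e(2) by blast
    then have "F' face_of F" using face_of_subset[OF fS(1)] fS(2) face_of_imp_subset by blast
    moreover have "aff_dim F' = aff_dim F" using assms by (auto simp: wall_def)
    moreover have "convex F" using fS(2) face_of_imp_convex by auto
    ultimately show False using face_of_aff_dim_lt[of F F'] assms(5) by auto
  qed
  then have "nv S F \<bullet> (z + e *\<^sub>R nv F' R - z) > 0" using nv_pos[OF assms(1) pS _ zF] by auto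
  then show ?thesis using e(1) by (simp add: zero_less_mult_iff)
qed

section \<open>The normal plane of a codimension two face\<close>

lemma codim2_coords:
  assumes SF: "wall S F" and FR: "wall F R"
    and x: "x \<in> dirs S" "\<And>d. d \<in> dirs R \<Longrightarrow> x \<bullet> d = 0"
  shows "x = (nv F R \<bullet> x) *\<^sub>R nv F R + (nv S F \<bullet> x) *\<^sub>R nv S F"
proof -
  let ?u = "nv F R" and ?w = "nv S F"
  have uw: "?u \<bullet> ?w = 0" using nv_props(3)[OF SF nv_props(1)[OF FR]] by (simp add: inner_commute)
  have R: "dirs R \<subseteq> dirs F" using FR by (auto simp: wall_def dest!: face_of_imp_subset intro!: dirs_mono)
  \<comment> \<open>The residual lies in \<open>dirs R\<close> and is orthogonal to it.\<close>
  define e where "e = x - (?w \<bullet> x) *\<^sub>R ?w - (?u \<bullet> x) *\<^sub>R ?u"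
  have "x - (?w \<bullet> x) *\<^sub>R ?w \<in> dirs F" using nv_decomp[OF SF x(1)] .
  from nv_decomp[OF FR this] have e: "e \<in> dirs R" by (simp add: e_def inner_diff_right uw)
  have "e \<bullet> e = x \<bullet> e - (?w \<bullet> x) * (?w \<bullet> e) - (?u \<bullet> x) * (?u \<bullet> e)"
    by (subst (1) e_def) (simp add: inner_diff_left)
  also have "\<dots> = 0" using x(2)[OF e] nv_props(3)[OF SF, of e] nv_props(3)[OF FR e] e R by auto
  finally have "e = 0" by simp
  then show ?thesis by (simp add: e_def algebra_simps)
qed

text \<open>A unit vector orthogonal to \<open>(a, s)\<close> is \<open>(s, -a)\<close> or its
  negative, and the signs decide. Up to sign, \<open>k\<close> is the determinant of the
  pair.\<close>

lemma real_rotation: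
  fixes a s a' s' :: real
  assumes "a\<^sup>2 + s\<^sup>2 = 1" "a'\<^sup>2 + s'\<^sup>2 = 1" "a * a' + s * s' = 0" "s > 0" "a' > 0"
  shows "a' = s" "s' = -a"
proof -
  define k where "k = s * a' - a * s'"
  have "a' * (a\<^sup>2 + s\<^sup>2) = s * k + a * (a * a' + s * s')" by (simp add: k_def power2_eq_square algebra_simps)
  then have 1: "a' = s * k" using assms by simp
  have "s' * (a\<^sup>2 + s\<^sup>2) = s * (a * a' + s * s') - a * k" by (simp add: k_def power2_eq_square algebra_simps)
  then have 2: "s' = - (a * k)" using assms by simp
  have "k\<^sup>2 * (a\<^sup>2 + s\<^sup>2) = a'\<^sup>2 + s'\<^sup>2" unfolding 1 2 by (simp add: power2_eq_square algebra_simps)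
  then have "k\<^sup>2 = 1" using assms by simp
  moreover have "k > 0" using 1 assms by (simp add: zero_less_mult_iff)
  ultimately have "k = 1" by (simp add: power2_eq_1_iff)
  then show "a' = s" "s' = -a" using 1 2 by auto
qed

text \<open>Both pairs of normals are orthonormal bases of the plane orthogonal to
  \<open>dirs R\<close> in \<open>dirs S\<close>. Applied with the roles of the facets exchanged,
  \<open>nv_inner_pos\<close> fixes the remaining sign.\<close>

lemma diamond_pair:
  assumes w: "wall S F" "wall S F'" "wall F R" "wall F' R" and ne: "F \<noteq> F'"
  defines "a \<equiv> nv F R \<bullet> nv F' R" and "s \<equiv> nv S F \<bullet> nv F' R"
  shows "nv F' R = a *\<^sub>R nv F R + s *\<^sub>R nv S F" "nv S F' = s *\<^sub>R nv F R - a *\<^sub>R nv S F"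
    "s > 0" "a\<^sup>2 + s\<^sup>2 = 1"
proof -
  let ?u = "nv F R" and ?w = "nv S F" and ?u' = "nv F' R" and ?w' = "nv S F'"
  have sub: "R \<subseteq> F" "R \<subseteq> F'" "F \<subseteq> S" "F' \<subseteq> S" using w by (auto simp: wall_def dest!: face_of_imp_subset)
  have uw: "?u \<bullet> ?w = 0" using nv_props(3)[OF w(1) nv_props(1)[OF w(3)]] by (simp add: inner_commute)
  have uw': "?u' \<bullet> ?w' = 0" using nv_props(3)[OF w(2) nv_props(1)[OF w(4)]] by (simp add: inner_commute)
  have nn: "?u \<bullet> ?u = 1" "?w \<bullet> ?w = 1" "?u' \<bullet> ?u' = 1" "?w' \<bullet> ?w' = 1"
    using nv_props(2) w by (simp_all add: norm_eq_1[symmetric])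
  have u': "?u' = a *\<^sub>R ?u + s *\<^sub>R ?w"
    unfolding a_def s_def
    by (rule codim2_coords[OF w(1,3)]) (use nv_props[OF w(4)] dirs_mono[OF sub(4)] in auto)
  define a' s' where "a' = ?u \<bullet> ?w'" and "s' = ?w \<bullet> ?w'"
  have w': "?w' = a' *\<^sub>R ?u + s' *\<^sub>R ?w"
    unfolding a'_def s'_def
    by (rule codim2_coords[OF w(1,3)]) (use nv_props[OF w(2)] dirs_mono[OF sub(2)] in auto)
  show s: "s > 0" unfolding s_def using nv_inner_pos[OF w(1,2,4) sub(1) ne] .
  have a': "a' > 0" unfolding a'_def using nv_inner_pos[OF w(2,1,3) sub(2)] ne by (simp add: inner_commute)
  have "?u' \<bullet> ?u' = a\<^sup>2 + s\<^sup>2"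
    unfolding u' using nn uw by (simp add: inner_add_left inner_add_right inner_commute power2_eq_square)
  then show 1: "a\<^sup>2 + s\<^sup>2 = 1" using nn by simp
  have "?w' \<bullet> ?w' = a'\<^sup>2 + s'\<^sup>2"
    unfolding w' using nn uw by (simp add: inner_add_left inner_add_right inner_commute power2_eq_square)
  then have 2: "a'\<^sup>2 + s'\<^sup>2 = 1" using nn by simp
  have "?u' \<bullet> ?w' = a * a' + s * s'"
    unfolding u' w' using nn uw by (simp add: inner_add_left inner_add_right inner_commute)
  then have 3: "a * a' + s * s' = 0" using uw' by simp
  show "?u' = a *\<^sub>R ?u + s *\<^sub>R ?w" by (rule u')
  show "?w' = s *\<^sub>R ?u - a *\<^sub>R ?w" using w' real_rotation[OF 1 2 3 s a'] by simp
qed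

text \<open>A codimension two face lies in exactly two facets, and the two orthonormal frames they
  induce on the normal plane have opposite orientation.\<close>

lemma diamond:
  fixes S R :: "'v::euclidean_space set" and g :: "'v \<Rightarrow> real"
  assumes P: "polyhedron S" and R: "R face_of S" "R \<noteq> {}" "aff_dim S = aff_dim R + 2"
    and g: "linear g"
  shows "(\<Sum>F\<in>{F. F face_of S \<and> R \<subseteq> F \<and> aff_dim F = aff_dim R + 1}.
           g (nv S F) *\<^sub>R nv F R) =
         (\<Sum>F\<in>{F. F face_of S \<and> R \<subseteq> F \<and> aff_dim F = aff_dim R + 1}.
           g (nv F R) *\<^sub>R nv S F)"
proof -
  let ?A = "{F. F face_of S \<and> R \<subseteq> F \<and> aff_dim F = aff_dim R + 1}"
  have cS: "convex S" using P polyhedron_imp_convex by auto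
  have w1: "wall S F" if "F \<in> ?A" for F using that R cS by (auto simp: wall_def)
  have w2: "wall F R" if "F \<in> ?A" for F
  proof -
    have F: "F face_of S" "R \<subseteq> F" "aff_dim F = aff_dim R + 1" using that by auto
    then show ?thesis
      using R(2) face_of_subset[OF R(1) F(2) face_of_imp_subset[OF F(1)]] face_of_imp_convex[OF F(1)]
      by (simp add: wall_def)
  qed
  have fac: "F \<in> ?A" if "F facet_of S" "R \<subseteq> F" for F using that R by (auto simp: facet_of_def)
  have RS: "R \<noteq> S" using R by auto
  obtain F1 where F1: "F1 facet_of S" "R \<subseteq> F1"
    using face_of_polyhedron_subset_facet[OF P R(1,2) RS] by auto
  have "\<exists>F2. F2 facet_of S \<and> R \<subseteq> F2 \<and> F2 \<noteq> F1"
  \<comment> \<open>A proper face is the intersection of the facets that contain it, so a single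
    facet would have to equal \<open>R\<close>.\<close>
  proof (rule ccontr)
    assume "\<not> ?thesis"
    then have "\<And>F. F facet_of S \<and> R \<subseteq> F \<longleftrightarrow> F = F1" using F1 by blast
    then have "{F. F facet_of S \<and> R \<subseteq> F} = {F1}" by simp
    then have "R = F1" using face_of_polyhedron[OF P R(1,2) RS] by simp
    then show False using F1 R by (auto simp: facet_of_def)
  qed
  then obtain F2 where F2: "F2 facet_of S" "R \<subseteq> F2" "F2 \<noteq> F1" by auto
  note A = fac[OF F1] fac[OF F2(1,2)]
  define a s where "a = nv F1 R \<bullet> nv F2 R" and "s = nv S F1 \<bullet> nv F2 R"
  note d2 = diamond_pair[OF w1[OF A(1)] w1[OF A(2)] w2[OF A(1)] w2[OF A(2)] F2(3)[symmetric], folded a_def s_def]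
  have nn: "nv F1 R \<bullet> nv F1 R = 1" "nv S F1 \<bullet> nv S F1 = 1"
    using nv_props(2) w1[OF A(1)] w2[OF A(1)] by (simp_all add: norm_eq_1[symmetric])
  have uw: "nv F1 R \<bullet> nv S F1 = 0" "nv S F1 \<bullet> nv F1 R = 0"
    using nv_props(3)[OF w1[OF A(1)] nv_props(1)[OF w2[OF A(1)]]] by (simp_all add: inner_commute)
  have eq: "?A = {F1, F2}"
  proof -
    have "F = F1 \<or> F = F2" if F: "F \<in> ?A" for F
    \<comment> \<open>In the coordinates given by \<open>F1\<close>, the products
      \<open>nv S F2 \<bullet> nv F R\<close> and \<open>nv S F \<bullet> nv F2 R\<close> are
      negatives of each other, yet both are positive.\<close>
    proof (rule ccontr)
      assume "\<not> ?thesis"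
      then have ne: "F1 \<noteq> F" "F2 \<noteq> F" by auto
      define b t where "b = nv F1 R \<bullet> nv F R" and "t = nv S F1 \<bullet> nv F R"
      note d3 = diamond_pair[OF w1[OF A(1)] w1[OF F] w2[OF A(1)] w2[OF F] ne(1), folded b_def t_def]
      have "nv S F2 \<bullet> nv F R > 0"
        by (rule nv_inner_pos[OF w1[OF A(2)] w1[OF F] w2[OF F] F2(2) ne(2)])
      moreover have "nv S F2 \<bullet> nv F R = s * b - a * t"
        unfolding d2(2) d3(1) using nn uw by (simp add: inner_add_left inner_add_right inner_diff_left)
      moreover have "nv S F \<bullet> nv F2 R > 0"
        by (rule nv_inner_pos[OF w1[OF F] w1[OF A(2)] w2[OF A(2)]]) (use F ne in auto)
      moreover have "nv S F \<bullet> nv F2 R = t * a - b * s"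
        unfolding d3(2) d2(1) using nn uw by (simp add: inner_add_left inner_add_right inner_diff_left)
      ultimately show False by (simp add: mult.commute)
    qed
    then show ?thesis using A by blast
  qed
  let ?u = "nv F1 R" and ?w = "nv S F1"
  define x y where "x = g ?u" and "y = g ?w"
  have g2: "g (nv F2 R) = a * x + s * y" "g (nv S F2) = s * x - a * y"
    unfolding d2(1,2) x_def y_def using g by (simp_all add: linear_add linear_diff linear_scale)
  have "(s * x - a * y) *\<^sub>R nv F2 R - (a * x + s * y) *\<^sub>R nv S F2
      = (- ((a\<^sup>2 + s\<^sup>2) * y)) *\<^sub>R ?u + ((a\<^sup>2 + s\<^sup>2) * x) *\<^sub>R ?w"
    unfolding d2(1,2) by (simp add: algebra_simps power2_eq_square)
  also have "\<dots> = x *\<^sub>R ?w - y *\<^sub>R ?u" unfolding d2(4) by simp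
  finally show ?thesis unfolding eq using F2(3)[symmetric]
    by (simp add: g2 x_def[symmetric] y_def[symmetric] algebra_simps)
qed

text \<open>Descends through facets containing \<open>R\<close> until one dimension is left.\<close>

lemma face_chain:
  assumes "polyhedron S" "R face_of S" "R \<noteq> {}" "R \<noteq> S"
  obtains F where "F face_of S" "R \<subseteq> F" "aff_dim F = aff_dim R + 1"
proof -
  have "\<exists>F. F face_of S \<and> R \<subseteq> F \<and> aff_dim F = aff_dim R + 1" using assms
  proof (induction "nat (aff_dim S)" arbitrary: S rule: less_induct)
    case less
    have cS: "convex S" using less polyhedron_imp_convex by auto
    show ?case
    proof (cases "aff_dim S = aff_dim R + 1")
      case True
      then show ?thesis using less.prems cS face_of_refl face_of_imp_subset by blast
    next
      case False
      obtain F where F: "F facet_of S" "R \<subseteq> F"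
        using face_of_polyhedron_subset_facet less.prems by metis
      then have F': "F face_of S" "F \<noteq> {}" "aff_dim F = aff_dim S - 1" by (auto simp: facet_of_def)
      have "R \<noteq> F" using False F' by auto
      moreover have "R face_of F" using face_of_subset[OF less.prems(2) F(2)] F' face_of_imp_subset by blast
      moreover have "polyhedron F" using face_of_polyhedron_polyhedron less.prems F' by blast
      moreover have "nat (aff_dim F) < nat (aff_dim S)"
        using F' aff_dim_negative_iff[of F] by linarith
      ultimately show ?thesis using less.hyps[of F] less.prems(3) F'(1) face_of_trans by blast
    qed
  qed
  then show ?thesis using that by blast
qed

text \<open>The affine hulls are removed one after the other. Each removal leaves an open set, and a
  nonempty relatively open part of \<open>S\<close> has full dimension, so it cannot be exhausted by
  a smaller affine hull.\<close>

lemma open_not_covered_by_lower_dim: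
  fixes S :: "'v::euclidean_space set"
  assumes "finite \<F>" "convex S" "open W" "S \<inter> W \<noteq> {}" "\<And>A. A \<in> \<F> \<Longrightarrow> aff_dim A < aff_dim S"
  shows "\<not> S \<inter> W \<subseteq> \<Union>\<F>"
  using assms
proof (induction \<F> arbitrary: W rule: finite_induct)
  case (insert A \<F>)
  let ?W = "W \<inter> - (affine hull A)"
  have "open ?W" using insert.prems(2) closed_affine_hull by (intro open_Int) (auto)
  moreover have "S \<inter> ?W \<noteq> {}"
  proof
    assume "S \<inter> ?W = {}"
    then have "S \<inter> W \<subseteq> affine hull A" by auto
    then have "aff_dim (S \<inter> W) \<le> aff_dim A"
      using aff_dim_subset[of "S \<inter> W" "affine hull A"] by simp
    then show False
      using aff_dim_convex_Int_open[OF insert.prems(1,2,3)] insert.prems(4)[of A] by simp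
  qed
  ultimately have "\<not> S \<inter> ?W \<subseteq> \<Union>\<F>"
    using insert.IH[of ?W] insert.prems by auto
  then show ?case using hull_subset[of A affine] by blast
qed auto

section \<open>Polyhedral complexes and hyperplane cuts\<close>

lemma epcD:
  assumes "epc_complex T \<iota> PP"
  shows "\<And>\<sigma>. \<sigma> \<in> PP \<Longrightarrow> closedin T \<sigma>" "\<Union>PP = topspace T" "locally_finite_in T PP"
    "\<And>\<sigma>. \<sigma> \<in> PP \<Longrightarrow> inj_on \<iota> \<sigma>" "\<And>\<sigma>. \<sigma> \<in> PP \<Longrightarrow> polyhedron (\<iota> ` \<sigma>)"
    "\<And>\<sigma>. \<sigma> \<in> PP \<Longrightarrow> convex (\<iota> ` \<sigma>)"
    "\<And>\<sigma>. \<sigma> \<in> PP \<Longrightarrow> homeomorphic_map (subtopology T \<sigma>) (top_of_set (\<iota> ` \<sigma>)) \<iota>"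
    "\<And>\<sigma> F. \<sigma> \<in> PP \<Longrightarrow> F face_of (\<iota> ` \<sigma>) \<Longrightarrow> \<sigma> \<inter> \<iota> -` F \<in> PP"
    "\<And>\<sigma> \<sigma>'. \<sigma> \<in> PP \<Longrightarrow> \<sigma>' \<in> PP \<Longrightarrow> \<iota> ` (\<sigma> \<inter> \<sigma>') face_of (\<iota> ` \<sigma>)"
    "\<And>\<sigma>. \<sigma> \<in> PP \<Longrightarrow> \<sigma> \<subseteq> topspace T"
  using assms unfolding epc_complex_def
  by (auto intro: polyhedron_imp_convex dest: closedin_subset)

lemma inj_on_image_subsetD: "inj_on f C \<Longrightarrow> A \<subseteq> C \<Longrightarrow> B \<subseteq> C \<Longrightarrow> f ` A \<subseteq> f ` B \<Longrightarrow> A \<subseteq> B"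
  unfolding inj_on_def by blast

text \<open>The two cells meet in a face of \<open>\<sigma>'\<close>, and a face through a relative
  interior point is everything. Incidences between cells are derived from single points in this
  way.\<close>

lemma cell_face:
  assumes e: "epc_complex T \<iota> PP" and s: "\<sigma> \<in> PP" "\<sigma>' \<in> PP"
    and x: "x \<in> \<sigma>" "x \<in> \<sigma>'" "\<iota> x \<in> rel_interior (\<iota> ` \<sigma>')"
  shows "\<sigma>' \<subseteq> \<sigma>"
proof -
  have "\<iota> ` (\<sigma>' \<inter> \<sigma>) face_of (\<iota> ` \<sigma>')" using epcD(9)[OF e] s by auto
  then have "\<iota> ` \<sigma>' \<subseteq> \<iota> ` (\<sigma>' \<inter> \<sigma>)" by (rule subset_of_face_of) (use x in auto)
  then have "\<sigma>' \<subseteq> \<sigma>' \<inter> \<sigma>"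
    by (intro inj_on_image_subsetD[OF epcD(4)[OF e s(2)], of \<sigma>' "\<sigma>' \<inter> \<sigma>"] order_refl Int_lower1)
  then show ?thesis by auto
qed

text \<open>Cells meet in common faces, so inclusion already makes one a face of the other; from
  here on faces are handled as subsets.\<close>

lemma is_face_iff_subset:
  assumes e: "epc_complex T \<iota> PP" and s: "\<sigma> \<in> PP" "\<sigma>' \<in> PP"
  shows "is_face \<iota> \<sigma>' \<sigma> \<longleftrightarrow> \<sigma>' \<subseteq> \<sigma>"
  using epcD(9)[OF e s] by (auto simp: is_face_def Int_absorb1 inf.absorb2)

lemma cell_eqI:
  assumes e: "epc_complex T \<iota> PP" and s: "\<sigma> \<in> PP" "\<sigma>' \<in> PP" and sub: "\<sigma>' \<subseteq> \<sigma>" and d: "pdim \<iota> \<sigma>' = pdim \<iota> \<sigma>"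
  shows "\<sigma>' = \<sigma>"
proof -
  have "is_face \<iota> \<sigma>' \<sigma>" using is_face_iff_subset[OF e s] sub by simp
  then have "\<iota> ` \<sigma>' = \<iota> ` \<sigma>"
    using face_of_aff_dim_lt[OF epcD(6)[OF e s(1)], of "\<iota> ` \<sigma>'"] d unfolding is_face_def pdim_def by linarith
  then have "\<sigma> \<subseteq> \<sigma>'" using inj_on_image_subsetD[OF epcD(4)[OF e s(1)] order_refl sub] by simp
  then show ?thesis using sub by auto
qed

lemma face_cell:
  assumes e: "epc_complex T \<iota> PP" and s: "\<sigma> \<in> PP" and F: "F face_of (\<iota> ` \<sigma>)"
  obtains \<tau> where "\<tau> \<in> PP" "\<iota> ` \<tau> = F" "\<tau> \<subseteq> \<sigma>" "\<tau> = \<sigma> \<inter> \<iota> -` F"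
  using epcD(8)[OF e s F] face_of_imp_subset[OF F] that[of "\<sigma> \<inter> \<iota> -` F"] by blast

lemma cell_min:
  assumes e: "epc_complex T \<iota> PP" and s: "\<sigma> \<in> PP" "x \<in> \<sigma>"
  obtains \<tau> where "\<tau> \<in> PP" "x \<in> \<tau>" "\<iota> x \<in> rel_interior (\<iota> ` \<tau>)" "\<tau> \<subseteq> \<sigma>"
proof -
  obtain G where G: "G face_of (\<iota> ` \<sigma>)" "\<iota> x \<in> rel_interior G"
    using polyhedron_minimal_face[OF epcD(5)[OF e s(1)]] s(2) by blast
  obtain \<tau> where t: "\<tau> \<in> PP" "\<iota> ` \<tau> = G" "\<tau> \<subseteq> \<sigma>" "\<tau> = \<sigma> \<inter> \<iota> -` G" using face_cell[OF e s(1) G(1)] .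
  then have "x \<in> \<tau>" using s(2) G(2) rel_interior_subset by blast
  then show ?thesis using that t G(2) by blast
qed

lemma cell_min_point:
  assumes e: "epc_complex T \<iota> PP" and x: "x \<in> topspace T"
  obtains \<tau> where "\<tau> \<in> PP" "x \<in> \<tau>" "\<iota> x \<in> rel_interior (\<iota> ` \<tau>)"
proof -
  obtain \<sigma> where "\<sigma> \<in> PP" "x \<in> \<sigma>" using epcD(2)[OF e] x by auto
  from cell_min[OF e this] show ?thesis using that by blast
qed

lemma rel_interior_point:
  assumes e: "epc_complex T \<iota> PP" and s: "\<sigma> \<in> PP" "\<sigma> \<noteq> {}"
  obtains x where "x \<in> \<sigma>" "\<iota> x \<in> rel_interior (\<iota> ` \<sigma>)"
proof -
  have "rel_interior (\<iota> ` \<sigma>) \<noteq> {}" using rel_interior_eq_empty[OF epcD(6)[OF e s(1)]] s(2) by auto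
  then obtain y where "y \<in> rel_interior (\<iota> ` \<sigma>)" by auto
  then show ?thesis using that rel_interior_subset by blast
qed

section \<open>Open sets of the space seen inside a cell\<close>

lemma open_in_cell:
  assumes e: "epc_complex T \<iota> PP" and s: "\<sigma> \<in> PP" and W: "openin T W"
  obtains Q where "open Q" "\<And>x. x \<in> \<sigma> \<Longrightarrow> x \<in> W \<longleftrightarrow> \<iota> x \<in> Q"
proof -
  have "openin (subtopology T \<sigma>) (W \<inter> \<sigma>)" using W by (simp add: openin_subtopology_Int)
  then have "openin (top_of_set (\<iota> ` \<sigma>)) (\<iota> ` (W \<inter> \<sigma>))"
    using homeomorphic_imp_open_map[OF epcD(7)[OF e s]] by (simp add: open_map_def)
  then obtain Q where Q: "open Q" "\<iota> ` (W \<inter> \<sigma>) = \<iota> ` \<sigma> \<inter> Q" by (auto simp: openin_open)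
  have "x \<in> W \<longleftrightarrow> \<iota> x \<in> Q" if "x \<in> \<sigma>" for x
  proof
    assume "x \<in> W" then show "\<iota> x \<in> Q" using Q(2) that by auto
  next
    assume "\<iota> x \<in> Q"
    then have "\<iota> x \<in> \<iota> ` (W \<inter> \<sigma>)" using Q(2) that by auto
    then show "x \<in> W" using inj_onD[OF epcD(4)[OF e s]] that by auto
  qed
  then show ?thesis using that Q(1) by blast
qed

lemma cell_open_preimage:
  assumes e: "epc_complex T \<iota> PP" and s: "\<sigma> \<in> PP" and Q: "open Q"
  obtains W where "openin T W" "\<And>x. x \<in> \<sigma> \<Longrightarrow> x \<in> W \<longleftrightarrow> \<iota> x \<in> Q"
proof -
  have "continuous_map (subtopology T \<sigma>) (top_of_set (\<iota> ` \<sigma>)) \<iota>"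
    using homeomorphic_imp_continuous_map[OF epcD(7)[OF e s]] .
  moreover have "openin (top_of_set (\<iota> ` \<sigma>)) (\<iota> ` \<sigma> \<inter> Q)" using Q by blast
  ultimately have "openin (subtopology T \<sigma>) {x \<in> topspace (subtopology T \<sigma>). \<iota> x \<in> \<iota> ` \<sigma> \<inter> Q}"
    by (rule openin_continuous_map_preimage)
  then obtain W where W: "openin T W" "{x \<in> topspace (subtopology T \<sigma>). \<iota> x \<in> \<iota> ` \<sigma> \<inter> Q} = W \<inter> \<sigma>"
    by (auto simp: openin_subtopology)
  show ?thesis
  proof (rule that[OF W(1)])
    fix x assume "x \<in> \<sigma>"
    then show "x \<in> W \<longleftrightarrow> \<iota> x \<in> Q" using W(2) epcD(10)[OF e s] by auto
  qed
qed

lemma finite_star: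
  assumes e: "epc_complex T \<iota> PP" shows "finite {\<sigma> \<in> PP. x \<in> \<sigma>}"
proof (cases "x \<in> topspace T")
  case True
  then obtain V where "x \<in> V" "finite {U \<in> PP. U \<inter> V \<noteq> {}}"
    using epcD(3)[OF e] unfolding locally_finite_in_def by auto
  then show ?thesis by (auto elim!: rev_finite_subset)
next
  case False
  then have "{\<sigma> \<in> PP. x \<in> \<sigma>} = {}" using epcD(2)[OF e] by auto
  then show ?thesis by (simp only: finite.emptyI)
qed

text \<open>By local finiteness only finitely many closed cells near \<open>x\<close> miss
  \<open>x\<close>; removing them keeps the neighborhood open.\<close>

lemma star_nbhd:
  assumes e: "epc_complex T \<iota> PP" and x: "x \<in> topspace T"
  obtains V where "openin T V" "x \<in> V" "\<And>\<sigma>. \<sigma> \<in> PP \<Longrightarrow> \<sigma> \<inter> V \<noteq> {} \<Longrightarrow> x \<in> \<sigma>"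
proof -
  obtain V where V: "openin T V" "x \<in> V" "finite {U \<in> PP. U \<inter> V \<noteq> {}}"
    using epcD(3)[OF e] x unfolding locally_finite_in_def by auto
  define C where "C = \<Union>{U \<in> PP. U \<inter> V \<noteq> {} \<and> x \<notin> U}"
  have "finite {U \<in> PP. U \<inter> V \<noteq> {} \<and> x \<notin> U}" using V(3) by (rule rev_finite_subset) auto
  then have "closedin T C" unfolding C_def by (intro closedin_Union) (auto intro: epcD(1)[OF e])
  then have "openin T (V - C)" using V(1) by (rule openin_diff[rotated])
  then show ?thesis using that[of "V - C"] V(2) by (auto simp: C_def)
qed

lemma small_star_nbhd:
  assumes e: "epc_complex T \<iota> PP" and x: "x \<in> topspace T" and r: "r > 0"
  obtains V where "openin T V" "x \<in> V" "\<And>\<sigma>. \<sigma> \<in> PP \<Longrightarrow> \<sigma> \<inter> V \<noteq> {} \<Longrightarrow> x \<in> \<sigma>"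
    "\<And>y. y \<in> V \<Longrightarrow> dist (\<iota> y) (\<iota> x) < r"
proof -
  obtain V where V: "openin T V" "x \<in> V" "\<And>\<sigma>. \<sigma> \<in> PP \<Longrightarrow> \<sigma> \<inter> V \<noteq> {} \<Longrightarrow> x \<in> \<sigma>"
    using star_nbhd[OF e x] by metis
  let ?S = "{\<sigma> \<in> PP. x \<in> \<sigma>}"
  have "\<exists>W. openin T W \<and> (\<forall>y\<in>\<sigma>. y \<in> W \<longleftrightarrow> \<iota> y \<in> ball (\<iota> x) r)" if "\<sigma> \<in> ?S" for \<sigma>
  proof -
    have s: "\<sigma> \<in> PP" using that by simp
    obtain W where "openin T W" "\<And>y. y \<in> \<sigma> \<Longrightarrow> y \<in> W \<longleftrightarrow> \<iota> y \<in> ball (\<iota> x) r"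
      by (rule cell_open_preimage[OF e s open_ball[of "\<iota> x" r]]) blast
    then show ?thesis by blast
  qed
  then have "\<forall>\<sigma>\<in>?S. \<exists>W. openin T W \<and> (\<forall>y\<in>\<sigma>. y \<in> W \<longleftrightarrow> \<iota> y \<in> ball (\<iota> x) r)" by simp
  from bchoice[OF this] obtain W where W0: "\<forall>\<sigma>\<in>?S. openin T (W \<sigma>) \<and> (\<forall>y\<in>\<sigma>. y \<in> W \<sigma> \<longleftrightarrow> \<iota> y \<in> ball (\<iota> x) r)" ..
  have W: "\<And>\<sigma>. \<sigma> \<in> ?S \<Longrightarrow> openin T (W \<sigma>)"
    "\<And>\<sigma> y. \<sigma> \<in> ?S \<Longrightarrow> y \<in> \<sigma> \<Longrightarrow> y \<in> W \<sigma> \<longleftrightarrow> \<iota> y \<in> ball (\<iota> x) r" using W0 by blast+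
  \<comment> \<open>Inserting \<open>topspace T\<close> keeps the intersected family
    nonempty.\<close>
  define V' where "V' = V \<inter> \<Inter>(insert (topspace T) (W ` ?S))"
  have "openin T (\<Inter>(insert (topspace T) (W ` ?S)))"
    using W(1) finite_star[OF e, of x] by (intro openin_Inter) auto
  then have o: "openin T V'" using V(1) by (auto simp: V'_def)
  have xV': "x \<in> V'" using V(2) x W(2) r by (auto simp: V'_def)
  show ?thesis
  proof (rule that[OF o xV'])
    show "\<And>\<sigma>. \<sigma> \<in> PP \<Longrightarrow> \<sigma> \<inter> V' \<noteq> {} \<Longrightarrow> x \<in> \<sigma>" using V(3) by (auto simp: V'_def)
    fix y assume y: "y \<in> V'"
    then have yT: "y \<in> topspace T" using o openin_subset by blast
    then obtain \<sigma> where s: "\<sigma> \<in> PP" "y \<in> \<sigma>" using epcD(2)[OF e] by auto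
    then have "\<sigma> \<in> ?S" using V(3)[OF s(1)] y by (auto simp: V'_def)
    then have "\<iota> y \<in> ball (\<iota> x) r" using W(2)[OF _ s(2)] y by (auto simp: V'_def)
    then show "dist (\<iota> y) (\<iota> x) < r" by (simp add: dist_commute)
  qed
qed

section \<open>Subdivisions and pure dimension\<close>

lemma subdivides_refl: "subdivides PP PP" by (auto simp: subdivides_def)

lemma subdivides_trans: "subdivides PP PP' \<Longrightarrow> subdivides PP' PP'' \<Longrightarrow> subdivides PP PP''"
  unfolding subdivides_def by (meson order_trans)

text \<open>Some cell \<open>\<sigma>1\<close> contains \<open>\<tau>\<close>, and its face
  \<open>\<sigma>1 \<inter> \<sigma>\<close> meets the relative interior of \<open>\<tau>\<close>,
  hence contains \<open>\<tau>\<close>.\<close>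

lemma subdivides_carrier:
  assumes e: "epc_complex T \<iota> PP" "epc_complex T \<iota> PP'" and sub: "subdivides PP' PP"
    and t: "\<tau> \<in> PP'" "\<sigma> \<in> PP" "p \<in> \<tau>" "p \<in> \<sigma>" "\<iota> p \<in> rel_interior (\<iota> ` \<tau>)"
  shows "\<tau> \<subseteq> \<sigma>"
proof -
  obtain \<sigma>1 where s1: "\<sigma>1 \<in> PP" "\<tau> \<subseteq> \<sigma>1" using sub t by (auto simp: subdivides_def)
  have "\<iota> ` (\<sigma>1 \<inter> \<sigma>) face_of (\<iota> ` \<sigma>1)" using epcD(9)[OF e(1)] s1 t by auto
  then have "\<iota> ` \<tau> \<subseteq> \<iota> ` (\<sigma>1 \<inter> \<sigma>)" by (rule subset_of_face_of) (use t s1 in auto)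
  then have "\<tau> \<subseteq> \<sigma>1 \<inter> \<sigma>"
    using inj_on_image_subsetD[OF epcD(4)[OF e(1) s1(1)] s1(2), of "\<sigma>1 \<inter> \<sigma>"] by blast
  then show ?thesis by auto
qed

text \<open>Near \<open>z\<close> the cell \<open>\<sigma>\<close> is covered by the finitely many
  cells of \<open>PP'\<close> at \<open>z\<close> that lie in it; if all had smaller dimension, they
  could not cover a relatively open piece.\<close>

lemma refine_same_dim:
  assumes e: "epc_complex T \<iota> PP" "epc_complex T \<iota> PP'" and sub: "subdivides PP' PP"
    and s: "\<sigma> \<in> PP" "z \<in> \<sigma>"
  obtains \<sigma>' where "\<sigma>' \<in> PP'" "z \<in> \<sigma>'" "\<sigma>' \<subseteq> \<sigma>" "pdim \<iota> \<sigma>' = pdim \<iota> \<sigma>"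
proof -
  have "\<exists>\<sigma>'. \<sigma>' \<in> PP' \<and> z \<in> \<sigma>' \<and> \<sigma>' \<subseteq> \<sigma> \<and> pdim \<iota> \<sigma>' = pdim \<iota> \<sigma>"
  proof (rule ccontr)
    assume neg: "\<not> ?thesis"
    have zT: "z \<in> topspace T" using epcD(10)[OF e(1) s(1)] s(2) by auto
    obtain V where V: "openin T V" "z \<in> V" "\<And>\<sigma>. \<sigma> \<in> PP' \<Longrightarrow> \<sigma> \<inter> V \<noteq> {} \<Longrightarrow> z \<in> \<sigma>"
      using star_nbhd[OF e(2) zT] by metis
    obtain Q where Q: "open Q" "\<And>x. x \<in> \<sigma> \<Longrightarrow> x \<in> V \<longleftrightarrow> \<iota> x \<in> Q"
      using open_in_cell[OF e(1) s(1) V(1)] by metis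
    define A where "A = {\<sigma>' \<in> PP'. z \<in> \<sigma>' \<and> \<sigma>' \<subseteq> \<sigma>}"
    have fin: "finite A" using finite_star[OF e(2), of z] by (rule rev_finite_subset) (auto simp: A_def)
    have cs: "convex (\<iota> ` \<sigma>)" using epcD(6)[OF e(1) s(1)] .
    let ?S = "rel_interior (\<iota> ` \<sigma>)"
    have "closure ?S = closure (\<iota> ` \<sigma>)" using convex_closure_rel_interior[OF cs] .
    moreover have "\<iota> z \<in> closure (\<iota> ` \<sigma>)" by (rule subsetD[OF closure_subset imageI[OF s(2)]])
    ultimately have "\<iota> z \<in> closure ?S" by simp
    moreover have "\<iota> z \<in> Q" using Q(2)[OF s(2)] V(2) by simp
    ultimately have ne: "?S \<inter> Q \<noteq> {}"
      using open_Int_closure_eq_empty[OF Q(1), of ?S] by blast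
    have dim: "aff_dim B < aff_dim ?S" if B: "B \<in> (`) \<iota> ` A" for B
    proof -
      obtain \<sigma>' where s': "\<sigma>' \<in> A" "B = \<iota> ` \<sigma>'" using B by blast
      then have "aff_dim B \<noteq> aff_dim (\<iota> ` \<sigma>)" using neg by (auto simp: A_def pdim_def)
      moreover have "aff_dim B \<le> aff_dim (\<iota> ` \<sigma>)" using s' by (intro aff_dim_subset) (auto simp: A_def)
      ultimately show ?thesis using rel_interior_aff_dim[OF cs] by simp
    qed
    have "?S \<inter> Q \<subseteq> \<Union>((`) \<iota> ` A)"
    proof
      fix y assume y: "y \<in> ?S \<inter> Q"
      then obtain p where p: "p \<in> \<sigma>" "y = \<iota> p" using rel_interior_subset by blast
      have pV: "p \<in> V" using Q(2)[OF p(1)] y p by auto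
      have pT: "p \<in> topspace T" using epcD(10)[OF e(1) s(1)] p by auto
      obtain \<tau> where t: "\<tau> \<in> PP'" "p \<in> \<tau>" "\<iota> p \<in> rel_interior (\<iota> ` \<tau>)" using cell_min_point[OF e(2) pT] .
      have "\<tau> \<subseteq> \<sigma>" using subdivides_carrier[OF e sub t(1) s(1) t(2) p(1) t(3)] .
      moreover have "z \<in> \<tau>" using V(3)[OF t(1)] t(2) pV by auto
      ultimately show "y \<in> \<Union>((`) \<iota> ` A)" using t p by (auto simp: A_def)
    qed
    moreover have "\<not> ?S \<inter> Q \<subseteq> \<Union>((`) \<iota> ` A)"
      by (rule open_not_covered_by_lower_dim[OF _ convex_rel_interior[OF cs] Q(1) ne dim]) (use fin in auto)
    ultimately show False by simp
  qed
  then show ?thesis using that by blast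
qed

lemma pdim_mono: "\<sigma> \<subseteq> \<sigma>' \<Longrightarrow> pdim \<iota> \<sigma> \<le> pdim \<iota> \<sigma>'"
  unfolding pdim_def by (intro aff_dim_subset) auto

lemma pdim_empty_iff: "pdim \<iota> \<sigma> = -1 \<longleftrightarrow> \<sigma> = {}"
  using aff_dim_empty[of "\<iota> ` \<sigma>"] by (auto simp: pdim_def)

lemma pdim_nonneg: "\<sigma> \<noteq> {} \<Longrightarrow> pdim \<iota> \<sigma> \<ge> 0"
  using aff_dim_negative_iff[of "\<iota> ` \<sigma>"] unfolding pdim_def by (metis image_is_empty not_less)

lemma pure_PP0:
  assumes e: "epc_complex T \<iota> PP0" and pure: "pure_dimension \<iota> PP0 n" and s: "\<sigma> \<in> PP0" "\<sigma> \<noteq> {}"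
  obtains \<sigma>' where "\<sigma>' \<in> PP0" "\<sigma> \<subseteq> \<sigma>'" "pdim \<iota> \<sigma>' = int n"
proof -
  obtain x where x: "x \<in> \<sigma>" using s by auto
  let ?A = "{\<sigma>' \<in> PP0. \<sigma> \<subseteq> \<sigma>'}"
  have "finite ?A" using finite_star[OF e, of x] by (rule rev_finite_subset) (use x in auto)
  then obtain m where m: "m \<in> ?A" "\<forall>b\<in>?A. m \<subseteq> b \<longrightarrow> m = b"
    using finite_has_maximal2[of ?A \<sigma>] s by auto
  have "\<forall>\<sigma>'\<in>PP0. m \<subseteq> \<sigma>' \<longrightarrow> \<sigma>' = m" using m by auto
  then show ?thesis using pure m that by (auto simp: pure_dimension_def)
qed

lemma in_classD:
  assumes "in_class T \<iota> PP0 PP"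
  shows "epc_complex T \<iota> PP"
    and "\<exists>PP'. epc_complex T \<iota> PP' \<and> subdivides PP' PP \<and> subdivides PP' PP0"
  using assms by (auto simp: in_class_def equiv_complexes_def)

text \<open>\<open>refine_same_dim\<close> passes from a cell of either complex to the common
  subdivision without loss of dimension, and inclusion leads on to the other complex.\<close>

lemma pure_in_class:
  assumes e0: "epc_complex T \<iota> PP0" and pure: "pure_dimension \<iota> PP0 n" and c: "in_class T \<iota> PP0 PP" and s: "\<sigma> \<in> PP"
  shows "pdim \<iota> \<sigma> \<le> int n" and "\<sigma> \<noteq> {} \<Longrightarrow> \<exists>\<sigma>'\<in>PP. \<sigma> \<subseteq> \<sigma>' \<and> pdim \<iota> \<sigma>' = int n"
proof -
  note e = in_classD(1)[OF c]
  obtain PP' where P': "epc_complex T \<iota> PP'" "subdivides PP' PP" "subdivides PP' PP0"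
    using in_classD(2)[OF c] by auto
  have le: "pdim \<iota> \<sigma> \<le> int n" if sP: "\<sigma> \<in> PP" for \<sigma>
  proof (cases "\<sigma> = {}")
    case True
    then have "pdim \<iota> \<sigma> = -1" by (simp add: pdim_empty_iff)
    then show ?thesis by simp
  next
    case False
    then obtain z where z: "z \<in> \<sigma>" by auto
    obtain \<sigma>' where s': "\<sigma>' \<in> PP'" "z \<in> \<sigma>'" "pdim \<iota> \<sigma>' = pdim \<iota> \<sigma>"
      by (rule refine_same_dim[OF e P'(1,2) sP z]) blast
    then obtain \<sigma>0 where s0: "\<sigma>0 \<in> PP0" "\<sigma>' \<subseteq> \<sigma>0" using P'(3) by (auto simp: subdivides_def)
    obtain \<sigma>1 where "\<sigma>1 \<in> PP0" "\<sigma>0 \<subseteq> \<sigma>1" "pdim \<iota> \<sigma>1 = int n"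
      using pure_PP0[OF e0 pure s0(1)] s0(2) s'(2) by auto
    then show ?thesis using pdim_mono[of \<sigma>' \<sigma>1 \<iota>] s' s0 by auto
  qed
  show "pdim \<iota> \<sigma> \<le> int n" by (rule le[OF s])
  assume ne: "\<sigma> \<noteq> {}"
  obtain z where z: "z \<in> \<sigma>" "\<iota> z \<in> rel_interior (\<iota> ` \<sigma>)" using rel_interior_point[OF e s ne] .
  have zT: "z \<in> topspace T" using epcD(10)[OF e s] z by auto
  then obtain \<sigma>0 where s0: "\<sigma>0 \<in> PP0" "z \<in> \<sigma>0" using epcD(2)[OF e0] by auto
  obtain \<sigma>1 where s1: "\<sigma>1 \<in> PP0" "\<sigma>0 \<subseteq> \<sigma>1" "pdim \<iota> \<sigma>1 = int n" using pure_PP0[OF e0 pure s0(1)] s0(2) by auto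
  obtain \<sigma>' where s': "\<sigma>' \<in> PP'" "z \<in> \<sigma>'" "pdim \<iota> \<sigma>' = int n"
    using refine_same_dim[OF e0 P'(1,3) s1(1)] s0 s1 by (metis subsetD)
  obtain \<sigma>2 where s2: "\<sigma>2 \<in> PP" "\<sigma>' \<subseteq> \<sigma>2" using P'(2) s' by (auto simp: subdivides_def)
  have "\<sigma> \<subseteq> \<sigma>2" using cell_face[OF e s2(1) s _ z] s2 s' by auto
  moreover have "pdim \<iota> \<sigma>2 = int n" using le[OF s2(1)] pdim_mono[OF s2(2), of \<iota>] s' by simp
  ultimately show "\<exists>\<sigma>'\<in>PP. \<sigma> \<subseteq> \<sigma>' \<and> pdim \<iota> \<sigma>' = int n" using s2 by auto
qed

section \<open>Cutting a complex along hyperplanes through the origin\<close>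

definition hcut :: "('a \<Rightarrow> 'v::euclidean_space) \<Rightarrow> 'v \<Rightarrow> 'a set set \<Rightarrow> 'a set set" where
  "hcut \<iota> w PP = {\<sigma> \<inter> \<iota> -` half w A | \<sigma> A. \<sigma> \<in> PP \<and> A \<in> signs}"

lemma image_hcut_cell: "\<iota> ` (\<sigma> \<inter> \<iota> -` H) = \<iota> ` \<sigma> \<inter> H" by auto

lemma hcut_memI: "\<sigma> \<in> PP \<Longrightarrow> A \<in> signs \<Longrightarrow> \<sigma> \<inter> \<iota> -` half w A \<in> hcut \<iota> w PP"
  unfolding hcut_def by blast

lemma hcut_memE:
  assumes "\<sigma>' \<in> hcut \<iota> w PP"
  obtains \<sigma> A where "\<sigma> \<in> PP" "A \<in> signs" "\<sigma>' = \<sigma> \<inter> \<iota> -` half w A"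
  using assms unfolding hcut_def by blast

text \<open>Faces of a cut cell are described by \<open>face_of_Int_half\<close>, and two cut cells
  meet in a common face of the old cells intersected with a face of the half-spaces.\<close>

lemma epc_hcut:
  assumes e: "epc_complex T \<iota> PP" shows "epc_complex T \<iota> (hcut \<iota> w PP)"
  unfolding epc_complex_def
proof (intro conjI ballI allI impI)
  have hom: "homeomorphic_map (subtopology T (\<sigma> \<inter> \<iota> -` half w A)) (top_of_set (\<iota> ` (\<sigma> \<inter> \<iota> -` half w A))) \<iota>"
    if "\<sigma> \<in> PP" for \<sigma> A
  proof -
    have "\<iota> ` (topspace (subtopology T \<sigma>) \<inter> \<iota> -` half w A) = topspace (top_of_set (\<iota> ` \<sigma>)) \<inter> half w A"
      using epcD(10)[OF e that] by auto
    from homeomorphic_map_subtopologies[OF epcD(7)[OF e that] this]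
    show ?thesis unfolding image_hcut_cell subtopology_subtopology .
  qed
  have closed: "closedin T (\<sigma> \<inter> \<iota> -` half w A)" if s: "\<sigma> \<in> PP" and A: "A \<in> signs" for \<sigma> A
  proof -
    have "continuous_map (subtopology T \<sigma>) (top_of_set (\<iota> ` \<sigma>)) \<iota>"
      using homeomorphic_imp_continuous_map[OF epcD(7)[OF e s]] .
    moreover have "closedin (top_of_set (\<iota> ` \<sigma>)) (\<iota> ` \<sigma> \<inter> half w A)"
      using polyhedron_imp_closed[OF polyhedron_half[OF A, of w]] by (rule closedin_closed_Int)
    ultimately have "closedin (subtopology T \<sigma>) {x \<in> topspace (subtopology T \<sigma>). \<iota> x \<in> \<iota> ` \<sigma> \<inter> half w A}"
      by (rule closedin_continuous_map_preimage)
    also have "{x \<in> topspace (subtopology T \<sigma>). \<iota> x \<in> \<iota> ` \<sigma> \<inter> half w A} = \<sigma> \<inter> \<iota> -` half w A"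
      using epcD(10)[OF e s] by auto
    finally show ?thesis using closedin_trans_full epcD(1)[OF e s] by blast
  qed
  show "closedin T \<sigma>" if "\<sigma> \<in> hcut \<iota> w PP" for \<sigma>
    using that closed by (auto elim!: hcut_memE)
  show un: "\<Union> (hcut \<iota> w PP) = topspace T"
  proof
    show "\<Union> (hcut \<iota> w PP) \<subseteq> topspace T" using epcD(10)[OF e] by (auto elim!: hcut_memE)
    show "topspace T \<subseteq> \<Union> (hcut \<iota> w PP)"
    proof
      fix x assume "x \<in> topspace T"
      then obtain \<sigma> where s: "\<sigma> \<in> PP" "x \<in> \<sigma>" using epcD(2)[OF e] by auto
      define A where "A = (if w \<bullet> \<iota> x \<ge> 0 then {0..} else {..0::real})"
      have A: "A \<in> signs" "x \<in> \<sigma> \<inter> \<iota> -` half w A" using s(2) by (auto simp: signs_def A_def half_def)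
      show "x \<in> \<Union> (hcut \<iota> w PP)" by (rule UnionI[OF hcut_memI[OF s(1) A(1)] A(2)])
    qed
  qed
  show "locally_finite_in T (hcut \<iota> w PP)"
    unfolding locally_finite_in_def
  proof (intro conjI ballI)
    show "\<Union> (hcut \<iota> w PP) \<subseteq> topspace T" using un by simp
    fix x assume "x \<in> topspace T"
    then obtain V where V: "openin T V" "x \<in> V" "finite {U \<in> PP. U \<inter> V \<noteq> {}}"
      using epcD(3)[OF e] unfolding locally_finite_in_def by auto
    have fs: "finite signs" by (simp add: signs_def)
    have "finite ((\<lambda>(\<sigma>, A). \<sigma> \<inter> \<iota> -` half w A) ` ({U \<in> PP. U \<inter> V \<noteq> {}} \<times> signs))"
      using V(3) fs by (intro finite_imageI finite_cartesian_product)
    then have "finite {U \<in> hcut \<iota> w PP. U \<inter> V \<noteq> {}}"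
      by (rule rev_finite_subset) (force elim!: hcut_memE)
    then show "\<exists>V. openin T V \<and> x \<in> V \<and> finite {U \<in> hcut \<iota> w PP. U \<inter> V \<noteq> {}}" using V by auto
  qed
  show "inj_on \<iota> \<sigma>" if "\<sigma> \<in> hcut \<iota> w PP" for \<sigma>
    using that epcD(4)[OF e] by (auto elim!: hcut_memE intro: inj_on_subset)
  show "polyhedron (\<iota> ` \<sigma>)" if sc: "\<sigma> \<in> hcut \<iota> w PP" for \<sigma>
  proof -
    obtain \<sigma>0 A where s0: "\<sigma>0 \<in> PP" "A \<in> signs" "\<sigma> = \<sigma>0 \<inter> \<iota> -` half w A" using sc by (rule hcut_memE)
    show ?thesis unfolding s0(3) image_hcut_cell by (rule polyhedron_Int[OF epcD(5)[OF e s0(1)] polyhedron_half[OF s0(2)]])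
  qed
  show "homeomorphic_map (subtopology T \<sigma>) (top_of_set (\<iota> ` \<sigma>)) \<iota>" if "\<sigma> \<in> hcut \<iota> w PP" for \<sigma>
    using that hom by (auto elim!: hcut_memE)
  show "\<sigma> \<inter> \<iota> -` F \<in> hcut \<iota> w PP" if s: "\<sigma> \<in> hcut \<iota> w PP" and F: "F face_of \<iota> ` \<sigma>" for \<sigma> F
  proof -
    obtain \<sigma>0 A where s0: "\<sigma>0 \<in> PP" "A \<in> signs" "\<sigma> = \<sigma>0 \<inter> \<iota> -` half w A" using s by (auto elim: hcut_memE)
    have F': "F face_of (\<iota> ` \<sigma>0 \<inter> half w A)" using F unfolding s0(3) image_hcut_cell .
    show ?thesis
    \<comment> \<open>\<open>face_of_Int_half\<close> concerns nonempty faces; the empty face is a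
      cut of the empty cell, which belongs to \<open>PP\<close>.\<close>
    proof (cases "F = {}")
      case True
      have "\<sigma>0 \<inter> \<iota> -` {} \<in> PP" using epcD(8)[OF e s0(1)] by blast
      from hcut_memI[OF this s0(2), of \<iota> w] show ?thesis using True by simp
    next
      case False
      obtain G B where G: "G face_of (\<iota> ` \<sigma>0)" "B \<in> signs" "F = G \<inter> half w B"
        using face_of_Int_half[OF epcD(5)[OF e s0(1)] s0(2) F' False] .
      have "F \<subseteq> half w A" using face_of_imp_subset[OF F'] by auto
      then have "\<sigma> \<inter> \<iota> -` F = (\<sigma>0 \<inter> \<iota> -` G) \<inter> \<iota> -` half w B" unfolding s0(3) G(3) by auto
      then show ?thesis using hcut_memI[OF epcD(8)[OF e s0(1) G(1)] G(2), of \<iota> w] by simp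
    qed
  qed
  have int: "\<iota> ` (\<sigma> \<inter> \<sigma>') face_of (\<iota> ` \<sigma>)" if s: "\<sigma> \<in> hcut \<iota> w PP" "\<sigma>' \<in> hcut \<iota> w PP" for \<sigma> \<sigma>'
  proof -
    obtain \<sigma>0 A where s0: "\<sigma>0 \<in> PP" "A \<in> signs" "\<sigma> = \<sigma>0 \<inter> \<iota> -` half w A" using s by (auto elim: hcut_memE)
    obtain \<sigma>1 B where s1: "\<sigma>1 \<in> PP" "B \<in> signs" "\<sigma>' = \<sigma>1 \<inter> \<iota> -` half w B" using s by (auto elim: hcut_memE)
    have "\<sigma> \<inter> \<sigma>' = (\<sigma>0 \<inter> \<sigma>1) \<inter> \<iota> -` half w (A \<inter> B)"
      unfolding s0(3) s1(3) half_Int[symmetric] by auto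
    then have "\<iota> ` (\<sigma> \<inter> \<sigma>') = \<iota> ` (\<sigma>0 \<inter> \<sigma>1) \<inter> half w (A \<inter> B)" by (simp only: image_hcut_cell)
    moreover have "\<iota> ` \<sigma> = \<iota> ` \<sigma>0 \<inter> half w A" unfolding s0(3) image_hcut_cell ..
    ultimately show ?thesis
      using face_of_Int_Int[OF epcD(9)[OF e s0(1) s1(1)] half_face[OF s0(2) s1(2)]] by simp
  qed
  show "\<iota> ` (\<sigma> \<inter> \<sigma>') face_of (\<iota> ` \<sigma>)" if s: "\<sigma> \<in> hcut \<iota> w PP" "\<sigma>' \<in> hcut \<iota> w PP" for \<sigma> \<sigma>'
    using int[OF s] .
  show "\<iota> ` (\<sigma> \<inter> \<sigma>') face_of (\<iota> ` \<sigma>')" if s: "\<sigma> \<in> hcut \<iota> w PP" "\<sigma>' \<in> hcut \<iota> w PP" for \<sigma> \<sigma>'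
    using int[OF s(2,1)] by (simp add: Int_commute)
qed

lemma subdivides_hcut: "subdivides (hcut \<iota> w PP) PP"
  by (auto simp: subdivides_def elim!: hcut_memE)

lemma hcut_mono: "subdivides PP' PP \<Longrightarrow> subdivides (hcut \<iota> w PP') (hcut \<iota> w PP)"
  unfolding subdivides_def
proof
  fix \<sigma>' assume sub: "\<forall>\<sigma>'\<in>PP'. \<exists>\<sigma>\<in>PP. \<sigma>' \<subseteq> \<sigma>" and "\<sigma>' \<in> hcut \<iota> w PP'"
  then obtain \<tau> A where t: "\<tau> \<in> PP'" "A \<in> signs" "\<sigma>' = \<tau> \<inter> \<iota> -` half w A" by (auto elim: hcut_memE)
  then obtain \<sigma> where s: "\<sigma> \<in> PP" "\<tau> \<subseteq> \<sigma>" using sub by auto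
  have "\<sigma>' \<subseteq> \<sigma> \<inter> \<iota> -` half w A" using t s by auto
  then show "\<exists>\<sigma>\<in>hcut \<iota> w PP. \<sigma>' \<subseteq> \<sigma>" using hcut_memI[OF s(1) t(2)] by (rule bexI)
qed

text \<open>Cutting a common subdivision of \<open>PP\<close> and \<open>PP0\<close> by the same
  hyperplane gives a common subdivision of the cut complex and \<open>PP0\<close>.\<close>

lemma in_class_hcut:
  assumes "in_class T \<iota> PP0 PP" shows "in_class T \<iota> PP0 (hcut \<iota> w PP)"
proof -
  obtain PP' where P': "epc_complex T \<iota> PP'" "subdivides PP' PP" "subdivides PP' PP0"
    using in_classD(2)[OF assms] by auto
  have "subdivides (hcut \<iota> w PP') PP0" using subdivides_trans[OF subdivides_hcut P'(3)] .
  then show ?thesis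
    using epc_hcut[OF P'(1), of w] epc_hcut[OF in_classD(1)[OF assms], of w] hcut_mono[OF P'(2), of \<iota> w]
    unfolding in_class_def equiv_complexes_def by blast
qed

fun hcuts :: "('a \<Rightarrow> 'v::euclidean_space) \<Rightarrow> 'v list \<Rightarrow> 'a set set \<Rightarrow> 'a set set" where
  "hcuts \<iota> [] PP = PP"
| "hcuts \<iota> (w # ws) PP = hcut \<iota> w (hcuts \<iota> ws PP)"

lemma in_class_hcuts: "in_class T \<iota> PP0 PP \<Longrightarrow> in_class T \<iota> PP0 (hcuts \<iota> ws PP)"
  by (induction ws) (auto intro: in_class_hcut)

lemma subdivides_hcuts: "subdivides (hcuts \<iota> ws PP) PP"
  by (induction ws) (auto intro: subdivides_refl subdivides_trans[OF subdivides_hcut])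

lemma hcuts_sign:
  assumes "w \<in> set ws" "\<sigma> \<in> hcuts \<iota> ws PP"
  shows "(\<forall>x\<in>\<sigma>. w \<bullet> \<iota> x \<ge> 0) \<or> (\<forall>x\<in>\<sigma>. w \<bullet> \<iota> x \<le> 0)"
  using assms
proof (induction ws arbitrary: \<sigma>)
  case (Cons v ws)
  then obtain \<sigma>0 A where s: "\<sigma>0 \<in> hcuts \<iota> ws PP" "A \<in> signs" "\<sigma> = \<sigma>0 \<inter> \<iota> -` half v A"
    by (auto elim: hcut_memE)
  show ?case
  proof (cases "w = v")
    case True
    then show ?thesis using s(2,3) by (auto elim!: signs_cases simp: half_def)
  next
    case False
    then show ?thesis using Cons.IH[OF _ s(1)] Cons.prems(1) s(3) by auto
  qed
qed simp

text \<open>A piece inside the hyperplane counts as the two inequalities \<open>v\<close> and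
  \<open>-v\<close>; hence the negatives. The description lets faces of cut cells be detected by the
  cutting forms.\<close>

lemma hcuts_structure:
  assumes "\<sigma>' \<in> hcuts \<iota> ws PP"
  shows "\<exists>\<sigma>\<in>PP. \<exists>A \<subseteq> set ws \<union> uminus ` set ws. \<sigma>' = {x \<in> \<sigma>. \<forall>w\<in>A. w \<bullet> \<iota> x \<ge> 0}"
  using assms
proof (induction ws arbitrary: \<sigma>')
  case (Cons v ws)
  then obtain \<sigma>0 B where s: "\<sigma>0 \<in> hcuts \<iota> ws PP" "B \<in> signs" "\<sigma>' = \<sigma>0 \<inter> \<iota> -` half v B"
    by (auto elim: hcut_memE)
  obtain \<sigma> A where A: "\<sigma> \<in> PP" "A \<subseteq> set ws \<union> uminus ` set ws" "\<sigma>0 = {x \<in> \<sigma>. \<forall>w\<in>A. w \<bullet> \<iota> x \<ge> 0}"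
    using Cons.IH[OF s(1)] by auto
  define A' where "A' = A \<union> (if B = {0..} then {v} else if B = {..0} then {-v} else {v, -v})"
  have "\<sigma>' = {x \<in> \<sigma>. \<forall>w\<in>A'. w \<bullet> \<iota> x \<ge> 0}"
    using s(2) unfolding s(3) A(3) A'_def half_def by (auto elim!: signs_cases split: if_splits)
  moreover have "A' \<subseteq> set (v # ws) \<union> uminus ` set (v # ws)" using A(2) by (auto simp: A'_def)
  ultimately show ?case using A(1) by blast
qed auto

section \<open>Minkowski weights and concave functions\<close>

lemma wall_cells:
  assumes e: "epc_complex T \<iota> PP" and s: "\<sigma> \<in> PP" "\<tau> \<in> PP" "\<tau> \<noteq> {}" "\<tau> \<subseteq> \<sigma>" "pdim \<iota> \<sigma> = pdim \<iota> \<tau> + 1"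
  shows "wall (\<iota> ` \<sigma>) (\<iota> ` \<tau>)"
  using is_face_iff_subset[OF e s(1,2)] s epcD(6)[OF e s(1)] by (auto simp: wall_def is_face_def pdim_def)

lemma cofaces_eq:
  assumes e: "epc_complex T \<iota> PP" and t: "\<tau> \<in> PP" "\<tau> \<inter> W \<noteq> {}"
  shows "cofaces \<iota> PP W k \<tau> = {\<sigma> \<in> PP. \<tau> \<subseteq> \<sigma> \<and> pdim \<iota> \<sigma> = k}"
  using is_face_iff_subset[OF e _ t(1)] t(2) unfolding cofaces_def restr_dim_def restr_def by blast

lemma finite_cofaces:
  assumes e: "epc_complex T \<iota> PP" and t: "\<tau> \<noteq> {}"
  shows "finite {\<sigma> \<in> PP. \<tau> \<subseteq> \<sigma> \<and> P \<sigma>}"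
proof -
  obtain x where "x \<in> \<tau>" using t by auto
  then show ?thesis using finite_star[OF e, of x] by (auto elim!: rev_finite_subset)
qed

lemma restr_dim_iff: "\<sigma> \<in> restr_dim \<iota> PP W k \<longleftrightarrow> \<sigma> \<in> PP \<and> \<sigma> \<inter> W \<noteq> {} \<and> pdim \<iota> \<sigma> = k"
  by (simp add: restr_dim_def restr_def conj_assoc)

lemma rel_interior_point_in_open:
  assumes e: "epc_complex T \<iota> PP" and s: "\<sigma> \<in> PP" "\<sigma> \<inter> W \<noteq> {}" and W: "openin T W"
  obtains x where "x \<in> \<sigma>" "x \<in> W" "\<iota> x \<in> rel_interior (\<iota> ` \<sigma>)"
proof -
  obtain Q where Q: "open Q" "\<And>x. x \<in> \<sigma> \<Longrightarrow> x \<in> W \<longleftrightarrow> \<iota> x \<in> Q"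
    using open_in_cell[OF e s(1) W] by metis
  obtain z where z: "z \<in> \<sigma>" "z \<in> W" using s(2) by auto
  let ?S = "rel_interior (\<iota> ` \<sigma>)"
  have "closure ?S = closure (\<iota> ` \<sigma>)" using convex_closure_rel_interior[OF epcD(6)[OF e s(1)]] .
  moreover have "\<iota> z \<in> closure (\<iota> ` \<sigma>)" by (rule subsetD[OF closure_subset imageI[OF z(1)]])
  moreover have "\<iota> z \<in> Q" using Q(2)[OF z(1)] z(2) by simp
  ultimately have "Q \<inter> ?S \<noteq> {}" using open_Int_closure_eq_empty[OF Q(1), of ?S] by auto
  then obtain y where y: "y \<in> Q" "y \<in> ?S" by auto
  then have "y \<in> \<iota> ` \<sigma>" using rel_interior_subset by auto
  then show ?thesis using that y Q(2) by auto
qed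

lemma cell_move:
  assumes e: "epc_complex T \<iota> PP" and s: "\<sigma> \<in> PP" and W: "openin T W" and x: "x \<in> \<sigma>" "x \<in> W"
    and d: "e > 0" "\<And>t. 0 < t \<Longrightarrow> t \<le> e \<Longrightarrow> \<iota> x + t *\<^sub>R d \<in> \<iota> ` \<sigma>"
  obtains t y where "t > 0" "t \<le> e" "y \<in> \<sigma>" "y \<in> W" "\<iota> y = \<iota> x + t *\<^sub>R d"
proof -
  obtain Q where Q: "open Q" "\<And>x. x \<in> \<sigma> \<Longrightarrow> x \<in> W \<longleftrightarrow> \<iota> x \<in> Q"
    using open_in_cell[OF e s W] by metis
  then have "\<iota> x \<in> Q" using x by auto
  then obtain r where r: "r > 0" "ball (\<iota> x) r \<subseteq> Q" using Q(1) open_contains_ball by blast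
  \<comment> \<open>The denominator makes the displacement at most \<open>r / 2\<close>, also when
    \<open>d = 0\<close>.\<close>
  define t where "t = min e (r / (2 * (norm d + 1)))"
  have n: "norm d + 1 > 0" by (simp add: add_nonneg_pos)
  have t: "t > 0" "t \<le> e" using d(1) r(1) n by (auto simp: t_def)
  have "t * norm d \<le> r / (2 * (norm d + 1)) * (norm d + 1)"
    using t by (intro mult_mono) (auto simp: t_def)
  also have "\<dots> = r / 2" using n by (simp add: field_simps)
  finally have "t * norm d < r" using r(1) by simp
  then have "\<iota> x + t *\<^sub>R d \<in> ball (\<iota> x) r" using t by (simp add: dist_norm)
  then have "\<iota> x + t *\<^sub>R d \<in> Q" using r by auto
  moreover obtain y where "y \<in> \<sigma>" "\<iota> y = \<iota> x + t *\<^sub>R d" using d(2)[OF t] by auto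
  ultimately show ?thesis using that t Q(2) by metis
qed

text \<open>From a relative interior point inside \<open>W\<close> a short step along
  \<open>d\<close> stays in the cell and in \<open>W\<close>. So the arbitrary choice in
  \<open>pa_lin\<close> is determined on the directions of the cell.\<close>

lemma linear_agree_dirs:
  assumes e: "epc_complex T \<iota> PP" and s: "\<sigma> \<in> PP" "\<sigma> \<inter> W \<noteq> {}" and W: "openin T W"
    and l: "linear l" "linear l'" "\<And>x. x \<in> \<sigma> \<Longrightarrow> x \<in> W \<Longrightarrow> l (\<iota> x) = l' (\<iota> x)"
    and d: "d \<in> dirs (\<iota> ` \<sigma>)"
  shows "(l d :: real) = l' d"
proof -
  obtain x where x: "x \<in> \<sigma>" "x \<in> W" "\<iota> x \<in> rel_interior (\<iota> ` \<sigma>)"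
    using rel_interior_point_in_open[OF e s W] .
  obtain r where r: "r > 0" "\<And>t. \<bar>t\<bar> \<le> r \<Longrightarrow> \<iota> x + t *\<^sub>R d \<in> \<iota> ` \<sigma>"
    using rel_interior_extend[OF x(3) d] by auto
  obtain t y where t: "t > 0" "t \<le> r" "y \<in> \<sigma>" "y \<in> W" "\<iota> y = \<iota> x + t *\<^sub>R d"
    by (rule cell_move[OF e s(1) W x(1,2) r(1), of d]) (use r(2) in auto)
  have "l (\<iota> x + t *\<^sub>R d) = l' (\<iota> x + t *\<^sub>R d)" using l(3)[OF t(3,4)] t(5) by simp
  then show ?thesis using l(3)[OF x(1,2)] t(1) l(1,2) by (simp add: linear_add linear_scale)
qed

lemma pa_lin_props:
  assumes "pa_on \<iota> PP W g" "\<sigma> \<in> PP"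
  shows "linear (pa_lin \<iota> W g \<sigma>)" "\<And>x. x \<in> \<sigma> \<Longrightarrow> x \<in> W \<Longrightarrow> g x = pa_lin \<iota> W g \<sigma> (\<iota> x)"
proof -
  have "\<exists>l. linear l \<and> (\<forall>x\<in>\<sigma> \<inter> W. g x = l (\<iota> x))" using assms by (auto simp: pa_on_def)
  from someI_ex[OF this, folded pa_lin_def]
  show "linear (pa_lin \<iota> W g \<sigma>)" "\<And>x. x \<in> \<sigma> \<Longrightarrow> x \<in> W \<Longrightarrow> g x = pa_lin \<iota> W g \<sigma> (\<iota> x)" by auto
qed

lemma pa_lin_face:
  assumes e: "epc_complex T \<iota> PP" and W: "openin T W" and g: "pa_on \<iota> PP W g"
    and s: "\<sigma> \<in> PP" "\<tau> \<in> PP" "\<tau> \<subseteq> \<sigma>" "\<tau> \<inter> W \<noteq> {}" and d: "d \<in> dirs (\<iota> ` \<tau>)"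
  shows "pa_lin \<iota> W g \<sigma> d = pa_lin \<iota> W g \<tau> d"
proof (rule linear_agree_dirs[OF e s(2,4) W _ _ _ d])
  fix x assume x: "x \<in> \<tau>" "x \<in> W"
  then have xs: "x \<in> \<sigma>" using s(3) by auto
  show "pa_lin \<iota> W g \<sigma> (\<iota> x) = pa_lin \<iota> W g \<tau> (\<iota> x)"
    unfolding pa_lin_props(2)[OF g s(1) xs x(2), symmetric] using pa_lin_props(2)[OF g s(2) x] by simp
qed (use pa_lin_props(1)[OF g] s in auto)

text \<open>Carries the sums over faces in \<open>diamond\<close> over to cells.\<close>

lemma intermediate_faces_bij:
  assumes e: "epc_complex T \<iota> PP" and s: "\<sigma> \<in> PP" "\<rho> \<in> PP" "\<rho> \<subseteq> \<sigma>"
  shows "bij_betw ((`) \<iota>) {\<tau> \<in> PP. \<rho> \<subseteq> \<tau> \<and> pdim \<iota> \<tau> = m \<and> \<tau> \<subseteq> \<sigma>}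
    {F. F face_of (\<iota> ` \<sigma>) \<and> \<iota> ` \<rho> \<subseteq> F \<and> aff_dim F = m}"
  unfolding bij_betw_def
proof
  have inj: "\<And>A B. A \<subseteq> \<sigma> \<Longrightarrow> B \<subseteq> \<sigma> \<Longrightarrow> \<iota> ` A \<subseteq> \<iota> ` B \<Longrightarrow> A \<subseteq> B"
    using inj_on_image_subsetD[OF epcD(4)[OF e s(1)]] .
  show "inj_on ((`) \<iota>) {\<tau> \<in> PP. \<rho> \<subseteq> \<tau> \<and> pdim \<iota> \<tau> = m \<and> \<tau> \<subseteq> \<sigma>}"
  proof (rule inj_onI)
    fix A B assume A: "A \<in> {\<tau> \<in> PP. \<rho> \<subseteq> \<tau> \<and> pdim \<iota> \<tau> = m \<and> \<tau> \<subseteq> \<sigma>}"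
      and B: "B \<in> {\<tau> \<in> PP. \<rho> \<subseteq> \<tau> \<and> pdim \<iota> \<tau> = m \<and> \<tau> \<subseteq> \<sigma>}" and eq: "\<iota> ` A = \<iota> ` B"
    show "A = B" using inj[of A B] inj[of B A] A B eq by blast
  qed
  show "(`) \<iota> ` {\<tau> \<in> PP. \<rho> \<subseteq> \<tau> \<and> pdim \<iota> \<tau> = m \<and> \<tau> \<subseteq> \<sigma>} =
    {F. F face_of (\<iota> ` \<sigma>) \<and> \<iota> ` \<rho> \<subseteq> F \<and> aff_dim F = m}" (is "?L = ?R")
  proof
    show "?L \<subseteq> ?R"
    proof
      fix F assume "F \<in> ?L"
      then obtain \<tau> where t: "\<tau> \<in> PP" "\<rho> \<subseteq> \<tau>" "pdim \<iota> \<tau> = m" "\<tau> \<subseteq> \<sigma>" "F = \<iota> ` \<tau>" by blast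
      then show "F \<in> ?R" using is_face_iff_subset[OF e s(1) t(1)] by (auto simp: is_face_def pdim_def)
    qed
    show "?R \<subseteq> ?L"
    proof
      fix F assume F: "F \<in> ?R"
      then have Ff: "F face_of (\<iota> ` \<sigma>)" by simp
      obtain \<tau> where t: "\<tau> \<in> PP" "\<iota> ` \<tau> = F" "\<tau> \<subseteq> \<sigma>" using face_cell[OF e s(1) Ff] .
      have "\<rho> \<subseteq> \<tau>" using inj[OF s(3) t(3)] F t(2) by auto
      then show "F \<in> ?L" using t F by (auto simp: pdim_def)
    qed
  qed
qed

text \<open>Summing over flags of cells, the identity \<open>diamond\<close> lets the two unit normals of a flag exchange
  roles; the inner sum over the big cells then vanishes by balancing.\<close>

lemma minkowski_pa_mult:
  assumes e: "epc_complex T \<iota> PP" and W: "openin T W" and g: "pa_on \<iota> PP W g" and m: "minkowski \<iota> PP W k c"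
  shows "minkowski \<iota> PP W (k - 1) (pa_mult \<iota> PP W g c)"
  unfolding minkowski_def
proof
  fix \<rho> assume "\<rho> \<in> restr_dim \<iota> PP W (k - 1 - 1)"
  then have r: "\<rho> \<in> PP" "\<rho> \<inter> W \<noteq> {}" "pdim \<iota> \<rho> = k - 2" by (auto simp: restr_dim_iff)
  have rne: "\<rho> \<noteq> {}" using r(2) by auto
  define A where "A = {\<tau> \<in> PP. \<rho> \<subseteq> \<tau> \<and> pdim \<iota> \<tau> = k - 1}"
  define D where "D = {\<sigma> \<in> PP. \<rho> \<subseteq> \<sigma> \<and> pdim \<iota> \<sigma> = k}"
  have fin: "finite A" "finite D" unfolding A_def D_def by (rule finite_cofaces[OF e rne])+
  have B: "cofaces \<iota> PP W k \<tau> = {\<sigma>. \<sigma> \<in> D \<and> \<tau> \<subseteq> \<sigma>}" if "\<tau> \<in> A" for \<tau>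
    using cofaces_eq[OF e, of \<tau> W k] that r(2) by (auto simp: A_def D_def)
  let ?g = "pa_lin \<iota> W g"
  have inner: "(\<Sum>\<tau>\<in>{\<tau>. \<tau> \<in> A \<and> \<tau> \<subseteq> \<sigma>}. (c \<sigma> * ?g \<sigma> (nvec \<iota> \<sigma> \<tau>)) *\<^sub>R nvec \<iota> \<tau> \<rho>)
      = (\<Sum>\<tau>\<in>{\<tau>. \<tau> \<in> A \<and> \<tau> \<subseteq> \<sigma>}. (c \<sigma> * ?g \<sigma> (nvec \<iota> \<tau> \<rho>)) *\<^sub>R nvec \<iota> \<sigma> \<tau>)" if s: "\<sigma> \<in> D" for \<sigma>
  proof -
    have s': "\<sigma> \<in> PP" "\<rho> \<subseteq> \<sigma>" "pdim \<iota> \<sigma> = k" using s by (auto simp: D_def)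
    let ?F = "{F. F face_of (\<iota> ` \<sigma>) \<and> \<iota> ` \<rho> \<subseteq> F \<and> aff_dim F = aff_dim (\<iota> ` \<rho>) + 1}"
    have km: "aff_dim (\<iota> ` \<rho>) + 1 = k - 1" using r(3) by (simp add: pdim_def)
    have set: "{\<tau>. \<tau> \<in> A \<and> \<tau> \<subseteq> \<sigma>} = {\<tau> \<in> PP. \<rho> \<subseteq> \<tau> \<and> pdim \<iota> \<tau> = k - 1 \<and> \<tau> \<subseteq> \<sigma>}" by (auto simp: A_def)
    have bij: "bij_betw ((`) \<iota>) {\<tau>. \<tau> \<in> A \<and> \<tau> \<subseteq> \<sigma>} ?F"
      unfolding set km by (rule intermediate_faces_bij[OF e s'(1) r(1) s'(2)])
    have "\<iota> ` \<rho> face_of \<iota> ` \<sigma>" using is_face_iff_subset[OF e s'(1) r(1)] s'(2) by (simp add: is_face_def)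
    then have "(\<Sum>F\<in>?F. ?g \<sigma> (nv (\<iota> ` \<sigma>) F) *\<^sub>R nv F (\<iota> ` \<rho>)) = (\<Sum>F\<in>?F. ?g \<sigma> (nv F (\<iota> ` \<rho>)) *\<^sub>R nv (\<iota> ` \<sigma>) F)"
      using rne s'(3) r(3) pa_lin_props(1)[OF g s'(1)]
      by (intro diamond epcD(5)[OF e s'(1)]) (auto simp: pdim_def)
    then have "(\<Sum>\<tau>\<in>{\<tau>. \<tau> \<in> A \<and> \<tau> \<subseteq> \<sigma>}. ?g \<sigma> (nvec \<iota> \<sigma> \<tau>) *\<^sub>R nvec \<iota> \<tau> \<rho>)
        = (\<Sum>\<tau>\<in>{\<tau>. \<tau> \<in> A \<and> \<tau> \<subseteq> \<sigma>}. ?g \<sigma> (nvec \<iota> \<tau> \<rho>) *\<^sub>R nvec \<iota> \<sigma> \<tau>)"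
      unfolding nvec_eq_nv sum.reindex_bij_betw[OF bij, symmetric] .
    then have "c \<sigma> *\<^sub>R (\<Sum>\<tau>\<in>{\<tau>. \<tau> \<in> A \<and> \<tau> \<subseteq> \<sigma>}. ?g \<sigma> (nvec \<iota> \<sigma> \<tau>) *\<^sub>R nvec \<iota> \<tau> \<rho>)
        = c \<sigma> *\<^sub>R (\<Sum>\<tau>\<in>{\<tau>. \<tau> \<in> A \<and> \<tau> \<subseteq> \<sigma>}. ?g \<sigma> (nvec \<iota> \<tau> \<rho>) *\<^sub>R nvec \<iota> \<sigma> \<tau>)" by simp
    then show ?thesis by (simp only: scaleR_sum_right scaleR_scaleR)
  qed
  have "cofaces \<iota> PP W (k - 1) \<rho> = A" unfolding A_def by (rule cofaces_eq[OF e r(1,2)])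
  then have "(\<Sum>\<tau>\<in>cofaces \<iota> PP W (k - 1) \<rho>. pa_mult \<iota> PP W g c \<tau> *\<^sub>R nvec \<iota> \<tau> \<rho>)
      = (\<Sum>\<tau>\<in>A. pa_mult \<iota> PP W g c \<tau> *\<^sub>R nvec \<iota> \<tau> \<rho>)" by simp
  also have "\<dots> = - (\<Sum>\<tau>\<in>A. \<Sum>\<sigma>\<in>{\<sigma>. \<sigma> \<in> D \<and> \<tau> \<subseteq> \<sigma>}. (c \<sigma> * ?g \<sigma> (nvec \<iota> \<sigma> \<tau>)) *\<^sub>R nvec \<iota> \<tau> \<rho>)"
  proof (subst sum_negf[symmetric], rule sum.cong[OF refl])
    fix \<tau> assume t: "\<tau> \<in> A"
    then have "pdim \<iota> \<tau> + 1 = k" by (simp add: A_def)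
    then have "pa_mult \<iota> PP W g c \<tau> = - (\<Sum>\<sigma>\<in>{\<sigma>. \<sigma> \<in> D \<and> \<tau> \<subseteq> \<sigma>}. c \<sigma> * ?g \<sigma> (nvec \<iota> \<sigma> \<tau>))"
      unfolding pa_mult_def by (simp add: B[OF t])
    then show "pa_mult \<iota> PP W g c \<tau> *\<^sub>R nvec \<iota> \<tau> \<rho> = - (\<Sum>\<sigma>\<in>{\<sigma>. \<sigma> \<in> D \<and> \<tau> \<subseteq> \<sigma>}. (c \<sigma> * ?g \<sigma> (nvec \<iota> \<sigma> \<tau>)) *\<^sub>R nvec \<iota> \<tau> \<rho>)"
      by (simp add: scaleR_sum_left)
  qed
  also have "(\<Sum>\<tau>\<in>A. \<Sum>\<sigma>\<in>{\<sigma>. \<sigma> \<in> D \<and> \<tau> \<subseteq> \<sigma>}. (c \<sigma> * ?g \<sigma> (nvec \<iota> \<sigma> \<tau>)) *\<^sub>R nvec \<iota> \<tau> \<rho>)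
      = (\<Sum>\<sigma>\<in>D. \<Sum>\<tau>\<in>{\<tau>. \<tau> \<in> A \<and> \<tau> \<subseteq> \<sigma>}. (c \<sigma> * ?g \<sigma> (nvec \<iota> \<sigma> \<tau>)) *\<^sub>R nvec \<iota> \<tau> \<rho>)" by (rule sum.swap_restrict[OF fin])
  also have "\<dots> = (\<Sum>\<sigma>\<in>D. \<Sum>\<tau>\<in>{\<tau>. \<tau> \<in> A \<and> \<tau> \<subseteq> \<sigma>}. (c \<sigma> * ?g \<sigma> (nvec \<iota> \<tau> \<rho>)) *\<^sub>R nvec \<iota> \<sigma> \<tau>)"
    by (rule sum.cong[OF refl inner])
  also have "\<dots> = (\<Sum>\<tau>\<in>A. \<Sum>\<sigma>\<in>{\<sigma>. \<sigma> \<in> D \<and> \<tau> \<subseteq> \<sigma>}. (c \<sigma> * ?g \<sigma> (nvec \<iota> \<tau> \<rho>)) *\<^sub>R nvec \<iota> \<sigma> \<tau>)" by (rule sum.swap_restrict[OF fin, symmetric])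
  \<comment> \<open>The normal from \<open>\<rho>\<close> into \<open>\<tau>\<close> is tangent to
    \<open>\<tau>\<close>, where the linear parts of all cofaces agree; the factor leaves the sum,
    and balancing at \<open>\<tau>\<close> remains.\<close>
  also have "\<dots> = (\<Sum>\<tau>\<in>A. 0)"
  proof (rule sum.cong[OF refl])
    fix \<tau> assume t: "\<tau> \<in> A"
    then have t': "\<tau> \<in> PP" "\<tau> \<inter> W \<noteq> {}" "pdim \<iota> \<tau> = k - 1" "\<rho> \<subseteq> \<tau>" using r(2) by (auto simp: A_def)
    have "wall (\<iota> ` \<tau>) (\<iota> ` \<rho>)" by (rule wall_cells[OF e t'(1) r(1) rne t'(4)]) (simp add: t'(3) r(3))
    then have u: "nvec \<iota> \<tau> \<rho> \<in> dirs (\<iota> ` \<tau>)" unfolding nvec_eq_nv by (rule nv_props)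
    have "(\<Sum>\<sigma>\<in>{\<sigma>. \<sigma> \<in> D \<and> \<tau> \<subseteq> \<sigma>}. (c \<sigma> * ?g \<sigma> (nvec \<iota> \<tau> \<rho>)) *\<^sub>R nvec \<iota> \<sigma> \<tau>)
        = (\<Sum>\<sigma>\<in>{\<sigma>. \<sigma> \<in> D \<and> \<tau> \<subseteq> \<sigma>}. ?g \<tau> (nvec \<iota> \<tau> \<rho>) *\<^sub>R (c \<sigma> *\<^sub>R nvec \<iota> \<sigma> \<tau>))"
    proof (rule sum.cong[OF refl])
      fix \<sigma> assume "\<sigma> \<in> {\<sigma>. \<sigma> \<in> D \<and> \<tau> \<subseteq> \<sigma>}"
      then have "\<sigma> \<in> PP" "\<tau> \<subseteq> \<sigma>" by (auto simp: D_def)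
      from pa_lin_face[OF e W g this(1) t'(1) this(2) t'(2) u]
      show "(c \<sigma> * ?g \<sigma> (nvec \<iota> \<tau> \<rho>)) *\<^sub>R nvec \<iota> \<sigma> \<tau> = ?g \<tau> (nvec \<iota> \<tau> \<rho>) *\<^sub>R (c \<sigma> *\<^sub>R nvec \<iota> \<sigma> \<tau>)" by simp
    qed
    also have "\<dots> = ?g \<tau> (nvec \<iota> \<tau> \<rho>) *\<^sub>R (\<Sum>\<sigma>\<in>cofaces \<iota> PP W k \<tau>. c \<sigma> *\<^sub>R nvec \<iota> \<sigma> \<tau>)"
      unfolding B[OF t] by (rule scaleR_sum_right[symmetric])
    also have "\<dots> = 0"
      using m t' unfolding minkowski_def by (simp add: restr_dim_iff)
    finally show "(\<Sum>\<sigma>\<in>{\<sigma>. \<sigma> \<in> D \<and> \<tau> \<subseteq> \<sigma>}. (c \<sigma> * ?g \<sigma> (nvec \<iota> \<tau> \<rho>)) *\<^sub>R nvec \<iota> \<sigma> \<tau>) = 0" .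
  qed
  finally show "(\<Sum>\<tau>\<in>cofaces \<iota> PP W (k - 1) \<rho>. pa_mult \<iota> PP W g c \<tau> *\<^sub>R nvec \<iota> \<tau> \<rho>) = 0" by simp
qed

section \<open>Pullback of weights and positive cycles\<close>

lemma same_dim_container_unique:
  assumes e: "epc_complex T \<iota> PP" and s: "\<sigma> \<in> PP" "\<sigma>' \<subseteq> \<sigma>" "pdim \<iota> \<sigma> = pdim \<iota> \<sigma>'"
    and s1: "\<sigma>1 \<in> PP" "\<sigma>' \<subseteq> \<sigma>1" "pdim \<iota> \<sigma>1 = pdim \<iota> \<sigma>'"
  shows "\<sigma>1 = \<sigma>"
proof -
  \<comment> \<open>The common face \<open>?I\<close> contains \<open>\<sigma>'\<close>, hence has
    its dimension and equals both cells. This makes the \<open>THE\<close> in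
    \<open>pullback\<close> well defined.\<close>
  let ?I = "\<sigma> \<inter> \<sigma>1"
  have f: "\<iota> ` ?I face_of \<iota> ` \<sigma>" using epcD(9)[OF e s(1) s1(1)] .
  obtain \<tau> where t: "\<tau> \<in> PP" "\<iota> ` \<tau> = \<iota> ` ?I" "\<tau> \<subseteq> \<sigma>" using face_cell[OF e s(1) f] .
  have "\<tau> \<subseteq> ?I" "?I \<subseteq> \<tau>"
    by (rule inj_on_image_subsetD[OF epcD(4)[OF e s(1)]]; use t in simp)+
  then have tI: "\<tau> = ?I" by auto
  then have "\<sigma>' \<subseteq> \<tau>" using s s1 by auto
  then have "pdim \<iota> \<sigma>' \<le> pdim \<iota> \<tau>" by (rule pdim_mono)
  moreover have "pdim \<iota> \<tau> \<le> pdim \<iota> \<sigma>" "pdim \<iota> \<tau> \<le> pdim \<iota> \<sigma>1" using tI by (auto intro: pdim_mono)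
  ultimately have "pdim \<iota> \<tau> = pdim \<iota> \<sigma>" "pdim \<iota> \<tau> = pdim \<iota> \<sigma>1" using s(3) s1(3) by auto
  then have "\<tau> = \<sigma>" "\<tau> = \<sigma>1"
    using cell_eqI[OF e s(1) t(1) t(3)] cell_eqI[OF e s1(1) t(1)] tI by auto
  then show ?thesis by simp
qed

lemma pullback_eq:
  assumes e: "epc_complex T \<iota> PP" and s: "\<sigma> \<in> PP" "\<sigma>' \<subseteq> \<sigma>" "pdim \<iota> \<sigma> = pdim \<iota> \<sigma>'"
  shows "pullback \<iota> PP c \<sigma>' = c \<sigma>"
proof -
  have "(THE \<sigma>. \<sigma> \<in> PP \<and> \<sigma>' \<subseteq> \<sigma> \<and> pdim \<iota> \<sigma> = pdim \<iota> \<sigma>') = \<sigma>"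
  proof (rule the_equality)
    show "\<sigma> \<in> PP \<and> \<sigma>' \<subseteq> \<sigma> \<and> pdim \<iota> \<sigma> = pdim \<iota> \<sigma>'" using s by simp
  qed (rule same_dim_container_unique[OF e s]; simp)
  then show ?thesis using s unfolding pullback_def by auto
qed

text \<open>A positive cycle is known to be nonnegative on some representative only. A cell of
  \<open>PP\<close> contains a cell of the common subdivision of equal dimension, through which the
  two weights are compared.\<close>

lemma positive_cycle_weight:
  assumes c: "in_class T \<iota> PP0 PP" and p: "positive_cycle T \<iota> PP0 W k PP c"
  shows "positive_weight \<iota> PP W k c"
  unfolding positive_weight_def
proof
  fix \<sigma> assume "\<sigma> \<in> restr_dim \<iota> PP W k"
  then have s: "\<sigma> \<in> PP" "\<sigma> \<inter> W \<noteq> {}" "pdim \<iota> \<sigma> = k" by (auto simp: restr_dim_iff)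
  note e = in_classD(1)[OF c]
  obtain PP1 c1 where P1: "in_class T \<iota> PP0 PP1" "positive_weight \<iota> PP1 W k c1" "same_cycle T \<iota> PP0 W k PP c PP1 c1"
    using p by (auto simp: positive_cycle_def)
  obtain PP' where P': "in_class T \<iota> PP0 PP'" "subdivides PP' PP" "subdivides PP' PP1"
    "\<And>\<sigma>'. \<sigma>' \<in> restr_dim \<iota> PP' W k \<Longrightarrow> pullback \<iota> PP c \<sigma>' = pullback \<iota> PP1 c1 \<sigma>'"
    using P1(3) by (auto simp: same_cycle_def)
  obtain z where z: "z \<in> \<sigma>" "z \<in> W" using s by auto
  obtain \<sigma>' where s': "\<sigma>' \<in> PP'" "z \<in> \<sigma>'" "\<sigma>' \<subseteq> \<sigma>" "pdim \<iota> \<sigma>' = pdim \<iota> \<sigma>"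
    using refine_same_dim[OF e in_classD(1)[OF P'(1)] P'(2) s(1) z(1)] .
  have "pullback \<iota> PP c \<sigma>' = c \<sigma>" by (rule pullback_eq[OF e s(1) s'(3)]) (simp add: s'(4))
  moreover have "pullback \<iota> PP c \<sigma>' = pullback \<iota> PP1 c1 \<sigma>'"
    by (rule P'(4)) (use s' s z in \<open>auto simp: restr_dim_iff\<close>)
  moreover have "pullback \<iota> PP1 c1 \<sigma>' \<ge> 0"
  proof (cases "\<exists>\<sigma>1\<in>PP1. \<sigma>' \<subseteq> \<sigma>1 \<and> pdim \<iota> \<sigma>1 = pdim \<iota> \<sigma>'")
    case True
    then obtain \<sigma>1 where s1: "\<sigma>1 \<in> PP1" "\<sigma>' \<subseteq> \<sigma>1" "pdim \<iota> \<sigma>1 = pdim \<iota> \<sigma>'" by auto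
    have "z \<in> \<sigma>1 \<inter> W" using s1 s' z by auto
    then have "\<sigma>1 \<in> restr_dim \<iota> PP1 W k" unfolding restr_dim_iff using s1 s' s by auto
    then have "c1 \<sigma>1 \<ge> 0" using P1(2) unfolding positive_weight_def by auto
    then show ?thesis using pullback_eq[OF in_classD(1)[OF P1(1)] s1] by simp
  next
    \<comment> \<open>\<open>pullback\<close> has its default value 0 here.\<close>
    case False
    then show ?thesis by (simp only: pullback_def if_False order_refl)
  qed
  ultimately show "c \<sigma> \<ge> 0" by simp
qed

lemma same_cycle_refl: "in_class T \<iota> PP0 PP \<Longrightarrow> same_cycle T \<iota> PP0 W k PP c PP c"
  unfolding same_cycle_def using subdivides_refl by blast

section \<open>Sums of minima of linear forms as concave functions\<close>

definition minsum :: "'v::euclidean_space set \<Rightarrow> 'v \<Rightarrow> real" where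
  "minsum L y = (\<Sum>w\<in>L. min 0 (w \<bullet> y))"

text \<open>The vector \<open>m\<close> sums the forms that are negative at \<open>z\<close>: a
  supergradient of the concave function at \<open>z\<close>. The form \<open>w0\<close> vanishes at
  \<open>z\<close> and is left out, so its kink can be kept on the right; \<open>w0 = 0\<close>
  gives the plain supporting inequality.\<close>

lemma minsum_support:
  assumes L: "finite L" and w0: "w0 = 0 \<or> w0 \<in> L" "w0 \<bullet> z = 0"
  obtains m where "minsum L z = m \<bullet> z" "\<And>y. minsum L y \<le> m \<bullet> y + min 0 (w0 \<bullet> y)"
proof -
  define m where "m = (\<Sum>w\<in>L. if w \<bullet> z < 0 then w else 0)"
  have "minsum L z = m \<bullet> z"
    unfolding minsum_def m_def inner_sum_left by (rule sum.cong) auto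
  moreover have "minsum L y \<le> m \<bullet> y + min 0 (w0 \<bullet> y)" for y
  proof (cases "w0 \<in> L")
    case True
    have "minsum L y = min 0 (w0 \<bullet> y) + (\<Sum>w\<in>L-{w0}. min 0 (w \<bullet> y))"
      unfolding minsum_def by (rule sum.remove[OF L True])
    also have "(\<Sum>w\<in>L-{w0}. min 0 (w \<bullet> y)) \<le> (\<Sum>w\<in>L-{w0}. (if w \<bullet> z < 0 then w else 0) \<bullet> y)"
      by (rule sum_mono) auto
    also have "\<dots> = m \<bullet> y"
      unfolding m_def sum.remove[OF L True] using w0 by (simp add: inner_sum_left)
    finally show ?thesis by simp
  next
    case False
    then have "w0 = 0" using w0 by auto
    moreover have "minsum L y \<le> m \<bullet> y"
      unfolding minsum_def m_def inner_sum_left by (rule sum_mono) auto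
    ultimately show ?thesis by simp
  qed
  ultimately show ?thesis using that by blast
qed

text \<open>Balancing annihilates linear functions, so a supporting linear function at a relative
  interior point of \<open>\<tau>\<close> may be subtracted. What remains along each coface is at
  most the kink of \<open>w0\<close>. Taking \<open>w0 = 0\<close> yields positivity, a form from
  \<open>L\<close> strict positivity.\<close>

lemma pa_mult_minsum_ge:
  assumes e: "epc_complex T \<iota> PP" and W: "openin T W" and L: "finite L"
    and g: "pa_on \<iota> PP W (minsum L \<circ> \<iota>)" and m: "minkowski \<iota> PP W k c" and p: "positive_weight \<iota> PP W k c"
    and t: "\<tau> \<in> restr_dim \<iota> PP W (k - 1)" and w0: "w0 = 0 \<or> w0 \<in> L" "\<And>x. x \<in> \<tau> \<Longrightarrow> w0 \<bullet> \<iota> x = 0"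
  shows "pa_mult \<iota> PP W (minsum L \<circ> \<iota>) c \<tau> \<ge> - (\<Sum>\<sigma>\<in>cofaces \<iota> PP W k \<tau>. c \<sigma> * min 0 (w0 \<bullet> nvec \<iota> \<sigma> \<tau>))"
proof -
  have t': "\<tau> \<in> PP" "\<tau> \<inter> W \<noteq> {}" "pdim \<iota> \<tau> = k - 1" using t by (auto simp: restr_dim_iff)
  have tne: "\<tau> \<noteq> {}" using t' by auto
  let ?g = "pa_lin \<iota> W (minsum L \<circ> \<iota>)"
  obtain z where z: "z \<in> \<tau>" "z \<in> W" "\<iota> z \<in> rel_interior (\<iota> ` \<tau>)"
    using rel_interior_point_in_open[OF e t'(1,2) W] .
  obtain q where q: "minsum L (\<iota> z) = q \<bullet> \<iota> z" "\<And>y. minsum L y \<le> q \<bullet> y + min 0 (w0 \<bullet> y)"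
    by (rule minsum_support[OF L w0(1) w0(2)[OF z(1)]]) blast
  note C = cofaces_eq[OF e t'(1,2), of k]
  have le: "c \<sigma> * ?g \<sigma> (nvec \<iota> \<sigma> \<tau>) \<le> c \<sigma> * (q \<bullet> nvec \<iota> \<sigma> \<tau>) + c \<sigma> * min 0 (w0 \<bullet> nvec \<iota> \<sigma> \<tau>)"
    if "\<sigma> \<in> cofaces \<iota> PP W k \<tau>" for \<sigma>
  proof -
    have s: "\<sigma> \<in> PP" "\<tau> \<subseteq> \<sigma>" "pdim \<iota> \<sigma> = k" using that unfolding C by auto
    have w: "wall (\<iota> ` \<sigma>) (\<iota> ` \<tau>)" by (rule wall_cells[OF e s(1) t'(1) tne s(2)]) (simp add: t' s)
    let ?v = "nvec \<iota> \<sigma> \<tau>"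
    obtain r where r: "r > 0" "\<And>t. 0 < t \<Longrightarrow> t \<le> r \<Longrightarrow> \<iota> z + t *\<^sub>R ?v \<in> rel_interior (\<iota> ` \<sigma>)"
      using nv_move[OF w z(3)] unfolding nvec_eq_nv by auto
    have zs: "z \<in> \<sigma>" using z s by auto
    obtain t y where y: "t > 0" "t \<le> r" "y \<in> \<sigma>" "y \<in> W" "\<iota> y = \<iota> z + t *\<^sub>R ?v"
      by (rule cell_move[OF e s(1) W zs z(2) r(1), of ?v]) (use r(2) rel_interior_subset in blast)+
    note pl = pa_lin_props[OF g s(1)]
    have "t * ?g \<sigma> ?v = ?g \<sigma> (\<iota> y) - ?g \<sigma> (\<iota> z)"
      unfolding y(5) using pl(1) by (simp add: linear_add linear_scale)
    also have "\<dots> = minsum L (\<iota> y) - minsum L (\<iota> z)" using pl(2)[OF y(3,4)] pl(2)[OF zs z(2)] by simp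
    also have "\<dots> \<le> q \<bullet> \<iota> y + min 0 (w0 \<bullet> \<iota> y) - q \<bullet> \<iota> z" using q by (simp add: q(1))
    also have "\<dots> = t * (q \<bullet> ?v) + min 0 (t * (w0 \<bullet> ?v))" unfolding y(5) using w0(2)[OF z(1)] by (simp add: inner_add_right)
    also have "min 0 (t * (w0 \<bullet> ?v)) = t * min 0 (w0 \<bullet> ?v)" using y(1) by (auto simp: min_def zero_le_mult_iff mult_le_0_iff)
    finally have "t * ?g \<sigma> ?v \<le> t * (q \<bullet> ?v + min 0 (w0 \<bullet> ?v))" by (simp only: distrib_left)
    then have "?g \<sigma> ?v \<le> q \<bullet> ?v + min 0 (w0 \<bullet> ?v)" using y(1) by simp
    moreover have "c \<sigma> \<ge> 0" using p that unfolding positive_weight_def cofaces_def by auto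
    ultimately show ?thesis by (metis mult_left_mono distrib_left)
  qed
  have "(\<Sum>\<sigma>\<in>cofaces \<iota> PP W k \<tau>. c \<sigma> * ?g \<sigma> (nvec \<iota> \<sigma> \<tau>))
      \<le> (\<Sum>\<sigma>\<in>cofaces \<iota> PP W k \<tau>. c \<sigma> * (q \<bullet> nvec \<iota> \<sigma> \<tau>)) + (\<Sum>\<sigma>\<in>cofaces \<iota> PP W k \<tau>. c \<sigma> * min 0 (w0 \<bullet> nvec \<iota> \<sigma> \<tau>))"
    unfolding sum.distrib[symmetric] by (rule sum_mono[OF le])
  moreover have "(\<Sum>\<sigma>\<in>cofaces \<iota> PP W k \<tau>. c \<sigma> * (q \<bullet> nvec \<iota> \<sigma> \<tau>)) = q \<bullet> (\<Sum>\<sigma>\<in>cofaces \<iota> PP W k \<tau>. c \<sigma> *\<^sub>R nvec \<iota> \<sigma> \<tau>)"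
    by (simp add: inner_sum_right)
  moreover have "(\<Sum>\<sigma>\<in>cofaces \<iota> PP W k \<tau>. c \<sigma> *\<^sub>R nvec \<iota> \<sigma> \<tau>) = 0" using m t unfolding minkowski_def by auto
  moreover have "pdim \<iota> \<tau> + 1 = k" using t'(3) by simp
  ultimately show ?thesis unfolding pa_mult_def by simp
qed

lemma positive_pa_mult_minsum:
  assumes "epc_complex T \<iota> PP" "openin T W" "finite L"
    "pa_on \<iota> PP W (minsum L \<circ> \<iota>)" "minkowski \<iota> PP W k c" "positive_weight \<iota> PP W k c"
  shows "positive_weight \<iota> PP W (k - 1) (pa_mult \<iota> PP W (minsum L \<circ> \<iota>) c)"
  unfolding positive_weight_def using pa_mult_minsum_ge[OF assms, of _ 0] by auto

text \<open>By balancing, the slopes of \<open>w0\<close> along the cofaces have weighted sum zero.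
  One of them is nonzero with positive weight, so some weighted slope is negative and the bound of
  \<open>pa_mult_minsum_ge\<close> is positive.\<close>

lemma strict_pa_mult_minsum:
  assumes e: "epc_complex T \<iota> PP" and W: "openin T W" and L: "finite L"
    and g: "pa_on \<iota> PP W (minsum L \<circ> \<iota>)" and m: "minkowski \<iota> PP W k c" and p: "positive_weight \<iota> PP W k c"
    and t: "\<tau> \<in> restr_dim \<iota> PP W (k - 1)" and w0: "w0 \<in> L" "\<And>x. x \<in> \<tau> \<Longrightarrow> w0 \<bullet> \<iota> x = 0"
    and s: "\<sigma> \<in> cofaces \<iota> PP W k \<tau>" "c \<sigma> > 0" "x \<in> \<sigma>" "w0 \<bullet> \<iota> x \<noteq> 0"
  shows "pa_mult \<iota> PP W (minsum L \<circ> \<iota>) c \<tau> > 0"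
proof -
  let ?C = "cofaces \<iota> PP W k \<tau>"
  have t': "\<tau> \<in> PP" "\<tau> \<inter> W \<noteq> {}" "pdim \<iota> \<tau> = k - 1" using t by (auto simp: restr_dim_iff)
  have tne: "\<tau> \<noteq> {}" using t' by auto
  note C = cofaces_eq[OF e t'(1,2), of k]
  have fin: "finite ?C" unfolding C by (rule finite_cofaces[OF e tne])
  have s': "\<sigma> \<in> PP" "\<tau> \<subseteq> \<sigma>" "pdim \<iota> \<sigma> = k" using s(1) unfolding C by auto
  have w: "wall (\<iota> ` \<sigma>) (\<iota> ` \<tau>)" by (rule wall_cells[OF e s'(1) t'(1) tne s'(2)]) (simp add: t' s')
  obtain z where z: "z \<in> \<tau>" using tne by auto
  \<comment> \<open>A form vanishing on \<open>\<tau>\<close> and along the normal would vanish on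
    all of \<open>\<sigma>\<close>.\<close>
  have ne: "w0 \<bullet> nvec \<iota> \<sigma> \<tau> \<noteq> 0"
  proof
    assume 0: "w0 \<bullet> nvec \<iota> \<sigma> \<tau> = 0"
    let ?v = "nvec \<iota> \<sigma> \<tau>"
    have "\<iota> x - \<iota> z - (?v \<bullet> (\<iota> x - \<iota> z)) *\<^sub>R ?v \<in> dirs (\<iota> ` \<tau>)"
      unfolding nvec_eq_nv by (rule nv_decomp[OF w]) (use s z s' in \<open>auto intro!: diff_in_dirs\<close>)
    moreover have "\<forall>p\<in>\<iota> ` \<tau>. \<forall>q\<in>\<iota> ` \<tau>. w0 \<bullet> (p - q) = 0" using w0(2) by (auto simp: inner_diff_right)
    ultimately have "w0 \<bullet> (\<iota> x - \<iota> z - (?v \<bullet> (\<iota> x - \<iota> z)) *\<^sub>R ?v) = 0" by (rule orth_dirs[rotated])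
    then have "w0 \<bullet> \<iota> x = 0" using 0 w0(2)[OF z] by (simp add: inner_diff_right)
    then show False using s(4) by simp
  qed
  have cpos: "c \<sigma> \<ge> 0" if "\<sigma> \<in> ?C" for \<sigma> using p that unfolding positive_weight_def cofaces_def by auto
  have bal: "(\<Sum>\<sigma>\<in>?C. c \<sigma> * (w0 \<bullet> nvec \<iota> \<sigma> \<tau>)) = 0"
  proof -
    have "(\<Sum>\<sigma>\<in>?C. c \<sigma> * (w0 \<bullet> nvec \<iota> \<sigma> \<tau>)) = w0 \<bullet> (\<Sum>\<sigma>\<in>?C. c \<sigma> *\<^sub>R nvec \<iota> \<sigma> \<tau>)" by (simp add: inner_sum_right)
    also have "(\<Sum>\<sigma>\<in>?C. c \<sigma> *\<^sub>R nvec \<iota> \<sigma> \<tau>) = 0" using m t unfolding minkowski_def by auto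
    finally show ?thesis by simp
  qed
  have "(\<Sum>\<sigma>\<in>?C. c \<sigma> * \<bar>w0 \<bullet> nvec \<iota> \<sigma> \<tau>\<bar>) > 0"
    by (rule sum_pos2[OF fin s(1)]) (use s(2) ne cpos in auto)
  moreover have "c * \<bar>a\<bar> = c * a - 2 * (c * min 0 a)" for c a :: real by (simp add: min_def abs_if algebra_simps)
  then have "(\<Sum>\<sigma>\<in>?C. c \<sigma> * \<bar>w0 \<bullet> nvec \<iota> \<sigma> \<tau>\<bar>) = (\<Sum>\<sigma>\<in>?C. c \<sigma> * (w0 \<bullet> nvec \<iota> \<sigma> \<tau>)) - 2 * (\<Sum>\<sigma>\<in>?C. c \<sigma> * min 0 (w0 \<bullet> nvec \<iota> \<sigma> \<tau>))"
    by (simp add: sum_subtractf sum_distrib_left)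
  ultimately have "- (\<Sum>\<sigma>\<in>?C. c \<sigma> * min 0 (w0 \<bullet> nvec \<iota> \<sigma> \<tau>)) > 0" using bal by simp
  also have "\<dots> \<le> pa_mult \<iota> PP W (minsum L \<circ> \<iota>) c \<tau>"
    by (rule pa_mult_minsum_ge[OF e W L g m p t]) (use w0 in auto)
  finally show ?thesis .
qed

text \<open>Concavity is tested on positive cycles, the bounds above on weights;
  \<open>positive_cycle_weight\<close> supplies nonnegativity on the given complex.\<close>

lemma concave_minsum:
  assumes L: "finite L" and "in_class T \<iota> PP0 PP1" "pa_on \<iota> PP1 U (minsum L \<circ> \<iota>)"
  shows "concave_pa T \<iota> PP0 U (minsum L \<circ> \<iota>)"
  unfolding concave_pa_def
proof (intro conjI allI impI)
  fix W PP k c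
  assume a: "openin T W \<and> W \<subseteq> U \<and> in_class T \<iota> PP0 PP \<and> pa_on \<iota> PP W (minsum L \<circ> \<iota>) \<and>
       minkowski \<iota> PP W k c \<and> positive_cycle T \<iota> PP0 W k PP c"
  then have e: "epc_complex T \<iota> PP" using in_classD(1) by blast
  have "positive_weight \<iota> PP W k c" using positive_cycle_weight a by blast
  then have "positive_weight \<iota> PP W (k - 1) (pa_mult \<iota> PP W (minsum L \<circ> \<iota>) c)"
    using positive_pa_mult_minsum[OF e _ L] a by blast
  moreover have "minkowski \<iota> PP W (k - 1) (pa_mult \<iota> PP W (minsum L \<circ> \<iota>) c)"
    using minkowski_pa_mult[OF e] a by blast
  ultimately show "positive_cycle T \<iota> PP0 W (k - 1) PP (pa_mult \<iota> PP W (minsum L \<circ> \<iota>) c)"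
    unfolding positive_cycle_def using a same_cycle_refl by blast
qed (use assms in blast)

lemma pa_on_minsum:
  assumes "\<And>w \<sigma>. w \<in> L \<Longrightarrow> \<sigma> \<in> PP \<Longrightarrow> (\<forall>x\<in>\<sigma>. w \<bullet> \<iota> x \<ge> 0) \<or> (\<forall>x\<in>\<sigma>. w \<bullet> \<iota> x \<le> 0)"
  shows "pa_on \<iota> PP W (minsum L \<circ> \<iota>)"
  unfolding pa_on_def
proof
  fix \<sigma> assume s: "\<sigma> \<in> PP"
  \<comment> \<open>On \<open>\<sigma>\<close> each form has constant sign, so every minimum is
    linear there.\<close>
  define q where "q = (\<Sum>w\<in>L. if \<forall>x\<in>\<sigma>. w \<bullet> \<iota> x \<ge> 0 then 0 else w)"
  have "(minsum L \<circ> \<iota>) x = q \<bullet> \<iota> x" if "x \<in> \<sigma>" for x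
    unfolding minsum_def q_def comp_def inner_sum_left
  proof (rule sum.cong[OF refl])
    fix w assume "w \<in> L"
    then show "min 0 (w \<bullet> \<iota> x) = (if \<forall>x\<in>\<sigma>. w \<bullet> \<iota> x \<ge> 0 then 0 else w) \<bullet> \<iota> x"
      using assms[OF _ s, of w] that by auto
  qed
  then show "\<exists>l. linear l \<and> (\<forall>x\<in>\<sigma> \<inter> W. (minsum L \<circ> \<iota>) x = l (\<iota> x))"
    by (intro exI[of _ "\<lambda>y. q \<bullet> y"]) (auto simp: linear_iff inner_add_right)
qed

section \<open>The balancing condition on a subdivision\<close>

lemma wall_normal_pm:
  assumes w: "wall S F" and v: "v \<in> dirs S" "norm v = 1" "\<And>d. d \<in> dirs F \<Longrightarrow> v \<bullet> d = 0"
  shows "v = nv S F \<or> v = - nv S F"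
proof -
  let ?u = "nv S F"
  have e: "v - (?u \<bullet> v) *\<^sub>R ?u \<in> dirs F" (is "?d \<in> _") using nv_decomp[OF w v(1)] .
  have "?d \<bullet> ?d = v \<bullet> ?d - (?u \<bullet> v) * (?u \<bullet> ?d)" by (simp add: inner_diff_left)
  also have "\<dots> = 0" using v(3)[OF e] nv_props(3)[OF w e] by simp
  finally have e: "v = (?u \<bullet> v) *\<^sub>R ?u" by simp
  then have "norm v = \<bar>?u \<bullet> v\<bar>" using nv_props(2)[OF w] by (metis norm_scaleR mult.right_neutral)
  then have "?u \<bullet> v = 1 \<or> ?u \<bullet> v = -1" using v(2) by linarith
  then show ?thesis using e by (metis scaleR_minus1_left scaleR_one)
qed

text \<open>Close to \<open>\<tau>\<close> the images of both cofaces contain the same point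
  \<open>\<iota> z + t v\<close>, relatively interior to each. As \<iota> may identify points of
  different cells, a set \<open>S\<close> on which it is injective has to be given.\<close>

lemma coface_unique:
  assumes e: "epc_complex T \<iota> PP" and t: "\<tau> \<in> PP" "\<tau> \<noteq> {}"
    and s: "\<sigma> \<in> PP" "\<tau> \<subseteq> \<sigma>" "pdim \<iota> \<sigma> = pdim \<iota> \<tau> + 1"
    and s': "\<sigma>' \<in> PP" "\<tau> \<subseteq> \<sigma>'" "pdim \<iota> \<sigma>' = pdim \<iota> \<tau> + 1"
    and i: "inj_on \<iota> S" "\<sigma> \<subseteq> S" "\<sigma>' \<subseteq> S" and v: "nvec \<iota> \<sigma> \<tau> = nvec \<iota> \<sigma>' \<tau>"
  shows "\<sigma> = \<sigma>'"
proof -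
  have w: "wall (\<iota> ` \<sigma>) (\<iota> ` \<tau>)" "wall (\<iota> ` \<sigma>') (\<iota> ` \<tau>)"
    using wall_cells[OF e s(1) t(1,2) s(2,3)] wall_cells[OF e s'(1) t(1,2) s'(2,3)] by auto
  obtain z where z: "z \<in> \<tau>" "\<iota> z \<in> rel_interior (\<iota> ` \<tau>)" using rel_interior_point[OF e t] .
  let ?v = "nvec \<iota> \<sigma> \<tau>"
  obtain r where r: "r > 0" "\<And>t. 0 < t \<Longrightarrow> t \<le> r \<Longrightarrow> \<iota> z + t *\<^sub>R ?v \<in> rel_interior (\<iota> ` \<sigma>)"
    using nv_move[OF w(1) z(2)] unfolding nvec_eq_nv by auto
  obtain r' where r': "r' > 0" "\<And>t. 0 < t \<Longrightarrow> t \<le> r' \<Longrightarrow> \<iota> z + t *\<^sub>R ?v \<in> rel_interior (\<iota> ` \<sigma>')"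
    using nv_move[OF w(2) z(2)] v[unfolded nvec_eq_nv] unfolding nvec_eq_nv by auto
  define p where "p = \<iota> z + (min r r') *\<^sub>R ?v"
  have p: "p \<in> rel_interior (\<iota> ` \<sigma>)" "p \<in> rel_interior (\<iota> ` \<sigma>')" using r r' by (auto simp: p_def)
  then have "p \<in> \<iota> ` \<sigma>" "p \<in> \<iota> ` \<sigma>'" using rel_interior_subset by auto
  then obtain y y' where y: "y \<in> \<sigma>" "\<iota> y = p" "y' \<in> \<sigma>'" "\<iota> y' = p" by auto
  then have "y = y'" using inj_onD[OF i(1), of y y'] i by auto
  then show ?thesis
    using cell_face[OF e s(1) s'(1), of y] cell_face[OF e s'(1) s(1), of y] y p by auto
qed

text \<open>A codimension one cell of the subdivision either lies in one of the original complex, and the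
  two balancing conditions agree, or it cuts through a top cell, and its two cofaces carry equal
  weights and opposite normals.\<close>

lemma minkowski_pullback:
  assumes eb: "epc_complex T \<iota> PPb" and e: "epc_complex T \<iota> PP" and sub: "subdivides PP PPb"
    and dim: "\<And>\<sigma>. \<sigma> \<in> PPb \<Longrightarrow> pdim \<iota> \<sigma> \<le> n" and U: "openin T U" and m: "minkowski \<iota> PPb U n b"
  shows "minkowski \<iota> PP U n (pullback \<iota> PPb b)"
  unfolding minkowski_def
proof
  fix \<tau>' assume "\<tau>' \<in> restr_dim \<iota> PP U (n - 1)"
  then have t': "\<tau>' \<in> PP" "\<tau>' \<inter> U \<noteq> {}" "pdim \<iota> \<tau>' = n - 1" by (auto simp: restr_dim_iff)
  have tne: "\<tau>' \<noteq> {}" using t' by auto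
  obtain z where z: "z \<in> \<tau>'" "z \<in> U" "\<iota> z \<in> rel_interior (\<iota> ` \<tau>')"
    using rel_interior_point_in_open[OF e t'(1,2) U] .
  have zT: "z \<in> topspace T" using z epcD(10)[OF e t'(1)] by auto
  obtain \<tau> where t: "\<tau> \<in> PPb" "z \<in> \<tau>" "\<iota> z \<in> rel_interior (\<iota> ` \<tau>)" using cell_min_point[OF eb zT] .
  have tt: "\<tau>' \<subseteq> \<tau>" by (rule subdivides_carrier[OF eb e sub t'(1) t(1) z(1) t(2) z(3)])
  define C' where "C' = {\<sigma> \<in> PP. \<tau>' \<subseteq> \<sigma> \<and> pdim \<iota> \<sigma> = n}"
  have C': "cofaces \<iota> PP U n \<tau>' = C'" unfolding C'_def by (rule cofaces_eq[OF e t'(1,2)])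
  have con: "\<exists>\<sigma>\<in>PPb. \<sigma>' \<subseteq> \<sigma> \<and> \<tau> \<subseteq> \<sigma> \<and> pdim \<iota> \<sigma> = n \<and> pullback \<iota> PPb b \<sigma>' = b \<sigma>" if s': "\<sigma>' \<in> C'" for \<sigma>'
  proof -
    obtain \<sigma> where s: "\<sigma> \<in> PPb" "\<sigma>' \<subseteq> \<sigma>" using s' sub by (auto simp: C'_def subdivides_def)
    have n: "pdim \<iota> \<sigma>' = n" "\<tau>' \<subseteq> \<sigma>'" using s' by (auto simp: C'_def)
    then have "pdim \<iota> \<sigma> = n" using dim[OF s(1)] pdim_mono[OF s(2), of \<iota>] by simp
    moreover have "\<tau> \<subseteq> \<sigma>" by (rule cell_face[OF eb s(1) t(1) _ t(2,3)]) (use z n s in auto)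
    moreover have "pullback \<iota> PPb b \<sigma>' = b \<sigma>" by (rule pullback_eq[OF eb s]) (simp add: n calculation)
    ultimately show ?thesis using s by auto
  qed
  have wall': "wall (\<iota> ` \<sigma>') (\<iota> ` \<tau>')" if "\<sigma>' \<in> C'" for \<sigma>'
    by (rule wall_cells[OF e _ t'(1) tne]) (use that t' in \<open>auto simp: C'_def\<close>)
  have uniq: "\<sigma>1 = \<sigma>2" if "\<sigma>1 \<in> C'" "\<sigma>2 \<in> C'" "\<sigma>1 \<subseteq> S" "\<sigma>2 \<subseteq> S" "S \<in> PPb" "nvec \<iota> \<sigma>1 \<tau>' = nvec \<iota> \<sigma>2 \<tau>'" for \<sigma>1 \<sigma>2 S
    by (rule coface_unique[OF e t'(1) tne _ _ _ _ _ _ epcD(4)[OF eb that(5)] that(3,4,6)])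
      (use that(1,2) t' in \<open>auto simp: C'_def\<close>)
  have "pdim \<iota> \<tau> \<ge> n - 1" "pdim \<iota> \<tau> \<le> n" using pdim_mono[OF tt, of \<iota>] dim[OF t(1)] t'(3) by auto
  then consider "pdim \<iota> \<tau> = n - 1" | "pdim \<iota> \<tau> = n" by linarith
  then show "(\<Sum>\<sigma>\<in>cofaces \<iota> PP U n \<tau>'. pullback \<iota> PPb b \<sigma> *\<^sub>R nvec \<iota> \<sigma> \<tau>') = 0"
  proof cases
    case 1
    have zU: "\<tau> \<inter> U \<noteq> {}" using z t by auto
    define C where "C = {\<sigma> \<in> PPb. \<tau> \<subseteq> \<sigma> \<and> pdim \<iota> \<sigma> = n}"
    have C: "cofaces \<iota> PPb U n \<tau> = C" unfolding C_def by (rule cofaces_eq[OF eb t(1) zU])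
    have dt: "dirs (\<iota> ` \<tau>') = dirs (\<iota> ` \<tau>)"
      by (rule dirs_eqI) (use tt tne 1 t'(3) in \<open>auto simp: pdim_def\<close>)
    have nv: "nvec \<iota> \<sigma>' \<tau>' = nvec \<iota> \<sigma> \<tau>" if s': "\<sigma>' \<in> C'" and s: "\<sigma> \<in> C" "\<sigma>' \<subseteq> \<sigma>" for \<sigma>' \<sigma>
    proof -
      have w: "wall (\<iota> ` \<sigma>) (\<iota> ` \<tau>)" by (rule wall_cells[OF eb _ t(1)]) (use s 1 t(2) in \<open>auto simp: C_def\<close>)
      have "dirs (\<iota> ` \<sigma>') = dirs (\<iota> ` \<sigma>)"
        by (rule dirs_eqI) (use s s' tne in \<open>auto simp: C_def C'_def pdim_def\<close>)
      moreover have "\<iota> ` \<sigma>' \<subseteq> \<iota> ` \<sigma>" "\<iota> ` \<tau>' \<subseteq> \<iota> ` \<tau>" using s tt by auto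
      ultimately show ?thesis
        unfolding nvec_eq_nv using nv_props[OF w] dt
        by (intro nv_eqI[OF wall'[OF s']]) (simp_all add: subset_iff)
    qed
    have ex: "\<exists>\<sigma>'. \<sigma>' \<in> C' \<and> \<sigma>' \<subseteq> \<sigma>" if s: "\<sigma> \<in> C" for \<sigma>
    proof -
      have s': "\<sigma> \<in> PPb" "z \<in> \<sigma>" using s t(2) by (auto simp: C_def)
      obtain \<sigma>' where r: "\<sigma>' \<in> PP" "z \<in> \<sigma>'" "\<sigma>' \<subseteq> \<sigma>" "pdim \<iota> \<sigma>' = pdim \<iota> \<sigma>"
        using refine_same_dim[OF eb e sub s'] .
      have "\<tau>' \<subseteq> \<sigma>'" by (rule cell_face[OF e r(1) t'(1) r(2) z(1,3)])
      then show ?thesis using r s by (auto simp: C_def C'_def)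
    qed
    \<comment> \<open>Each coface of \<open>\<tau>\<close> contains a coface of
      \<open>\<tau>'\<close>, by \<open>uniq\<close> only one; the choice matches the two balancing
      sums term by term.\<close>
    define h where "h \<sigma> = (SOME \<sigma>'. \<sigma>' \<in> C' \<and> \<sigma>' \<subseteq> \<sigma>)" for \<sigma>
    have h: "h \<sigma> \<in> C'" "h \<sigma> \<subseteq> \<sigma>" if "\<sigma> \<in> C" for \<sigma> using someI_ex[OF ex[OF that], folded h_def] by auto
    have dims: "pdim \<iota> \<sigma> = n" "pdim \<iota> \<sigma>' = n" if "\<sigma> \<in> C" "\<sigma>' \<in> C'" for \<sigma> \<sigma>' using that by (auto simp: C_def C'_def)
    have bij: "bij_betw h C C'"
      unfolding bij_betw_def
    proof
      show "inj_on h C"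
      proof (rule inj_onI)
        fix \<sigma> \<sigma>1 assume s: "\<sigma> \<in> C" "\<sigma>1 \<in> C" "h \<sigma> = h \<sigma>1"
        have "\<sigma> \<in> PPb" "\<sigma>1 \<in> PPb" using s by (auto simp: C_def)
        then show "\<sigma> = \<sigma>1"
          by (intro same_dim_container_unique[OF eb, of \<sigma>1 "h \<sigma>" \<sigma>]) (use s h dims[OF _ h(1)] in auto)
      qed
      show "h ` C = C'"
      proof
        show "h ` C \<subseteq> C'" using h by auto
        show "C' \<subseteq> h ` C"
        proof
          fix \<sigma>' assume s': "\<sigma>' \<in> C'"
          obtain \<sigma> where s: "\<sigma> \<in> PPb" "\<sigma>' \<subseteq> \<sigma>" "\<tau> \<subseteq> \<sigma>" "pdim \<iota> \<sigma> = n" using con[OF s'] by auto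
          then have sC: "\<sigma> \<in> C" by (auto simp: C_def)
          have "\<sigma>' = h \<sigma>"
            by (rule uniq[OF s' h(1)[OF sC] s(2) h(2)[OF sC] s(1)])
              (simp add: nv[OF s' sC s(2)] nv[OF h(1)[OF sC] sC h(2)[OF sC]])
          then show "\<sigma>' \<in> h ` C" using sC by auto
        qed
      qed
    qed
    have "(\<Sum>\<sigma>\<in>C'. pullback \<iota> PPb b \<sigma> *\<^sub>R nvec \<iota> \<sigma> \<tau>') = (\<Sum>\<sigma>\<in>C. pullback \<iota> PPb b (h \<sigma>) *\<^sub>R nvec \<iota> (h \<sigma>) \<tau>')"
      by (rule sum.reindex_bij_betw[OF bij, symmetric])
    also have "\<dots> = (\<Sum>\<sigma>\<in>C. b \<sigma> *\<^sub>R nvec \<iota> \<sigma> \<tau>)"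
    proof (rule sum.cong[OF refl])
      fix \<sigma> assume s: "\<sigma> \<in> C"
      then have "\<sigma> \<in> PPb" by (auto simp: C_def)
      then have "pullback \<iota> PPb b (h \<sigma>) = b \<sigma>"
        by (intro pullback_eq[OF eb]) (use h[OF s] dims[OF s h(1)[OF s]] in auto)
      then show "pullback \<iota> PPb b (h \<sigma>) *\<^sub>R nvec \<iota> (h \<sigma>) \<tau>' = b \<sigma> *\<^sub>R nvec \<iota> \<sigma> \<tau>"
        using nv[OF h(1)[OF s] s h(2)[OF s]] by simp
    qed
    also have "\<dots> = 0"
      using m t(1) zU 1 unfolding minkowski_def C[symmetric] by (auto simp: restr_dim_iff)
    finally show ?thesis unfolding C' .
  next
    case 2
    have inT: "\<sigma>' \<subseteq> \<tau>" "pullback \<iota> PPb b \<sigma>' = b \<tau>" if s': "\<sigma>' \<in> C'" for \<sigma>'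
    proof -
      obtain \<sigma> where s: "\<sigma> \<in> PPb" "\<sigma>' \<subseteq> \<sigma>" "\<tau> \<subseteq> \<sigma>" "pdim \<iota> \<sigma> = n" "pullback \<iota> PPb b \<sigma>' = b \<sigma>" using con[OF s'] by auto
      have "\<tau> = \<sigma>" by (rule cell_eqI[OF eb s(1) t(1) s(3)]) (simp add: 2 s)
      then show "\<sigma>' \<subseteq> \<tau>" "pullback \<iota> PPb b \<sigma>' = b \<tau>" using s by auto
    qed
    have dd: "dirs (\<iota> ` \<sigma>') = dirs (\<iota> ` \<tau>)" if s': "\<sigma>' \<in> C'" for \<sigma>'
      by (rule dirs_eqI) (use inT(1)[OF s'] s' tne 2 in \<open>auto simp: C'_def pdim_def\<close>)
    obtain \<sigma>1 where r: "\<sigma>1 \<in> PP" "z \<in> \<sigma>1" "\<sigma>1 \<subseteq> \<tau>" "pdim \<iota> \<sigma>1 = pdim \<iota> \<tau>"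
      using refine_same_dim[OF eb e sub t(1,2)] .
    have "\<tau>' \<subseteq> \<sigma>1" by (rule cell_face[OF e r(1) t'(1) r(2) z(1,3)])
    then have s1: "\<sigma>1 \<in> C'" using r 2 by (auto simp: C'_def)
    let ?v = "nvec \<iota> \<sigma>1 \<tau>'"
    note w1 = wall'[OF s1]
    have v: "?v \<in> dirs (\<iota> ` \<tau>)" "norm ?v = 1" using nv_props[OF w1] dd[OF s1] unfolding nvec_eq_nv by auto
    have pm: "nvec \<iota> \<sigma>' \<tau>' = ?v \<or> nvec \<iota> \<sigma>' \<tau>' = - ?v" if s': "\<sigma>' \<in> C'" for \<sigma>'
      unfolding nvec_eq_nv
      by (rule wall_normal_pm[OF w1]) (use nv_props[OF wall'[OF s']] dd[OF s'] dd[OF s1] in auto)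
    \<comment> \<open>As \<open>z\<close> is relatively interior to the top cell
      \<open>\<tau>\<close>, one can step from it against \<open>?v\<close>; the subdivided cell
      reached there is the second coface.\<close>
    have "\<exists>\<sigma>2\<in>C'. nvec \<iota> \<sigma>2 \<tau>' = - ?v"
    proof -
      obtain V where V: "openin T V" "z \<in> V" "\<And>\<sigma>. \<sigma> \<in> PP \<Longrightarrow> \<sigma> \<inter> V \<noteq> {} \<Longrightarrow> z \<in> \<sigma>"
        using star_nbhd[OF e zT] by metis
      obtain r where r: "r > 0" "\<And>t. \<bar>t\<bar> \<le> r \<Longrightarrow> \<iota> z + t *\<^sub>R ?v \<in> \<iota> ` \<tau>"
        using rel_interior_extend[OF t(3) v(1)] by auto
      have r': "\<iota> z + s *\<^sub>R (- ?v) \<in> \<iota> ` \<tau>" if "0 < s" "s \<le> r" for s using r(2)[of "-s"] that by simp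
      obtain s y where y: "s > 0" "s \<le> r" "y \<in> \<tau>" "y \<in> V" "\<iota> y = \<iota> z + s *\<^sub>R (- ?v)"
        by (rule cell_move[OF eb t(1) V(1) t(2) V(2) r(1) r'])
      obtain \<sigma>2 where s2: "\<sigma>2 \<in> PP" "y \<in> \<sigma>2" "\<sigma>2 \<subseteq> \<tau>" "pdim \<iota> \<sigma>2 = pdim \<iota> \<tau>"
        using refine_same_dim[OF eb e sub t(1) y(3)] .
      have "z \<in> \<sigma>2" using V(3)[OF s2(1)] s2(2) y(4) by auto
      then have "\<tau>' \<subseteq> \<sigma>2" by (rule cell_face[OF e s2(1) t'(1) _ z(1,3)])
      then have s2C: "\<sigma>2 \<in> C'" using s2 2 by (auto simp: C'_def)
      have "nvec \<iota> \<sigma>2 \<tau>' \<bullet> (\<iota> y - \<iota> z) \<ge> 0"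
        unfolding nvec_eq_nv by (rule nv_props(4)[OF wall'[OF s2C]]) (use s2 z in auto)
      then have "nvec \<iota> \<sigma>2 \<tau>' \<noteq> ?v" using y(1,5) v(2) by (auto simp: norm_eq_1 mult_le_0_iff)
      then show ?thesis using pm[OF s2C] s2C by auto
    qed
    then obtain \<sigma>2 where s2: "\<sigma>2 \<in> C'" "nvec \<iota> \<sigma>2 \<tau>' = - ?v" by auto
    have "?v \<noteq> - ?v"
    proof
      assume "?v = - ?v"
      then have "?v \<bullet> ?v = (- ?v) \<bullet> ?v" by (rule arg_cong)
      then show False using v(2) by (simp add: norm_eq_1)
    qed
    then have ne: "\<sigma>1 \<noteq> \<sigma>2" using s2 by auto
    have "C' = {\<sigma>1, \<sigma>2}"
    proof -
      have "\<sigma> = \<sigma>1 \<or> \<sigma> = \<sigma>2" if s: "\<sigma> \<in> C'" for \<sigma>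
        using pm[OF s] uniq[OF s s1 inT(1)[OF s] inT(1)[OF s1] t(1)] uniq[OF s s2(1) inT(1)[OF s] inT(1)[OF s2(1)] t(1)] s2(2) by auto
      then show ?thesis using s1 s2 by auto
    qed
    then show ?thesis unfolding C' using ne inT(2)[OF s1] inT(2)[OF s2(1)] s2(2) by simp
  qed
qed

lemma positive_pullback:
  assumes eb: "epc_complex T \<iota> PPb" and sub: "subdivides PP PPb"
    and dim: "\<And>\<sigma>. \<sigma> \<in> PPb \<Longrightarrow> pdim \<iota> \<sigma> \<le> n" and pos: "\<And>\<sigma>. \<sigma> \<in> restr_dim \<iota> PPb U n \<Longrightarrow> b \<sigma> > 0"
    and s: "\<sigma> \<in> restr_dim \<iota> PP U n"
  shows "pullback \<iota> PPb b \<sigma> > 0"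
proof -
  have s': "\<sigma> \<in> PP" "\<sigma> \<inter> U \<noteq> {}" "pdim \<iota> \<sigma> = n" using s by (auto simp: restr_dim_iff)
  obtain \<sigma>1 where s1: "\<sigma>1 \<in> PPb" "\<sigma> \<subseteq> \<sigma>1" using s' sub by (auto simp: subdivides_def)
  have n: "pdim \<iota> \<sigma>1 = n" using dim[OF s1(1)] pdim_mono[OF s1(2), of \<iota>] s'(3) by simp
  have "pullback \<iota> PPb b \<sigma> = b \<sigma>1" by (rule pullback_eq[OF eb s1]) (simp add: n s')
  moreover have "\<sigma>1 \<inter> U \<noteq> {}" using s' s1 by blast
  ultimately show ?thesis using pos[of \<sigma>1] s1 n by (simp add: restr_dim_iff)
qed

section \<open>Iterated products that are positive around a point\<close>

lemma coface_exists:
  assumes e: "epc_complex T \<iota> PP" and t: "\<tau> \<in> PP" "\<tau> \<noteq> {}" and s: "\<sigma> \<in> PP" "\<tau> \<subseteq> \<sigma>" "pdim \<iota> \<tau> < pdim \<iota> \<sigma>"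
  obtains \<sigma>' where "\<sigma>' \<in> PP" "\<tau> \<subseteq> \<sigma>'" "pdim \<iota> \<sigma>' = pdim \<iota> \<tau> + 1"
proof -
  have "\<iota> ` \<tau> face_of \<iota> ` \<sigma>" using is_face_iff_subset[OF e s(1) t(1)] s(2) by (simp add: is_face_def)
  moreover have "\<iota> ` \<tau> \<noteq> \<iota> ` \<sigma>" using s(3) by (auto simp: pdim_def)
  moreover have "\<iota> ` \<tau> \<noteq> {}" using t(2) by auto
  ultimately obtain F where F: "F face_of \<iota> ` \<sigma>" "\<iota> ` \<tau> \<subseteq> F" "aff_dim F = aff_dim (\<iota> ` \<tau>) + 1"
    using face_chain[OF epcD(5)[OF e s(1)], of "\<iota> ` \<tau>"] by metis
  obtain \<sigma>' where s': "\<sigma>' \<in> PP" "\<iota> ` \<sigma>' = F" "\<sigma>' \<subseteq> \<sigma>" using face_cell[OF e s(1) F(1)] .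
  have "\<tau> \<subseteq> \<sigma>'" using inj_on_image_subsetD[OF epcD(4)[OF e s(1)] s(2) s'(3)] F(2) s'(2) by simp
  then show ?thesis using that s' F(3) by (simp add: pdim_def)
qed

text \<open>Strictness passes down through cells containing \<open>x0\<close>: by purity such a cell
  has a coface, which also contains \<open>x0\<close> and has positive weight by induction, and
  \<open>bend\<close> gives a form that vanishes on the cell but not on the coface.\<close>

lemma strict_iterated_weight:
  assumes e: "epc_complex T \<iota> PP" and U: "openin T U" and L: "finite L"
    and g: "pa_on \<iota> PP U (minsum L \<circ> \<iota>)" and x0: "x0 \<in> U"
    and bend: "\<And>\<sigma> \<tau>. \<sigma> \<in> PP \<Longrightarrow> \<tau> \<in> PP \<Longrightarrow> x0 \<in> \<tau> \<Longrightarrow> \<tau> \<subseteq> \<sigma> \<Longrightarrow> \<tau> \<noteq> \<sigma> \<Longrightarrow>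
      \<exists>w\<in>L. (\<forall>x\<in>\<tau>. w \<bullet> \<iota> x = 0) \<and> (\<exists>x\<in>\<sigma>. w \<bullet> \<iota> x \<noteq> 0)"
    and pure: "\<And>\<tau>. \<tau> \<in> PP \<Longrightarrow> x0 \<in> \<tau> \<Longrightarrow> \<exists>\<sigma>\<in>PP. \<tau> \<subseteq> \<sigma> \<and> pdim \<iota> \<sigma> = int n"
    and m: "minkowski \<iota> PP U (int n) b" and p: "\<And>\<sigma>. \<sigma> \<in> restr_dim \<iota> PP U (int n) \<Longrightarrow> b \<sigma> > 0"
  defines "c \<equiv> \<lambda>j. pa_mult_list \<iota> PP U (replicate j (minsum L \<circ> \<iota>)) b"
  shows "minkowski \<iota> PP U (int n - int j) (c j) \<and> positive_weight \<iota> PP U (int n - int j) (c j) \<and>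
    (\<forall>\<sigma>\<in>PP. x0 \<in> \<sigma> \<longrightarrow> pdim \<iota> \<sigma> = int n - int j \<longrightarrow> c j \<sigma> > 0)"
proof (induction j)
  case 0
  have "positive_weight \<iota> PP U (int n) b" using p unfolding positive_weight_def by (auto intro: less_imp_le)
  moreover have "b \<sigma> > 0" if "\<sigma> \<in> PP" "x0 \<in> \<sigma>" "pdim \<iota> \<sigma> = int n" for \<sigma>
    using that x0 by (intro p) (auto simp: restr_dim_iff)
  ultimately show ?case using m by (simp add: c_def)
next
  case (Suc j)
  let ?k = "int n - int j"
  have k: "int n - int (Suc j) = ?k - 1" by simp
  have cS: "c (Suc j) = pa_mult \<iota> PP U (minsum L \<circ> \<iota>) (c j)" by (simp add: c_def)
  have IH: "minkowski \<iota> PP U ?k (c j)" "positive_weight \<iota> PP U ?k (c j)"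
    "\<And>\<sigma>. \<sigma> \<in> PP \<Longrightarrow> x0 \<in> \<sigma> \<Longrightarrow> pdim \<iota> \<sigma> = ?k \<Longrightarrow> c j \<sigma> > 0" using Suc.IH by auto
  show ?case
    unfolding k cS
  proof (intro conjI ballI impI)
    show "minkowski \<iota> PP U (?k - 1) (pa_mult \<iota> PP U (minsum L \<circ> \<iota>) (c j))"
      by (rule minkowski_pa_mult[OF e U g IH(1)])
    show "positive_weight \<iota> PP U (?k - 1) (pa_mult \<iota> PP U (minsum L \<circ> \<iota>) (c j))"
      by (rule positive_pa_mult_minsum[OF e U L g IH(1,2)])
    fix \<tau> assume t: "\<tau> \<in> PP" "x0 \<in> \<tau>" "pdim \<iota> \<tau> = ?k - 1"
    obtain \<sigma>n where sn: "\<sigma>n \<in> PP" "\<tau> \<subseteq> \<sigma>n" "pdim \<iota> \<sigma>n = int n" using pure[OF t(1,2)] by auto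
    have tne: "\<tau> \<noteq> {}" and lt: "pdim \<iota> \<tau> < pdim \<iota> \<sigma>n" using t sn(3) by auto
    obtain \<sigma> where s: "\<sigma> \<in> PP" "\<tau> \<subseteq> \<sigma>" "pdim \<iota> \<sigma> = pdim \<iota> \<tau> + 1"
      using coface_exists[OF e t(1) tne sn(1,2) lt] .
    note ts = s(2)
    have ds: "pdim \<iota> \<sigma> = ?k" using s(3) t(3) by simp
    have tU: "\<tau> \<inter> U \<noteq> {}" using t x0 by auto
    have sC: "\<sigma> \<in> cofaces \<iota> PP U ?k \<tau>" unfolding cofaces_eq[OF e t(1) tU] using s ts ds by auto
    have "\<tau> \<noteq> \<sigma>" using ds t(3) by auto
    then obtain w x where w: "w \<in> L" "\<And>x. x \<in> \<tau> \<Longrightarrow> w \<bullet> \<iota> x = 0" "x \<in> \<sigma>" "w \<bullet> \<iota> x \<noteq> 0"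
      using bend[OF s(1) t(1,2) ts] by blast
    show "0 < pa_mult \<iota> PP U (minsum L \<circ> \<iota>) (c j) \<tau>"
      by (rule strict_pa_mult_minsum[OF e U L g IH(1,2) _ w(1,2) sC IH(3) w(3,4)])
        (use t tU s ts ds in \<open>auto simp: restr_dim_iff\<close>)
  qed
qed

section \<open>Linear inequalities describing cells and their faces\<close>

lemma polyhedron_homogeneous:
  fixes P :: "'v::euclidean_space set"
  assumes P: "polyhedron P" "P \<subseteq> {y. a \<bullet> y = \<beta>}" and \<beta>: "\<beta> \<noteq> 0"
  obtains A where "finite A" "P = {y. a \<bullet> y = \<beta> \<and> (\<forall>w\<in>A. w \<bullet> y \<ge> 0)}"
proof -
  obtain H where H: "finite H" "P = \<Inter>H" "\<forall>h\<in>H. \<exists>u s. u \<noteq> 0 \<and> h = {y. u \<bullet> y \<le> s}"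
    using P(1) unfolding polyhedron_def by auto
  have "\<forall>h\<in>H. \<exists>q. h = {y. fst q \<bullet> y \<le> snd q}"
  proof
    fix h assume "h \<in> H"
    then obtain u s where "h = {y. u \<bullet> y \<le> s}" using H(3) by blast
    then show "\<exists>q. h = {y. fst q \<bullet> y \<le> snd q}" by (intro exI[of _ "(u, s)"]) simp
  qed
  from bchoice[OF this] obtain q where q: "\<forall>h\<in>H. h = {y. fst (q h) \<bullet> y \<le> snd (q h)}" by blast
  \<comment> \<open>On the hyperplane \<open>s = (s / \<beta>) (a \<bullet> y)\<close>, so
    \<open>u \<bullet> y \<le> s\<close> becomes a linear inequality.\<close>
  define A where "A = (\<lambda>h. (snd (q h) / \<beta>) *\<^sub>R a - fst (q h)) ` H"
  have "y \<in> P \<longleftrightarrow> a \<bullet> y = \<beta> \<and> (\<forall>w\<in>A. w \<bullet> y \<ge> 0)" for y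
  proof (cases "a \<bullet> y = \<beta>")
    case True
    have "y \<in> P \<longleftrightarrow> (\<forall>h\<in>H. fst (q h) \<bullet> y \<le> snd (q h))" unfolding H(2) using q by blast
    also have "\<dots> \<longleftrightarrow> (\<forall>w\<in>A. w \<bullet> y \<ge> 0)"
      unfolding A_def using True \<beta> by (simp add: inner_diff_left)
    finally show ?thesis using True by simp
  qed (use P(2) in auto)
  then show ?thesis using that[of A] H(1) by (auto simp: A_def)
qed

text \<open>Suppose every inequality tight on \<open>F\<close> is tight on all of \<open>S\<close>.
  The others are strict at a relative interior point \<open>z\<close> of \<open>F\<close>, so one
  can step from \<open>z\<close> away from any point of \<open>S\<close>, and then
  \<open>F = S\<close>.\<close>

lemma exposing_inequality:
  fixes S :: "'v::euclidean_space set"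
  assumes S: "S = {y. a \<bullet> y = \<beta> \<and> (\<forall>w\<in>B. w \<bullet> y \<ge> 0)}" and B: "finite B"
    and F: "F face_of S" "F \<noteq> {}" "F \<noteq> S"
  shows "\<exists>w\<in>B. (\<forall>y\<in>F. w \<bullet> y = 0) \<and> (\<exists>y\<in>S. w \<bullet> y \<noteq> 0)"
proof (rule ccontr)
  assume neg: "\<not> ?thesis"
  have FS: "F \<subseteq> S" using F face_of_imp_subset by auto
  obtain z where z: "z \<in> rel_interior F" using rel_interior_eq_empty[OF face_of_imp_convex[OF F(1)]] F(2) by auto
  have zF: "z \<in> F" using z rel_interior_subset by auto
  have van: "w \<bullet> p = 0" if w: "w \<in> B" "w \<bullet> z = 0" and p: "p \<in> S" for w p
  proof -
    have "w \<bullet> y = 0" if y: "y \<in> F" for y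
    proof -
      obtain e where e: "e > 0" "\<And>t. \<bar>t\<bar> \<le> e \<Longrightarrow> z + t *\<^sub>R (y - z) \<in> F"
        using rel_interior_extend[OF z diff_in_dirs[OF y zF]] by auto
      have "z + (-e) *\<^sub>R (y - z) \<in> S" using subsetD[OF FS e(2)[of "-e"]] e(1) by simp
      then have "w \<bullet> (z + (-e) *\<^sub>R (y - z)) \<ge> 0" using S w by auto
      then have "e * (w \<bullet> y) \<le> 0" using w by (simp add: inner_add_right inner_diff_right)
      moreover have "w \<bullet> y \<ge> 0" using y FS S w by auto
      ultimately show ?thesis using e(1) by (simp add: mult_le_0_iff)
    qed
    then show ?thesis using neg w p by blast
  qed
  have "F = S"
  proof (rule face_of_rel_interior_eq[OF F(1) zF])
    fix p assume p: "p \<in> S"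
    \<comment> \<open>Small enough for every inequality that is strict at \<open>z\<close>; the
      \<open>1\<close> covers the case that there is none.\<close>
    define t where "t = Min (insert 1 ((\<lambda>w. w \<bullet> z / (\<bar>w \<bullet> (p - z)\<bar> + 1)) ` {w\<in>B. w \<bullet> z > 0}))"
    have t0: "t > 0" unfolding t_def using B by (subst Min_gr_iff) (auto intro!: divide_pos_pos add_nonneg_pos)
    have "w \<bullet> (z - t *\<^sub>R (p - z)) \<ge> 0" if w: "w \<in> B" for w
    proof (cases "w \<bullet> z = 0")
      case True
      then show ?thesis using van[OF w True p] by (simp add: inner_diff_right)
    next
      case False
      then have pos: "w \<bullet> z > 0" using w zF FS S by force
      have "t \<le> w \<bullet> z / (\<bar>w \<bullet> (p - z)\<bar> + 1)" unfolding t_def using B w pos by (intro Min_le) auto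
      then have "t * (\<bar>w \<bullet> (p - z)\<bar> + 1) \<le> w \<bullet> z" by (simp add: pos_le_divide_eq add_nonneg_pos)
      moreover have "t * (w \<bullet> (p - z)) \<le> t * (\<bar>w \<bullet> (p - z)\<bar> + 1)" using t0 by (intro mult_left_mono) auto
      ultimately show ?thesis by (simp add: inner_diff_right)
    qed
    moreover have "a \<bullet> (z - t *\<^sub>R (p - z)) = \<beta>" using p zF FS S by (auto simp: inner_diff_right)
    ultimately show "\<exists>t>0. z - t *\<^sub>R (p - z) \<in> S" using t0 S by blast
  qed
  then show False using F by simp
qed

section \<open>Strictly positive weights near a point\<close>

lemma finite_uniform_radius:
  assumes "finite S" "\<And>s. s \<in> S \<Longrightarrow> \<exists>r>0::real. P s r"
    and mono: "\<And>s r r'. P s r \<Longrightarrow> r' \<le> r \<Longrightarrow> P s r'"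
  shows "\<exists>r>0. \<forall>s\<in>S. P s r"
  using assms(1,2)
proof (induction S rule: finite_induct)
  case empty
  show ?case by (intro exI[of _ 1]) simp
next
  case (insert s S)
  then obtain r r' where "r > 0" "\<forall>s\<in>S. P s r" "r' > 0" "P s r'" by (metis insertCI)
  then show ?case using mono by (intro exI[of _ "min r r'"]) (auto intro: min.cobounded1 min.cobounded2)
qed

text \<open>Cuts by the coordinate hyperplanes through \<open>x0\<close> turn it into a vertex, and
  parallel cuts at distance \<delta> on both sides bound the cells at \<open>x0\<close>.\<close>

lemma small_star_cuts:
  fixes \<iota> :: "'a \<Rightarrow> 'v::euclidean_space"
  assumes e: "epc_complex T \<iota> PP" and H: "\<beta> \<noteq> 0" "\<And>x. x \<in> topspace T \<Longrightarrow> a \<bullet> \<iota> x = \<beta>"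
    and U: "openin T U" and x0: "x0 \<in> U"
  obtains ws where "{x0} \<in> hcuts \<iota> ws PP"
    "\<forall>\<sigma>\<in>hcuts \<iota> ws PP. x0 \<in> \<sigma> \<longrightarrow> \<sigma> \<subseteq> U \<and> bounded (\<iota> ` \<sigma>)"
proof -
  have xT: "x0 \<in> topspace T" using openin_subset[OF U] x0 by auto
  have "\<exists>r>0. \<forall>\<sigma>\<in>{\<sigma>\<in>PP. x0 \<in> \<sigma>}. \<forall>x\<in>\<sigma>. dist (\<iota> x) (\<iota> x0) < r \<longrightarrow> x \<in> U"
  proof (rule finite_uniform_radius[OF finite_star[OF e]])
    fix \<sigma> assume s: "\<sigma> \<in> {\<sigma>\<in>PP. x0 \<in> \<sigma>}"
    then have s1: "\<sigma> \<in> PP" "x0 \<in> \<sigma>" by auto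
    obtain Q where Q: "open Q" "\<And>x. x \<in> \<sigma> \<Longrightarrow> x \<in> U \<longleftrightarrow> \<iota> x \<in> Q"
      using open_in_cell[OF e s1(1) U] by metis
    then have "\<iota> x0 \<in> Q" using x0 s1 by auto
    then obtain r where r: "r > 0" "ball (\<iota> x0) r \<subseteq> Q" using Q(1) open_contains_ball by blast
    have "\<forall>x\<in>\<sigma>. dist (\<iota> x) (\<iota> x0) < r \<longrightarrow> x \<in> U" using r(2) Q(2) by (auto simp: dist_commute subset_iff)
    then show "\<exists>r>0. \<forall>x\<in>\<sigma>. dist (\<iota> x) (\<iota> x0) < r \<longrightarrow> x \<in> U" using r(1) by auto
  qed auto
  then obtain r where r: "r > 0" "\<And>\<sigma> x. \<sigma> \<in> PP \<Longrightarrow> x0 \<in> \<sigma> \<Longrightarrow> x \<in> \<sigma> \<Longrightarrow> dist (\<iota> x) (\<iota> x0) < r \<Longrightarrow> x \<in> U" by auto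
  \<comment> \<open>The \<open>+ 1\<close> makes the estimate by the sum of the coordinates strict:
    \<open>DIM('v) * \<delta> < r\<close>.\<close>
  define \<delta> where "\<delta> = r / (real DIM('v) + 1)"
  have \<delta>: "\<delta> > 0" using r(1) by (simp add: \<delta>_def)
  \<comment> \<open>On the hyperplane \<open>a \<bullet> y = \<beta>\<close> affine functions are linear, so cuts through the origin suffice.\<close>
  define W where "W e s = e - ((e \<bullet> \<iota> x0 + s) / \<beta>) *\<^sub>R a" for e s
  have W: "W e s \<bullet> \<iota> x = e \<bullet> \<iota> x - e \<bullet> \<iota> x0 - s" if "x \<in> topspace T" for e s x
    using H(1) H(2)[OF that] by (simp add: W_def inner_diff_left)
  have "finite ((\<lambda>(e, s). W e s) ` ((Basis :: 'v set) \<times> {0, \<delta>, -\<delta>}))" by simp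
  then obtain ws where ws: "set ws = (\<lambda>(e, s). W e s) ` ((Basis :: 'v set) \<times> {0, \<delta>, -\<delta>})"
    using finite_list by metis
  have Wws: "W e s \<in> set ws" if "e \<in> Basis" "s \<in> {0, \<delta>, -\<delta>}" for e s using that unfolding ws by force
  let ?Q = "hcuts \<iota> ws PP"
  have un: "\<Union>?Q = topspace T" "epc_complex T \<iota> ?Q"
  proof -
    show "epc_complex T \<iota> ?Q" by (induction ws) (auto intro: epc_hcut e)
    then show "\<Union>?Q = topspace T" by (rule epcD(2))
  qed
  obtain \<tau> where t: "\<tau> \<in> ?Q" "x0 \<in> \<tau>" "\<iota> x0 \<in> rel_interior (\<iota> ` \<tau>)" using cell_min_point[OF un(2) xT] .
  have "\<iota> x = \<iota> x0" if x: "x \<in> \<tau>" for x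
  proof (rule euclidean_eqI)
    fix e :: 'v assume eB: "e \<in> Basis"
    have xs: "y \<in> topspace T" if "y \<in> \<tau>" for y using epcD(10)[OF un(2) t(1)] that by auto
    obtain s where s: "s > 0" "\<And>u. \<bar>u\<bar> \<le> s \<Longrightarrow> \<iota> x0 + u *\<^sub>R (\<iota> x - \<iota> x0) \<in> \<iota> ` \<tau>"
      using rel_interior_extend[OF t(3) diff_in_dirs[of "\<iota> x" "\<iota> ` \<tau>" "\<iota> x0"]] x t(2) by auto
    \<comment> \<open>A point on the other side of \<open>x0\<close> from \<open>x\<close>: no
      coordinate difference changes sign on \<open>\<tau>\<close>, so that of \<open>x\<close> must
      vanish.\<close>
    obtain y where y: "y \<in> \<tau>" "\<iota> y = \<iota> x0 + (-s) *\<^sub>R (\<iota> x - \<iota> x0)" using s(1) s(2)[of "-s"] by auto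
    have "e \<bullet> \<iota> y - e \<bullet> \<iota> x0 = - s * (e \<bullet> \<iota> x - e \<bullet> \<iota> x0)"
      unfolding y(2) by (simp add: inner_add_right inner_diff_right algebra_simps)
    moreover have "(\<forall>x\<in>\<tau>. W e 0 \<bullet> \<iota> x \<ge> 0) \<or> (\<forall>x\<in>\<tau>. W e 0 \<bullet> \<iota> x \<le> 0)"
      by (rule hcuts_sign[OF Wws[OF eB] t(1)]) simp
    then have "(e \<bullet> \<iota> x - e \<bullet> \<iota> x0 \<ge> 0 \<and> e \<bullet> \<iota> y - e \<bullet> \<iota> x0 \<ge> 0) \<or> (e \<bullet> \<iota> x - e \<bullet> \<iota> x0 \<le> 0 \<and> e \<bullet> \<iota> y - e \<bullet> \<iota> x0 \<le> 0)"
      unfolding W[OF xs[OF x], of e 0, simplified, symmetric] W[OF xs[OF y(1)], of e 0, simplified, symmetric]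
      using x y(1) by blast
    ultimately have "e \<bullet> \<iota> x - e \<bullet> \<iota> x0 = 0" using s(1) by (auto simp: mult_le_0_iff zero_le_mult_iff)
    then show "\<iota> x \<bullet> e = \<iota> x0 \<bullet> e" by (simp add: inner_commute)
  qed
  then have "x = x0" if "x \<in> \<tau>" for x using inj_onD[OF epcD(4)[OF un(2) t(1)] _ that t(2)] that by simp
  then have "\<tau> = {x0}" using t(2) by blast
  then have v: "{x0} \<in> ?Q" using t(1) by simp
  have small: "dist (\<iota> x) (\<iota> x0) < r" if s: "\<sigma> \<in> ?Q" "x0 \<in> \<sigma>" "x \<in> \<sigma>" for \<sigma> x
  proof -
    have xs: "y \<in> topspace T" if "y \<in> \<sigma>" for y using epcD(10)[OF un(2) s(1)] that by auto
    have "\<bar>(\<iota> x - \<iota> x0) \<bullet> e\<bar> \<le> \<delta>" if eB: "e \<in> Basis" for e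
    proof -
      have "(\<forall>x\<in>\<sigma>. W e \<delta> \<bullet> \<iota> x \<ge> 0) \<or> (\<forall>x\<in>\<sigma>. W e \<delta> \<bullet> \<iota> x \<le> 0)"
        by (rule hcuts_sign[OF Wws[OF eB] s(1)]) simp
      then have 1: "e \<bullet> \<iota> x - e \<bullet> \<iota> x0 \<le> \<delta>" using W[OF xs[OF s(3)], of e \<delta>] W[OF xT, of e \<delta>] s(2,3) \<delta> by force
      have "(\<forall>x\<in>\<sigma>. W e (-\<delta>) \<bullet> \<iota> x \<ge> 0) \<or> (\<forall>x\<in>\<sigma>. W e (-\<delta>) \<bullet> \<iota> x \<le> 0)"
        by (rule hcuts_sign[OF Wws[OF eB] s(1)]) simp
      then have 2: "e \<bullet> \<iota> x - e \<bullet> \<iota> x0 \<ge> -\<delta>" using W[OF xs[OF s(3)], of e "-\<delta>"] W[OF xT, of e "-\<delta>"] s(2,3) \<delta> by force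
      have "(\<iota> x - \<iota> x0) \<bullet> e = e \<bullet> \<iota> x - e \<bullet> \<iota> x0" by (simp only: inner_diff_left inner_commute[of e])
      then show ?thesis using 1 2 by linarith
    qed
    then have "(\<Sum>e\<in>Basis. \<bar>(\<iota> x - \<iota> x0) \<bullet> e\<bar>) \<le> (\<Sum>e\<in>(Basis::'v set). \<delta>)" by (rule sum_mono)
    also have "\<dots> = real DIM('v) * \<delta>" by simp
    also have "\<dots> < (real DIM('v) + 1) * \<delta>" using \<delta> by simp
    also have "\<dots> = r" by (simp add: \<delta>_def)
    finally show ?thesis using norm_le_l1[of "\<iota> x - \<iota> x0"] by (simp add: dist_norm)
  qed
  show ?thesis
  proof (rule that[OF v], intro ballI impI)
    fix \<sigma> assume s: "\<sigma> \<in> ?Q" "x0 \<in> \<sigma>"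
    obtain \<sigma>0 where s0: "\<sigma>0 \<in> PP" "\<sigma> \<subseteq> \<sigma>0" using subdivides_hcuts[of \<iota> ws PP] s(1) by (auto simp: subdivides_def)
    have "\<sigma> \<subseteq> U" using r(2)[OF s0(1)] s0(2) small[OF s] s(2) by blast
    moreover have "bounded (\<iota> ` \<sigma>)"
      unfolding bounded_def using small[OF s] by (intro exI[of _ "\<iota> x0"] exI[of _ r]) (force simp: dist_commute)
    ultimately show "\<sigma> \<subseteq> U \<and> bounded (\<iota> ` \<sigma>)" ..
  qed
qed

section \<open>A weakly concave function on a balanced open set\<close>

locale weakly_concave_setting =
  fixes T :: "'a topology" and \<iota> :: "'a \<Rightarrow> 'v::euclidean_space"
    and PP0 PPb :: "'a set set" and n :: nat and U :: "'a set"
    and b :: "'a set \<Rightarrow> real" and f :: "'a \<Rightarrow> real" and a :: 'v and \<beta> :: real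
  assumes hyp: "\<beta> \<noteq> 0" "\<And>x. x \<in> topspace T \<Longrightarrow> a \<bullet> \<iota> x = \<beta>"
    and e0: "epc_complex T \<iota> PP0" and pure0: "pure_dimension \<iota> PP0 n" and openU: "openin T U"
    and bal: "balancing T \<iota> PP0 n U PPb b" and wconc: "weakly_concave T \<iota> PP0 n U PPb b f"
begin

lemma clsb: "in_class T \<iota> PP0 PPb" and mb: "minkowski \<iota> PPb U (int n) b"
  and posb: "\<And>\<sigma>. \<sigma> \<in> restr_dim \<iota> PPb U (int n) \<Longrightarrow> b \<sigma> > 0"
  using bal by (auto simp: balancing_def)

lemmas eb = in_classD(1)[OF clsb]

lemma dim_le: "in_class T \<iota> PP0 PP \<Longrightarrow> \<sigma> \<in> PP \<Longrightarrow> pdim \<iota> \<sigma> \<le> int n"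
  using pure_in_class(1)[OF e0 pure0] .

abbreviation "top_weight \<equiv> pullback \<iota> PPb b"

lemma top_weight:
  assumes c: "in_class T \<iota> PP0 PP" and sub: "subdivides PP PPb"
  shows "minkowski \<iota> PP U (int n) top_weight"
    "\<And>\<sigma>. \<sigma> \<in> restr_dim \<iota> PP U (int n) \<Longrightarrow> top_weight \<sigma> > 0"
  using minkowski_pullback[OF eb in_classD(1)[OF c] sub dim_le[OF clsb] openU mb]
    positive_pullback[OF eb sub dim_le[OF clsb] posb] by auto

text \<open>A sum with one summand; the factor \<alpha> becomes its coefficient.\<close>

lemma beta_positive_single:
  assumes c: "in_class T \<iota> PP0 PP" and sub: "subdivides PP PPb" and "\<alpha> > 0"
    and g: "\<And>g. g \<in> set gs \<Longrightarrow> concave_pa T \<iota> PP0 U g \<and> pa_on \<iota> PP U g"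
    and k: "int (length gs) = int n - k"
  shows "beta_positive T \<iota> PP0 n U PPb b k PP (\<lambda>\<sigma>. \<alpha> * pa_mult_list \<iota> PP U gs top_weight \<sigma>)"
  unfolding beta_positive_def
proof (intro conjI)
  show "\<exists>PP' (J::nat set) \<alpha>' G. in_class T \<iota> PP0 PP' \<and> subdivides PP' PPb \<and> finite J \<and> J \<noteq> {} \<and> (\<forall>j\<in>J. 0 < \<alpha>' j) \<and>
     (\<forall>j\<in>J. length (G j) = nat (int n - k) \<and> (\<forall>g\<in>set (G j). concave_pa T \<iota> PP0 U g \<and> pa_on \<iota> PP' U g)) \<and>
     same_cycle T \<iota> PP0 U k PP (\<lambda>\<sigma>. \<alpha> * pa_mult_list \<iota> PP U gs top_weight \<sigma>) PP'
          (\<lambda>\<sigma>. \<Sum>j\<in>J. \<alpha>' j * pa_mult_list \<iota> PP' U (G j) top_weight \<sigma>)"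
    using assms same_cycle_refl[OF c]
    by (intro exI[of _ PP] exI[of _ "{0}"] exI[of _ "\<lambda>_. \<alpha>"] exI[of _ "\<lambda>_. gs"]) (auto simp: k[symmetric])
qed (use k in auto)

lemma minkowski_scale:
  assumes "minkowski \<iota> PP W k c" shows "minkowski \<iota> PP W k (\<lambda>\<sigma>. \<alpha> * c \<sigma>)"
  using assms by (simp add: minkowski_def scaleR_scaleR[symmetric] scaleR_sum_right[symmetric] del: scaleR_scaleR)

text \<open>Since \<open>\<beta>\<close>-positivity is stable under positive multiples, the coefficients
  \<open>\<nu>\<^sub>i = c(\<sigma>\<^sub>i) / d(x\<^sub>i, \<tau>)\<close> need not be normalized.\<close>

lemma balanced_inequality:
  assumes c: "in_class T \<iota> PP0 PP" and t: "\<tau> \<in> PP" "y \<in> \<tau>" "y \<in> U"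
    and m: "minkowski \<iota> PP U (pdim \<iota> \<tau> + 1) c"
    and bp: "\<And>\<alpha>. \<alpha> > 0 \<Longrightarrow> beta_positive T \<iota> PP0 n U PPb b (pdim \<iota> \<tau> + 1) PP (\<lambda>\<sigma>. \<alpha> * c \<sigma>)"
    and C: "C = {\<sigma> \<in> PP. \<tau> \<subseteq> \<sigma> \<and> pdim \<iota> \<sigma> = pdim \<iota> \<tau> + 1}" "C \<noteq> {}"
    and xs: "\<And>\<sigma>. \<sigma> \<in> C \<Longrightarrow> \<sigma> \<subseteq> U \<and> xs \<sigma> \<in> \<sigma> \<and> c \<sigma> > 0"
    and d: "\<And>\<sigma>. \<sigma> \<in> C \<Longrightarrow> d \<sigma> = nvec \<iota> \<sigma> \<tau> \<bullet> (\<iota> (xs \<sigma>) - \<iota> y) \<and> d \<sigma> > 0"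
    and eq: "(\<Sum>\<sigma>\<in>C. (c \<sigma> / d \<sigma>) *\<^sub>R \<iota> (xs \<sigma>)) = (\<Sum>\<sigma>\<in>C. c \<sigma> / d \<sigma>) *\<^sub>R \<iota> y"
  shows "(\<Sum>\<sigma>\<in>C. (c \<sigma> / d \<sigma>) * f (xs \<sigma>)) \<le> (\<Sum>\<sigma>\<in>C. c \<sigma> / d \<sigma>) * f y"
proof -
  note e = in_classD(1)[OF c]
  have tne: "\<tau> \<noteq> {}" using t by auto
  have fin: "finite C" unfolding C(1) by (rule finite_cofaces[OF e tne])
  define S where "S = (\<Sum>\<sigma>\<in>C. c \<sigma> / d \<sigma>)"
  have S: "S > 0" unfolding S_def by (rule sum_pos[OF fin C(2)]) (simp add: xs divide_pos_pos conjunct2[OF d])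
  obtain h where h: "bij_betw h {..<card C} C" using ex_bij_betw_nat_finite[OF fin] by (auto simp: atLeast0LessThan)
  have hC: "h i \<in> C" if "i < card C" for i using h that by (auto simp: bij_betw_def)
  define \<nu> where "\<nu> i = c (h i) / d (h i) / S" for i
  have sumh: "(\<Sum>i<card C. F (h i)) = (\<Sum>\<sigma>\<in>C. F \<sigma>)" for F :: "'a set \<Rightarrow> 'z::comm_monoid_add"
    using sum.reindex_bij_betw[OF h] .
  have Cf: "{\<sigma>\<in>PP. pdim \<iota> \<sigma> = pdim \<iota> \<tau> + 1 \<and> is_face \<iota> \<tau> \<sigma>} = C"
    unfolding C(1) using is_face_iff_subset[OF e _ t(1)] by blast
  have "balanced_cc T \<iota> PP0 n U PPb b y {..<card C} (xs \<circ> h) \<nu>"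
    unfolding balanced_cc_def
  proof (intro conjI exI)
    show "\<forall>i\<in>{..<card C}. (xs \<circ> h) i \<in> U \<and> 0 \<le> \<nu> i"
    proof (intro ballI conjI)
      fix i assume "i \<in> {..<card C}"
      then have i: "h i \<in> C" using hC by auto
      show "(xs \<circ> h) i \<in> U" using xs[OF i] by auto
      show "0 \<le> \<nu> i" using xs[OF i] d[OF i] S by (simp add: \<nu>_def)
    qed
    have "(\<Sum>i<card C. \<nu> i) = (\<Sum>\<sigma>\<in>C. c \<sigma> / d \<sigma> / S)" unfolding \<nu>_def by (rule sumh)
    also have "\<dots> = 1" using S unfolding sum_divide_distrib[symmetric] S_def[symmetric] by simp
    finally show "(\<Sum>i<card C. \<nu> i) = 1" .
    have "(\<Sum>i<card C. \<nu> i *\<^sub>R \<iota> ((xs \<circ> h) i)) = (\<Sum>\<sigma>\<in>C. (c \<sigma> / d \<sigma> / S) *\<^sub>R \<iota> (xs \<sigma>))"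
      unfolding \<nu>_def comp_def by (rule sumh)
    also have "\<dots> = (1 / S) *\<^sub>R (\<Sum>\<sigma>\<in>C. (c \<sigma> / d \<sigma>) *\<^sub>R \<iota> (xs \<sigma>))" by (simp add: scaleR_sum_right mult.commute)
    also have "\<dots> = \<iota> y" using S unfolding eq S_def[symmetric] by simp
    finally show "(\<Sum>i<card C. \<nu> i *\<^sub>R \<iota> ((xs \<circ> h) i)) = \<iota> y" .
    show "\<forall>i\<in>{..<card C}. h i \<in> PP \<and> is_face \<iota> \<tau> (h i) \<and> h i \<subseteq> U \<and> (xs \<circ> h) i \<in> h i"
      using hC xs Cf by auto
    show "bij_betw h {..<card C} {\<sigma> \<in> PP. pdim \<iota> \<sigma> = pdim \<iota> \<tau> + 1 \<and> is_face \<iota> \<tau> \<sigma>}" unfolding Cf by (rule h)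
    show "minkowski \<iota> PP U (pdim \<iota> \<tau> + 1) (\<lambda>\<sigma>. (1 / S) * c \<sigma>)" by (rule minkowski_scale[OF m])
    show "beta_positive T \<iota> PP0 n U PPb b (pdim \<iota> \<tau> + 1) PP (\<lambda>\<sigma>. (1 / S) * c \<sigma>)" using S by (intro bp) simp
    show "\<forall>i\<in>{..<card C}. \<nu> i * infdist (\<iota> ((xs \<circ> h) i)) (affine hull \<iota> ` \<tau>) = (1 / S) * c (h i)"
    proof
      fix i assume "i \<in> {..<card C}"
      then have i: "h i \<in> C" using hC by auto
      have w: "wall (\<iota> ` h i) (\<iota> ` \<tau>)" by (rule wall_cells[OF e _ t(1) tne]) (use i in \<open>auto simp: C(1)\<close>)
      have "infdist (\<iota> (xs (h i))) (affine hull \<iota> ` \<tau>) = d (h i)"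
        using infdist_wall[OF w, of "\<iota> (xs (h i))" "\<iota> y"] xs[OF i] d[OF i] t(2) by (simp add: nvec_eq_nv)
      then show "\<nu> i * infdist (\<iota> ((xs \<circ> h) i)) (affine hull \<iota> ` \<tau>) = (1 / S) * c (h i)"
        using d[OF i] by (simp add: \<nu>_def)
    qed
  qed (use t c in auto)
  then have "(\<Sum>i<card C. \<nu> i * f ((xs \<circ> h) i)) \<le> f y" using wconc unfolding weakly_concave_def by blast
  also have "(\<Sum>i<card C. \<nu> i * f ((xs \<circ> h) i)) = (\<Sum>\<sigma>\<in>C. (c \<sigma> / d \<sigma> / S) * f (xs \<sigma>))"
    unfolding \<nu>_def comp_def by (rule sumh)
  also have "\<dots> = (\<Sum>\<sigma>\<in>C. (c \<sigma> / d \<sigma>) * f (xs \<sigma>)) / S" by (simp add: sum_divide_distrib)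
  finally show ?thesis using S unfolding S_def[symmetric] by (simp add: divide_le_eq mult.commute)
qed

text \<open>The weight \<open>c j\<close> has dimension \<open>n - j\<close>.\<close>

definition good_complex :: "'a \<Rightarrow> 'a set set \<Rightarrow> (nat \<Rightarrow> 'a set \<Rightarrow> real) \<Rightarrow> bool" where
  "good_complex x0 PP c \<longleftrightarrow> in_class T \<iota> PP0 PP \<and> subdivides PP PPb \<and> {x0} \<in> PP \<and>
     (\<forall>\<sigma>\<in>PP. x0 \<in> \<sigma> \<longrightarrow> \<sigma> \<subseteq> U \<and> polytope (\<iota> ` \<sigma>)) \<and>
     (\<forall>j\<le>n. minkowski \<iota> PP U (int n - int j) (c j) \<and>
        (\<forall>\<alpha>>0. beta_positive T \<iota> PP0 n U PPb b (int n - int j) PP (\<lambda>\<sigma>. \<alpha> * c j \<sigma>)) \<and>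
        (\<forall>\<sigma>\<in>PP. x0 \<in> \<sigma> \<longrightarrow> pdim \<iota> \<sigma> = int n - int j \<longrightarrow> c j \<sigma> > 0))"

text \<open>The first round of cuts shrinks the star of \<open>x0\<close>; the forms collected
  afterwards define its cells. Cutting along these forms makes their \<open>minsum\<close> piecewise
  affine, and a vertex survives any subdivision.\<close>

lemma good_complex_exists:
  assumes x0: "x0 \<in> U" shows "\<exists>PP c. good_complex x0 PP c"
proof -
  obtain ws where ws: "{x0} \<in> hcuts \<iota> ws PPb"
    "\<forall>\<sigma>\<in>hcuts \<iota> ws PPb. x0 \<in> \<sigma> \<longrightarrow> \<sigma> \<subseteq> U \<and> bounded (\<iota> ` \<sigma>)"
    by (rule small_star_cuts[OF eb hyp openU x0])
  define PP1 where "PP1 = hcuts \<iota> ws PPb"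
  have c1: "in_class T \<iota> PP0 PP1" unfolding PP1_def by (rule in_class_hcuts[OF clsb])
  note e1 = in_classD(1)[OF c1]
  define S1 where "S1 = {\<sigma> \<in> PP1. x0 \<in> \<sigma>}"
  have fin1: "finite S1" unfolding S1_def by (rule finite_star[OF e1])
  have "\<exists>A. finite A \<and> \<iota> ` \<sigma> = {y. a \<bullet> y = \<beta> \<and> (\<forall>w\<in>A. w \<bullet> y \<ge> 0)}" if s: "\<sigma> \<in> S1" for \<sigma>
  proof -
    have s1: "\<sigma> \<in> PP1" using s by (simp add: S1_def)
    have sub: "\<iota> ` \<sigma> \<subseteq> {y. a \<bullet> y = \<beta>}" using hyp(2) epcD(10)[OF e1 s1] by auto
    obtain A where "finite A" "\<iota> ` \<sigma> = {y. a \<bullet> y = \<beta> \<and> (\<forall>w\<in>A. w \<bullet> y \<ge> 0)}"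
      by (rule polyhedron_homogeneous[OF epcD(5)[OF e1 s1] sub hyp(1)])
    then show ?thesis by blast
  qed
  then have "\<forall>\<sigma>\<in>S1. \<exists>A. finite A \<and> \<iota> ` \<sigma> = {y. a \<bullet> y = \<beta> \<and> (\<forall>w\<in>A. w \<bullet> y \<ge> 0)}" by blast
  from bchoice[OF this] obtain A where A: "\<forall>\<sigma>\<in>S1. finite (A \<sigma>) \<and> \<iota> ` \<sigma> = {y. a \<bullet> y = \<beta> \<and> (\<forall>w\<in>A \<sigma>. w \<bullet> y \<ge> 0)}" by blast
  define L where "L = \<Union>(A ` S1)"
  have finL: "finite L" unfolding L_def using fin1 A by auto
  obtain vs where vs: "set vs = L" using finite_list[OF finL] by auto
  define PP where "PP = hcuts \<iota> vs PP1"
  have c: "in_class T \<iota> PP0 PP" unfolding PP_def by (rule in_class_hcuts[OF c1])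
  note e = in_classD(1)[OF c]
  have sub1: "subdivides PP PP1" unfolding PP_def by (rule subdivides_hcuts)
  have sub: "subdivides PP PPb"
    by (rule subdivides_trans[OF sub1]) (simp add: PP1_def subdivides_hcuts)
  have xT: "x0 \<in> topspace T" using openin_subset[OF openU] x0 by auto
  have vertex: "{x0} \<in> PP"
  proof -
    obtain \<tau> where t: "\<tau> \<in> PP" "x0 \<in> \<tau>" "\<iota> x0 \<in> rel_interior (\<iota> ` \<tau>)" using cell_min_point[OF e xT] .
    have "\<tau> \<subseteq> {x0}" by (rule subdivides_carrier[OF e1 e sub1 t(1) _ t(2) _ t(3)]) (use ws(1) in \<open>auto simp: PP1_def\<close>)
    then have "\<tau> = {x0}" using t(2) by auto
    then show ?thesis using t(1) by simp
  qed
  have star: "\<sigma> \<subseteq> U \<and> polytope (\<iota> ` \<sigma>)" if s: "\<sigma> \<in> PP" "x0 \<in> \<sigma>" for \<sigma>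
  proof -
    obtain \<sigma>1 where s1: "\<sigma>1 \<in> PP1" "\<sigma> \<subseteq> \<sigma>1" using sub1 s(1) by (auto simp: subdivides_def)
    then have "\<sigma>1 \<subseteq> U" "bounded (\<iota> ` \<sigma>1)" using ws(2) s(2) by (auto simp: PP1_def)
    moreover have "bounded (\<iota> ` \<sigma>)" by (rule bounded_subset[OF calculation(2)]) (use s1 in auto)
    ultimately show ?thesis using s1(2) epcD(5)[OF e s(1)] by (auto simp: polytope_eq_bounded_polyhedron)
  qed
  let ?g = "minsum L \<circ> \<iota>"
  have pa: "pa_on \<iota> PP U ?g"
    by (rule pa_on_minsum) (use hcuts_sign[of _ vs _ \<iota> PP1] vs in \<open>auto simp: PP_def\<close>)
  have conc: "concave_pa T \<iota> PP0 U ?g" by (rule concave_minsum[OF finL c pa])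
  \<comment> \<open>The cells around \<open>x0\<close> are cut out by the very forms along which the concave function bends.\<close>
  have bend: "\<exists>w\<in>L. (\<forall>x\<in>\<tau>. w \<bullet> \<iota> x = 0) \<and> (\<exists>x\<in>\<sigma>. w \<bullet> \<iota> x \<noteq> 0)"
    if s: "\<sigma> \<in> PP" "\<tau> \<in> PP" "x0 \<in> \<tau>" "\<tau> \<subseteq> \<sigma>" "\<tau> \<noteq> \<sigma>" for \<sigma> \<tau>
  proof -
    obtain \<sigma>1 B where s1: "\<sigma>1 \<in> PP1" "B \<subseteq> L \<union> uminus ` L" "\<sigma> = {x \<in> \<sigma>1. \<forall>w\<in>B. w \<bullet> \<iota> x \<ge> 0}"
      using hcuts_structure[of \<sigma> \<iota> vs PP1] s(1) vs unfolding PP_def by auto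
    have s1S: "\<sigma>1 \<in> S1" using s1 s(3,4) by (auto simp: S1_def)
    have "\<iota> ` \<sigma> = {y \<in> \<iota> ` \<sigma>1. \<forall>w\<in>B. w \<bullet> y \<ge> 0}" unfolding s1(3) by auto
    then have img: "\<iota> ` \<sigma> = {y. a \<bullet> y = \<beta> \<and> (\<forall>w\<in>A \<sigma>1 \<union> B. w \<bullet> y \<ge> 0)}" using A s1S by auto
    have finB: "finite (A \<sigma>1 \<union> B)" using A s1S s1(2) finL by (auto intro: finite_subset)
    have fc: "\<iota> ` \<tau> face_of \<iota> ` \<sigma>" using is_face_iff_subset[OF e s(1,2)] s(4) by (simp add: is_face_def)
    have ne: "\<iota> ` \<tau> \<noteq> {}" using s(3) by auto
    have neq: "\<iota> ` \<tau> \<noteq> \<iota> ` \<sigma>"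
    proof
      assume "\<iota> ` \<tau> = \<iota> ` \<sigma>"
      then have "pdim \<iota> \<tau> = pdim \<iota> \<sigma>" by (simp add: pdim_def)
      then show False using cell_eqI[OF e s(1,2,4)] s(5) by simp
    qed
    obtain w where w: "w \<in> A \<sigma>1 \<union> B" "\<forall>y\<in>\<iota> ` \<tau>. w \<bullet> y = 0" "\<exists>y\<in>\<iota> ` \<sigma>. w \<bullet> y \<noteq> 0"
      using exposing_inequality[OF img finB fc ne neq] by blast
    then have "w \<in> L \<or> - w \<in> L" using s1(2) s1S by (auto simp: L_def)
    then show ?thesis
    proof
      assume "w \<in> L" then show ?thesis using w by auto
    next
      assume "- w \<in> L" then show ?thesis using w by (intro bexI[of _ "-w"]) auto
    qed
  qed
  have pure: "\<exists>\<sigma>\<in>PP. \<tau> \<subseteq> \<sigma> \<and> pdim \<iota> \<sigma> = int n" if "\<tau> \<in> PP" "x0 \<in> \<tau>" for \<tau>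
    using pure_in_class(2)[OF e0 pure0 c that(1)] that(2) by auto
  define cw where "cw j = pa_mult_list \<iota> PP U (replicate j ?g) top_weight" for j
  note it = strict_iterated_weight[OF e openU finL pa x0 bend pure top_weight[OF c sub], folded cw_def]
  have bp: "beta_positive T \<iota> PP0 n U PPb b (int n - int j) PP (\<lambda>\<sigma>. \<alpha> * cw j \<sigma>)" if "\<alpha> > 0" for j \<alpha>
    unfolding cw_def by (rule beta_positive_single[OF c sub that]) (use conc pa in auto)
  have "good_complex x0 PP cw"
    unfolding good_complex_def
  proof (intro conjI ballI allI impI)
    fix j
    show "minkowski \<iota> PP U (int n - int j) (cw j)" using it[of j] by simp
    show "beta_positive T \<iota> PP0 n U PPb b (int n - int j) PP (\<lambda>\<sigma>. \<alpha> * cw j \<sigma>)" if "0 < \<alpha>" for \<alpha>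
      by (rule bp[OF that])
    show "cw j \<sigma> > 0" if "\<sigma> \<in> PP" "x0 \<in> \<sigma>" "pdim \<iota> \<sigma> = int n - int j" for \<sigma>
      using it[of j] that by blast
  qed (use c sub vertex star in blast)+
  then show ?thesis by blast
qed

end

section \<open>Continuity\<close>

text \<open>The half contains a nonempty relatively open part of \<open>S\<close>. For the section,
  \<open>u = p - z\<close> spans a complement: a direction of \<open>S\<close> killed by
  \<open>w\<close> can be followed from the relative interior point \<open>z\<close> without leaving
  the hyperplane.\<close>

lemma hyperplane_section_dim:
  assumes S: "convex S" and z: "z \<in> rel_interior S" "w \<bullet> z = 0" and p: "p \<in> S" "w \<bullet> p > 0"
  shows "aff_dim (S \<inter> half w {0..}) = aff_dim S" "aff_dim (S \<inter> half w {0}) = aff_dim S - 1"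
proof -
  have zS: "z \<in> S" using z rel_interior_subset by auto
  have "open {y. w \<bullet> y > 0}" by (rule open_halfspace_gt)
  then have "aff_dim (S \<inter> {y. w \<bullet> y > 0}) = aff_dim S" by (rule aff_dim_convex_Int_open[OF S]) (use p in auto)
  moreover have "aff_dim (S \<inter> {y. w \<bullet> y > 0}) \<le> aff_dim (S \<inter> half w {0..})"
    by (rule aff_dim_subset) (auto simp: half_def)
  moreover have "aff_dim (S \<inter> half w {0..}) \<le> aff_dim S" by (rule aff_dim_subset) auto
  ultimately show pos: "aff_dim (S \<inter> half w {0..}) = aff_dim S" by simp
  let ?H = "S \<inter> half w {0}"
  have zH: "z \<in> ?H" using zS z(2) by (simp add: half_def)
  have "half w ({0..} \<inter> {0}) face_of half w {0..}" by (rule half_face) (auto simp: signs_def)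
  then have "(S \<inter> half w ({0..} \<inter> {0})) face_of (S \<inter> half w {0..})"
    by (rule face_of_Int_Int[OF face_of_refl[OF S]])
  then have "?H face_of (S \<inter> half w {0..})" by simp
  moreover have "p \<in> S \<inter> half w {0..}" "p \<notin> ?H" using p by (auto simp: half_def)
  then have "?H \<noteq> S \<inter> half w {0..}" by blast
  moreover have "convex (S \<inter> half w {0..})"
    by (intro convex_Int S polyhedron_imp_convex polyhedron_half) (simp add: signs_def)
  ultimately have lt: "aff_dim ?H < aff_dim S" using face_of_aff_dim_lt[of "S \<inter> half w {0..}" ?H] pos by simp
  define u where "u = p - z"
  have u: "u \<in> dirs S" "w \<bullet> u > 0" using diff_in_dirs[OF p(1) zS] p(2) z(2) by (auto simp: u_def inner_diff_right)
  have "dirs S \<subseteq> span (insert u (dirs ?H))"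
  proof
    fix d assume d: "d \<in> dirs S"
    define d' where "d' = d - (w \<bullet> d / (w \<bullet> u)) *\<^sub>R u"
    have d': "d' \<in> dirs S" unfolding d'_def using d u by (intro subspace_diff subspace_scale) auto
    have w0: "w \<bullet> d' = 0" using u by (simp add: d'_def inner_diff_right)
    obtain e where e: "e > 0" "\<And>t. \<bar>t\<bar> \<le> e \<Longrightarrow> z + t *\<^sub>R d' \<in> S" using rel_interior_extend[OF z(1) d'] by auto
    have "z + e *\<^sub>R d' \<in> ?H" using e w0 z(2) by (simp add: half_def inner_add_right)
    from diff_in_dirs[OF this zH] have "e *\<^sub>R d' \<in> dirs ?H" by simp
    then have "(1/e) *\<^sub>R (e *\<^sub>R d') \<in> dirs ?H" by (rule subspace_scale[OF subspace_dirs])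
    then have "d' \<in> dirs ?H" using e(1) by simp
    then have "d' \<in> span (insert u (dirs ?H))" by (intro span_base) auto
    moreover have "u \<in> span (insert u (dirs ?H))" by (intro span_base) auto
    ultimately have "d' + (w \<bullet> d / (w \<bullet> u)) *\<^sub>R u \<in> span (insert u (dirs ?H))" by (intro span_add span_scale)
    then show "d \<in> span (insert u (dirs ?H))" by (simp add: d'_def)
  qed
  then have "dim (dirs S) \<le> dim (insert u (dirs ?H))" by (rule dim_subset[of _ "span _", unfolded dim_span])
  also have "\<dots> \<le> dim (dirs ?H) + 1" by (simp add: dim_insert)
  finally show "aff_dim ?H = aff_dim S - 1"
    using lt aff_dim_dirs[of S] aff_dim_dirs[of ?H] zS zH by fastforce
qed

section \<open>Concavity in the interior of a top-dimensional cell\<close>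

context weakly_concave_setting
begin

text \<open>Cut \<open>\<sigma>\<close> through \<open>y\<close> orthogonally to the segment. As
  \<open>y\<close> is interior, the section has exactly the two halves as cofaces, with equal
  weights and opposite normals. The distances of \<open>p\<close> and \<open>q\<close> from it are
  as \<open>t\<close> to \<open>1 - t\<close>, so the coefficients are as \<open>1 - t\<close> to
  \<open>t\<close>.\<close>

lemma concave_on_top_cell:
  assumes c: "in_class T \<iota> PP0 PP" and sub: "subdivides PP PPb"
    and s: "\<sigma> \<in> PP" "pdim \<iota> \<sigma> = int n" "\<sigma> \<subseteq> U"
    and p: "p \<in> \<sigma>" "q \<in> \<sigma>" "y \<in> \<sigma>" "\<iota> y \<in> rel_interior (\<iota> ` \<sigma>)"
    and t: "0 < t" "t < 1" and eq: "\<iota> y = (1 - t) *\<^sub>R \<iota> p + t *\<^sub>R \<iota> q"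
  shows "(1 - t) * f p + t * f q \<le> f y"
proof (cases "\<iota> p = \<iota> q")
  case True
  then have "p = q" using inj_onD[OF epcD(4)[OF in_classD(1)[OF c] s(1)]] p by auto
  moreover have "\<iota> y = \<iota> p" using eq True by (simp add: algebra_simps)
  then have "y = p" using inj_onD[OF epcD(4)[OF in_classD(1)[OF c] s(1)]] p by auto
  ultimately show ?thesis by (simp add: algebra_simps)
next
  case False
  note e = in_classD(1)[OF c]
  have top: "x \<in> topspace T" if "x \<in> \<sigma>" for x using epcD(10)[OF e s(1)] that by auto
  define u where "u = \<iota> p - \<iota> q"
  have uu: "u \<bullet> u > 0" using False by (simp add: u_def)
  \<comment> \<open>The multiple of \<open>a\<close> lets the form vanish at \<open>y\<close>, so
    that the cut passes through the origin.\<close>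
  define w where "w = u - ((u \<bullet> \<iota> y) / \<beta>) *\<^sub>R a"
  have w: "w \<bullet> \<iota> x = u \<bullet> (\<iota> x - \<iota> y)" if "x \<in> \<sigma>" for x
    using hyp(1) hyp(2)[OF top[OF that]] by (simp add: w_def inner_diff_left inner_diff_right)
  have py: "\<iota> p - \<iota> y = t *\<^sub>R u" "\<iota> q - \<iota> y = (- (1 - t)) *\<^sub>R u"
    unfolding eq u_def by (simp_all add: algebra_simps)
  have wy: "w \<bullet> \<iota> y = 0" using w[OF p(3)] by simp
  have wp: "w \<bullet> \<iota> p > 0" unfolding w[OF p(1)] py using uu t by simp
  have "- w \<bullet> \<iota> q = (1 - t) * (u \<bullet> u)" unfolding inner_minus_left w[OF p(2)] py by (simp add: algebra_simps)
  then have wq: "- w \<bullet> \<iota> q > 0" using uu t by simp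
  have cv: "convex (\<iota> ` \<sigma>)" by (rule epcD(6)[OF e s(1)])
  define QQ where "QQ = hcut \<iota> w PP"
  have cQ: "in_class T \<iota> PP0 QQ" unfolding QQ_def by (rule in_class_hcut[OF c])
  note eQ = in_classD(1)[OF cQ]
  have subQ: "subdivides QQ PPb" unfolding QQ_def by (rule subdivides_trans[OF subdivides_hcut sub])
  define sp sm \<tau> where "sp = \<sigma> \<inter> \<iota> -` half w {0..}" and "sm = \<sigma> \<inter> \<iota> -` half w {..0}" and "\<tau> = \<sigma> \<inter> \<iota> -` half w {0}"
  have inQ: "sp \<in> QQ" "sm \<in> QQ" "\<tau> \<in> QQ"
    unfolding QQ_def sp_def sm_def \<tau>_def by (intro hcut_memI[OF s(1)]; simp add: signs_def)+
  have ne: "half (-w) {0..} = half w {..0}" "half (-w) {0} = half w {0}" by (auto simp: half_def)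
  note hd = hyperplane_section_dim[OF cv p(4) wy imageI[OF p(1)] wp]
  have wy': "- w \<bullet> \<iota> y = 0" using wy by simp
  note hd' = hyperplane_section_dim[OF cv p(4) wy' imageI[OF p(2)] wq]
  have dims: "pdim \<iota> sp = int n" "pdim \<iota> sm = int n" "pdim \<iota> \<tau> = int n - 1"
    using hd hd'(1) s(2) unfolding pdim_def sp_def sm_def \<tau>_def image_hcut_cell ne by auto
  have yt: "y \<in> \<tau>" using p(3) wy by (simp add: \<tau>_def half_def)
  have mem: "p \<in> sp" "q \<in> sm" "p \<notin> \<tau>" "q \<notin> \<tau>" "p \<notin> sm" using p wp wq by (auto simp: sp_def sm_def \<tau>_def half_def)
  have subs: "\<tau> \<subseteq> sp" "\<tau> \<subseteq> sm" "sp \<subseteq> \<sigma>" "sm \<subseteq> \<sigma>" by (auto simp: \<tau>_def sp_def sm_def half_def)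
  have neq: "sp \<noteq> sm" using mem by auto
  have C: "{sp, sm} = {\<sigma>' \<in> QQ. \<tau> \<subseteq> \<sigma>' \<and> pdim \<iota> \<sigma>' = pdim \<iota> \<tau> + 1}"
  proof
    show "{sp, sm} \<subseteq> {\<sigma>' \<in> QQ. \<tau> \<subseteq> \<sigma>' \<and> pdim \<iota> \<sigma>' = pdim \<iota> \<tau> + 1}" using inQ subs dims by auto
    show "{\<sigma>' \<in> QQ. \<tau> \<subseteq> \<sigma>' \<and> pdim \<iota> \<sigma>' = pdim \<iota> \<tau> + 1} \<subseteq> {sp, sm}"
    proof
      fix \<sigma>' assume "\<sigma>' \<in> {\<sigma>' \<in> QQ. \<tau> \<subseteq> \<sigma>' \<and> pdim \<iota> \<sigma>' = pdim \<iota> \<tau> + 1}"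
      then have s': "\<sigma>' \<in> QQ" "\<tau> \<subseteq> \<sigma>'" "pdim \<iota> \<sigma>' = int n" using dims by auto
      obtain \<sigma>0 A where s0: "\<sigma>0 \<in> PP" "A \<in> signs" "\<sigma>' = \<sigma>0 \<inter> \<iota> -` half w A"
        using s'(1) unfolding QQ_def by (rule hcut_memE)
      \<comment> \<open>Any cell through the interior point \<open>y\<close> contains
        \<open>\<sigma>\<close>, so no other top cell takes part in the cut at
        \<open>\<tau>\<close>.\<close>
      have "\<sigma> \<subseteq> \<sigma>0" by (rule cell_face[OF e s0(1) s(1) _ p(3,4)]) (use yt s'(2) s0(3) in auto)
      moreover have "pdim \<iota> \<sigma> = pdim \<iota> \<sigma>0" using pdim_mono[OF calculation, of \<iota>] dim_le[OF c s0(1)] s(2) by simp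
      ultimately have "\<sigma> = \<sigma>0" using cell_eqI[OF e s0(1) s(1)] by simp
      then show "\<sigma>' \<in> {sp, sm}"
        using s0(2,3) s'(3) dims(3) by (auto elim!: signs_cases simp: sp_def sm_def \<tau>_def)
    qed
  qed
  have yU: "y \<in> U" using s(3) p(3) by auto
  have tU: "\<tau> \<inter> U \<noteq> {}" using yt yU by auto
  let ?c = "top_weight"
  note tw = top_weight[OF cQ subQ]
  have spos: "?c sp > 0" "?c sm > 0" using tw(2) inQ dims yt yU subs by (auto simp: restr_dim_iff)
  have k: "pdim \<iota> \<tau> + 1 = int n" using dims by simp
  have bp: "beta_positive T \<iota> PP0 n U PPb b (pdim \<iota> \<tau> + 1) QQ (\<lambda>\<sigma>. \<alpha> * ?c \<sigma>)" if "\<alpha> > 0" for \<alpha>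
    using beta_positive_single[OF cQ subQ that, of "[]" "int n"] unfolding k by simp
  have tne: "\<tau> \<noteq> {}" using yt by auto
  have wall: "wall (\<iota> ` sp) (\<iota> ` \<tau>)" "wall (\<iota> ` sm) (\<iota> ` \<tau>)"
    using wall_cells[OF eQ inQ(1,3) tne subs(1)] wall_cells[OF eQ inQ(2,3) tne subs(2)] dims by auto
  let ?vp = "nvec \<iota> sp \<tau>" and ?vm = "nvec \<iota> sm \<tau>"
  have cof: "cofaces \<iota> QQ U (int n) \<tau> = {sp, sm}" unfolding cofaces_eq[OF eQ inQ(3) tU] C k ..
  have "\<tau> \<in> restr_dim \<iota> QQ U (int n - 1)" using inQ tU dims by (simp add: restr_dim_iff)
  then have "(\<Sum>\<sigma>'\<in>{sp, sm}. ?c \<sigma>' *\<^sub>R nvec \<iota> \<sigma>' \<tau>) = 0"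
    unfolding cof[symmetric] by (rule tw(1)[unfolded minkowski_def, rule_format])
  then have bal': "?c sp *\<^sub>R ?vp + ?c sm *\<^sub>R ?vm = 0" using neq by simp
  then have vm: "?c sm *\<^sub>R ?vm = - (?c sp *\<^sub>R ?vp)" by (simp add: eq_neg_iff_add_eq_0 add.commute)
  have n1: "norm ?vp = 1" "norm ?vm = 1" using nv_props(2)[OF wall(1)] nv_props(2)[OF wall(2)] by (simp_all add: nvec_eq_nv)
  \<comment> \<open>Both normals are unit vectors, so taking norms in the balancing relation equates
    the weights.\<close>
  have ceq: "?c sm = ?c sp"
    using arg_cong[OF vm, of norm] n1 spos by simp
  have "?c sp *\<^sub>R ?vm = ?c sp *\<^sub>R (- ?vp)" using vm unfolding ceq by simp
  then have vm': "?vm = - ?vp" using spos(1) by (simp only: scaleR_cancel_left) auto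
  define dp dq where "dp = ?vp \<bullet> (\<iota> p - \<iota> y)" and "dq = ?vm \<bullet> (\<iota> q - \<iota> y)"
  have img: "\<iota> p \<in> \<iota> ` sp" "\<iota> q \<in> \<iota> ` sm" "\<iota> y \<in> \<iota> ` \<tau>" using mem yt by auto
  have inj: "inj_on \<iota> \<sigma>" by (rule epcD(4)[OF e s(1)])
  have "\<iota> p \<notin> \<iota> ` \<tau>" "\<iota> q \<notin> \<iota> ` \<tau>" using mem p inj subs by (auto simp: inj_on_image_mem_iff[OF inj])
  then have dpos: "dp > 0" "dq > 0"
    unfolding dp_def dq_def nvec_eq_nv using nv_pos[OF wall(1) img(1) _ img(3)] nv_pos[OF wall(2) img(2) _ img(3)] by auto
  \<comment> \<open>Common value of \<open>(1 - t) * dp\<close> and \<open>t * dq\<close>. The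
    coefficients become \<open>(1 - t) * K\<close> and \<open>t * K\<close>, and \<open>K\<close>
    cancels.\<close>
  define m where "m = (1 - t) * dp"
  have dd: "m = t * dq" unfolding m_def dp_def dq_def vm' py by (simp add: algebra_simps)
  have m0: "m > 0" using dpos t by (simp add: m_def)
  have inv1: "1 / dp = (1 - t) / m" using dpos t by (simp add: m_def)
  have inv2: "1 / dq = t / m" using dpos t by (simp add: dd)
  note inv = inv1 inv2
  define K where "K = ?c sp / m"
  have cd: "?c sp / dp = (1 - t) * K" "?c sm / dq = t * K"
    using arg_cong[OF inv(1), of "\<lambda>r. ?c sp * r"] arg_cong[OF inv(2), of "\<lambda>r. ?c sp * r"] unfolding ceq K_def
    by (simp_all add: mult.commute)
  have "(\<Sum>\<sigma>'\<in>{sp, sm}. (?c \<sigma>' / (if \<sigma>' = sp then dp else dq)) * f (if \<sigma>' = sp then p else q))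
      \<le> (\<Sum>\<sigma>'\<in>{sp, sm}. ?c \<sigma>' / (if \<sigma>' = sp then dp else dq)) * f y"
  proof (rule balanced_inequality[OF cQ inQ(3) yt yU _ bp C])
    show "minkowski \<iota> QQ U (pdim \<iota> \<tau> + 1) ?c" unfolding k by (rule tw(1))
    have "(\<Sum>\<sigma>'\<in>{sp, sm}. (?c \<sigma>' / (if \<sigma>' = sp then dp else dq)) *\<^sub>R \<iota> (if \<sigma>' = sp then p else q))
        = ((1 - t) * K) *\<^sub>R \<iota> p + (t * K) *\<^sub>R \<iota> q" using neq by (simp add: cd)
    also have "\<dots> = K *\<^sub>R \<iota> y" unfolding eq by (simp add: scaleR_add_right mult.commute)
    also have "K = (1 - t) * K + t * K" by (simp only: distrib_right[symmetric]) simp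
    also have "\<dots> = (\<Sum>\<sigma>'\<in>{sp, sm}. ?c \<sigma>' / (if \<sigma>' = sp then dp else dq))" using neq by (simp add: cd)
    finally show "(\<Sum>\<sigma>'\<in>{sp, sm}. (?c \<sigma>' / (if \<sigma>' = sp then dp else dq)) *\<^sub>R \<iota> (if \<sigma>' = sp then p else q))
        = (\<Sum>\<sigma>'\<in>{sp, sm}. ?c \<sigma>' / (if \<sigma>' = sp then dp else dq)) *\<^sub>R \<iota> y" .
    fix \<sigma>' assume "\<sigma>' \<in> {sp, sm}"
    then show "\<sigma>' \<subseteq> U \<and> (if \<sigma>' = sp then p else q) \<in> \<sigma>' \<and> 0 < ?c \<sigma>'"
      "(if \<sigma>' = sp then dp else dq) = nvec \<iota> \<sigma>' \<tau> \<bullet> (\<iota> (if \<sigma>' = sp then p else q) - \<iota> y) \<and> 0 < (if \<sigma>' = sp then dp else dq)"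
      using mem spos subs s(3) dpos neq by (auto simp: dp_def dq_def)
  qed simp_all
  then have "((1 - t) * K) * f p + (t * K) * f q \<le> ((1 - t) * K + t * K) * f y"
    using neq by (simp add: cd del: times_divide_eq_left times_divide_eq_right)
  then have "K * ((1 - t) * f p + t * f q) \<le> K * f y" by (simp add: algebra_simps)
  moreover have "K > 0" using m0 spos by (simp add: K_def)
  ultimately show ?thesis by (simp only: mult_le_cancel_left_pos)
qed

lemma jensen_on_top_cell:
  assumes c: "in_class T \<iota> PP0 PP" and sub: "subdivides PP PPb"
    and s: "\<sigma> \<in> PP" "pdim \<iota> \<sigma> = int n" "\<sigma> \<subseteq> U"
    and y: "y \<in> \<sigma>" "\<iota> y \<in> rel_interior (\<iota> ` \<sigma>)"
    and V: "finite V" "V \<subseteq> \<sigma>" "\<And>p. p \<in> V \<Longrightarrow> \<nu> p \<ge> 0" "sum \<nu> V = 1" "(\<Sum>p\<in>V. \<nu> p *\<^sub>R \<iota> p) = \<iota> y"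
  shows "(\<Sum>p\<in>V. \<nu> p * f p) \<le> f y"
proof -
  note e = in_classD(1)[OF c]
  have inj: "inj_on \<iota> \<sigma>" by (rule epcD(4)[OF e s(1)])
  have cv: "convex (\<iota> ` \<sigma>)" by (rule epcD(6)[OF e s(1)])
  let ?S = "rel_interior (\<iota> ` \<sigma>)"
  define g where "g = the_inv_into \<sigma> \<iota>"
  have g: "g (\<iota> x) = x" if "x \<in> \<sigma>" for x using that inj by (simp add: g_def the_inv_into_f_f)
  have Sin: "\<exists>x\<in>\<sigma>. z = \<iota> x" if "z \<in> ?S" for z using that rel_interior_subset by blast
  have conv: "convex_on ?S (\<lambda>z. - f (g z))"
  proof (rule convex_onI)
    show "convex ?S" by (rule convex_rel_interior[OF cv])
    fix t x z assume t: "0 < t" "t < (1::real)" and x: "x \<in> ?S" "z \<in> ?S"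
    have m: "(1 - t) *\<^sub>R x + t *\<^sub>R z \<in> ?S"
      using convexD[OF convex_rel_interior[OF cv] x, of "1 - t" t] t by simp
    obtain x' z' m' where o: "x' \<in> \<sigma>" "x = \<iota> x'" "z' \<in> \<sigma>" "z = \<iota> z'" "m' \<in> \<sigma>" "(1 - t) *\<^sub>R x + t *\<^sub>R z = \<iota> m'"
      using Sin[OF x(1)] Sin[OF x(2)] Sin[OF m] by blast
    have "(1 - t) * f x' + t * f z' \<le> f m'"
      by (rule concave_on_top_cell[OF c sub s o(1,3,5) _ t]) (use m o in auto)
    then show "- f (g ((1 - t) *\<^sub>R x + t *\<^sub>R z)) \<le> (1 - t) * (- f (g x)) + t * (- f (g z))"
      unfolding o(6) by (simp add: o g)
  qed
  \<comment> \<open>Concavity is only known at interior points, so the points of \<open>V\<close> are moved halfway towards \<open>y\<close>.\<close>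
  define h where "h p = (1/2) *\<^sub>R \<iota> p + (1/2) *\<^sub>R \<iota> y" for p
  have hS: "h p \<in> ?S" if "p \<in> V" for p
  proof -
    have "\<iota> p - (1/2) *\<^sub>R (\<iota> p - \<iota> y) \<in> ?S" using rel_interior_convex_shrink[OF cv y(2), of "\<iota> p" "1/2"] that V(2) by auto
    moreover have "\<iota> p - (1/2) *\<^sub>R (\<iota> p - \<iota> y) = h p"
      by (simp add: h_def scaleR_diff_right) (simp add: algebra_simps flip: scaleR_add_left)
    ultimately show ?thesis by simp
  qed
  have half: "(1/2) * f p + (1/2) * f y \<le> f (g (h p))" if p: "p \<in> V" for p
  proof -
    obtain m where m: "m \<in> \<sigma>" "h p = \<iota> m" using Sin[OF hS[OF p]] by auto
    have "(1 - 1/2) * f p + (1/2) * f y \<le> f m"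
      by (rule concave_on_top_cell[OF c sub s _ y(1) m(1)]) (use p V(2) m hS[OF p] in \<open>auto simp: h_def\<close>)
    then show ?thesis using m g by simp
  qed
  have Vne: "V \<noteq> {}" using V(4) by auto
  have "(\<Sum>p\<in>V. \<nu> p *\<^sub>R h p) = (1/2) *\<^sub>R (\<Sum>p\<in>V. \<nu> p *\<^sub>R \<iota> p) + (1/2) *\<^sub>R (sum \<nu> V *\<^sub>R \<iota> y)"
    unfolding h_def scaleR_add_right sum.distrib scaleR_sum_left scaleR_sum_right by (simp add: mult.commute)
  also have "\<dots> = \<iota> y" unfolding V(4,5) by (simp flip: scaleR_add_left)
  finally have hy: "(\<Sum>p\<in>V. \<nu> p *\<^sub>R h p) = \<iota> y" .
  have "- f (g (\<Sum>p\<in>V. \<nu> p *\<^sub>R h p)) \<le> (\<Sum>p\<in>V. \<nu> p * (- f (g (h p))))"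
    by (rule convex_on_sum[OF V(1) Vne conv V(4)]) (use V(3) hS in auto)
  then have "(\<Sum>p\<in>V. \<nu> p * f (g (h p))) \<le> f y" unfolding hy g[OF y(1)] by (simp add: sum_negf)
  \<comment> \<open>Averaging with \<open>y\<close> has brought in half of \<open>f y\<close>, which
    is now subtracted from both sides.\<close>
  moreover have "(\<Sum>p\<in>V. \<nu> p * ((1/2) * f p + (1/2) * f y)) \<le> (\<Sum>p\<in>V. \<nu> p * f (g (h p)))"
    by (intro sum_mono mult_left_mono half V(3))
  moreover have "(\<Sum>p\<in>V. \<nu> p * ((1/2) * f p + (1/2) * f y)) = (1/2) * (\<Sum>p\<in>V. \<nu> p * f p) + (1/2) * (sum \<nu> V * f y)"
    by (simp add: distrib_left sum.distrib sum_distrib_left sum_distrib_right mult_ac)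
  ultimately show ?thesis unfolding V(4) by simp
qed

end

section \<open>Two estimates for polytopes\<close>

lemma vertex_weight_bound:
  fixes V :: "'v::euclidean_space set"
  assumes V: "finite V" and x: "{x} face_of (convex hull V)" "x \<in> V"
  obtains K where "K \<ge> 0" "\<And>\<nu>. (\<And>p. p \<in> V \<Longrightarrow> \<nu> p \<ge> 0) \<Longrightarrow> sum \<nu> V = 1 \<Longrightarrow>
    1 - \<nu> x \<le> K * dist (\<Sum>p\<in>V. \<nu> p *\<^sub>R p) x"
proof -
  have "{x} exposed_face_of (convex hull V)"
    using exposed_face_of_polyhedron[OF polyhedron_convex_hull[OF V]] x(1) by simp
  then obtain a b where ab: "convex hull V \<subseteq> {y. a \<bullet> y \<le> b}" "{x} = convex hull V \<inter> {y. a \<bullet> y = b}"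
    by (auto simp: exposed_face_of_def)
  have ax: "a \<bullet> x = b" using ab(2) by auto
  have lt: "a \<bullet> p < b" if "p \<in> V" "p \<noteq> x" for p
  proof -
    have "p \<in> convex hull V" using that(1) by (rule hull_inc)
    then have "a \<bullet> p \<le> b" "a \<bullet> p \<noteq> b" using ab that(2) by auto
    then show ?thesis by simp
  qed
  \<comment> \<open>Gap of the exposing functional between \<open>x\<close> and the other points: a
    combination loses at least \<kappa> per unit of weight off \<open>x\<close>, and Cauchy-Schwarz
    bounds the loss by the distance. The \<open>1\<close> covers \<open>V = {x}\<close>.\<close>
  define \<kappa> where "\<kappa> = Min (insert 1 ((\<lambda>p. b - a \<bullet> p) ` (V - {x})))"
  have \<kappa>: "\<kappa> > 0" unfolding \<kappa>_def using V lt by (subst Min_gr_iff) auto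
  have \<kappa>le: "\<kappa> \<le> b - a \<bullet> p" if "p \<in> V - {x}" for p unfolding \<kappa>_def using V that by (intro Min_le) auto
  show ?thesis
  proof (rule that[of "norm a / \<kappa>"])
    show "0 \<le> norm a / \<kappa>" using \<kappa> by simp
    fix \<nu> :: "'v \<Rightarrow> real" assume \<nu>: "\<And>p. p \<in> V \<Longrightarrow> \<nu> p \<ge> 0" "sum \<nu> V = 1"
    let ?y = "\<Sum>p\<in>V. \<nu> p *\<^sub>R p"
    have "\<kappa> * (1 - \<nu> x) = (\<Sum>p\<in>V-{x}. \<nu> p * \<kappa>)"
      unfolding sum_distrib_right[symmetric] using \<nu>(2) sum.remove[OF V x(2), of \<nu>] by simp
    also have "\<dots> \<le> (\<Sum>p\<in>V-{x}. \<nu> p * (b - a \<bullet> p))" using \<nu>(1) \<kappa>le by (intro sum_mono mult_left_mono) auto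
    also have "\<dots> = (\<Sum>p\<in>V. \<nu> p * (b - a \<bullet> p))" using ax by (simp add: sum.remove[OF V x(2)])
    also have "\<dots> = b * sum \<nu> V - a \<bullet> ?y"
      by (simp add: inner_sum_right right_diff_distrib sum_subtractf sum_distrib_left mult.commute)
    also have "\<dots> = a \<bullet> (x - ?y)" using \<nu>(2) ax by (simp add: inner_diff_right)
    also have "\<dots> \<le> norm a * norm (x - ?y)" by (rule norm_cauchy_schwarz)
    also have "norm (x - ?y) = dist ?y x" by (simp add: dist_norm norm_minus_commute)
    finally show "1 - \<nu> x \<le> norm a / \<kappa> * dist ?y x" using \<kappa> by (simp add: field_simps)
  qed
qed

text \<open>A point just beyond the facet, close to \<open>z\<close>, sees all of the polytope through the facet: the point
  in question is where the segment from \<open>y\<close> to \<open>z - h v\<close> meets the affine hull of \<open>F\<close>.\<close>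

lemma facet_visibility:
  fixes V :: "'v::euclidean_space set"
  assumes w: "wall S F" and V: "finite V" "S = convex hull V" and z: "z \<in> rel_interior F"
  shows "\<exists>h0>0. \<forall>h. 0 < h \<longrightarrow> h \<le> h0 \<longrightarrow> (\<forall>y\<in>S.
    (1 / (h + nv S F \<bullet> (y - z))) *\<^sub>R (h *\<^sub>R y + (nv S F \<bullet> (y - z)) *\<^sub>R (z - h *\<^sub>R nv S F)) \<in> F)"
proof -
  let ?v = "nv S F"
  have zF: "z \<in> F" using z rel_interior_subset by auto
  have FS: "F \<subseteq> S" and cF: "convex F" using w by (auto simp: wall_def face_of_imp_subset dest: face_of_imp_convex)
  have zS: "z \<in> S" using zF FS by auto
  define D where "D y = ?v \<bullet> (y - z)" for y
  define Z where "Z h y = (1 / (h + D y)) *\<^sub>R (h *\<^sub>R y + D y *\<^sub>R (z - h *\<^sub>R ?v))" for h y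
  have D0: "D y \<ge> 0" if "y \<in> S" for y unfolding D_def by (rule nv_props(4)[OF w that zF])
  have VS: "p \<in> S" if "p \<in> V" for p using that V(2) hull_inc by metis
  have "\<exists>h0>0. \<forall>p\<in>V. \<forall>h. 0 < h \<longrightarrow> h \<le> h0 \<longrightarrow> Z h p \<in> F"
  proof (rule finite_uniform_radius[OF V(1)])
    fix p assume p: "p \<in> V"
    show "\<exists>h0>0. \<forall>h. 0 < h \<longrightarrow> h \<le> h0 \<longrightarrow> Z h p \<in> F"
    proof (cases "p \<in> F")
      case True
      have "D p = 0" unfolding D_def using nv_props(3)[OF w diff_in_dirs[OF True zF]] .
      then have "Z h p = p" if "h > 0" for h using that by (simp add: Z_def)
      then show ?thesis using True by (intro exI[of _ 1]) auto
    next
      case False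
      have d: "D p > 0" unfolding D_def by (rule nv_pos[OF w VS[OF p] False zF])
      define r where "r = p - z - D p *\<^sub>R ?v"
      have r: "r \<in> dirs F" unfolding r_def D_def by (rule nv_decomp[OF w diff_in_dirs[OF VS[OF p] zS]])
      obtain e where e: "e > 0" "\<And>t. \<bar>t\<bar> \<le> e \<Longrightarrow> z + t *\<^sub>R r \<in> F" using rel_interior_extend[OF z r] by auto
      show ?thesis
      proof (intro exI[of _ "e * D p"] conjI allI impI)
        show "0 < e * D p" using e d by simp
        fix h assume h: "0 < h" "h \<le> e * D p"
        have "h *\<^sub>R p + D p *\<^sub>R (z - h *\<^sub>R ?v) = (h + D p) *\<^sub>R z + h *\<^sub>R r" by (simp add: r_def algebra_simps)
        then have "Z h p = z + (h / (h + D p)) *\<^sub>R r" using h d by (simp add: Z_def scaleR_add_right)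
        moreover have "h / (h + D p) \<le> e"
        proof -
          have "h / (h + D p) \<le> h / D p" using h d by (intro divide_left_mono) auto
          also have "\<dots> \<le> e" using h d by (simp add: divide_le_eq)
          finally show ?thesis .
        qed
        ultimately show "Z h p \<in> F" using e(2)[of "h / (h + D p)"] h d by simp
      qed
    qed
  qed auto
  then obtain h0 where h0: "h0 > 0" "\<And>p h. p \<in> V \<Longrightarrow> 0 < h \<Longrightarrow> h \<le> h0 \<Longrightarrow> Z h p \<in> F" by blast
  have "Z h y \<in> F" if h: "0 < h" "h \<le> h0" and y: "y \<in> S" for h y
  proof -
    obtain \<nu> where \<nu>: "\<And>p. p \<in> V \<Longrightarrow> \<nu> p \<ge> 0" "sum \<nu> V = 1" "(\<Sum>p\<in>V. \<nu> p *\<^sub>R p) = y"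
      using y unfolding V(2) convex_hull_finite[OF V(1)] by blast
    have "(\<Sum>p\<in>V. \<nu> p * D p) = ?v \<bullet> (\<Sum>p\<in>V. \<nu> p *\<^sub>R p) - sum \<nu> V * (?v \<bullet> z)"
      by (simp add: D_def inner_diff_right right_diff_distrib sum_subtractf inner_sum_right sum_distrib_right)
    then have Dy: "(\<Sum>p\<in>V. \<nu> p * D p) = D y" unfolding \<nu>(2,3) by (simp add: D_def inner_diff_right)
    have pos: "h + D y > 0" "\<And>p. p \<in> V \<Longrightarrow> h + D p > 0" using D0[OF y] D0[OF VS] h by (auto intro: add_pos_nonneg)
    \<comment> \<open>Projection from \<open>z - h v\<close> is not affine; weighting by the
      denominators \<open>h + D p\<close> makes the image of \<open>y\<close> a convex combination
      of the images of the points of \<open>V\<close>.\<close>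
    define \<mu> where "\<mu> p = \<nu> p * (h + D p) / (h + D y)" for p
    have \<mu>1: "sum \<mu> V = 1"
    proof -
      have "sum \<mu> V = (sum \<nu> V * h + (\<Sum>p\<in>V. \<nu> p * D p)) / (h + D y)"
        by (simp add: \<mu>_def sum_divide_distrib[symmetric] distrib_left sum.distrib sum_distrib_right)
      then show ?thesis using pos(1) unfolding \<nu>(2) Dy by simp
    qed
    have "(\<Sum>p\<in>V. \<mu> p *\<^sub>R Z h p) \<in> F"
      by (rule convex_sum[OF V(1) cF \<mu>1]) (use \<nu>(1) pos h0(2) h in \<open>auto simp: \<mu>_def less_imp_le\<close>)
    also have "(\<Sum>p\<in>V. \<mu> p *\<^sub>R Z h p) = (\<Sum>p\<in>V. (1 / (h + D y)) *\<^sub>R (\<nu> p *\<^sub>R (h *\<^sub>R p + D p *\<^sub>R (z - h *\<^sub>R ?v))))"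
    proof (rule sum.cong[OF refl])
      fix p assume "p \<in> V"
      then have "h + D p \<noteq> 0" using pos(2)[of p] by simp
      then show "\<mu> p *\<^sub>R Z h p = (1 / (h + D y)) *\<^sub>R (\<nu> p *\<^sub>R (h *\<^sub>R p + D p *\<^sub>R (z - h *\<^sub>R ?v)))"
        unfolding \<mu>_def Z_def scaleR_scaleR by simp
    qed
    also have "\<dots> = (1 / (h + D y)) *\<^sub>R (\<Sum>p\<in>V. h *\<^sub>R (\<nu> p *\<^sub>R p) + (\<nu> p * D p) *\<^sub>R (z - h *\<^sub>R ?v))"
      unfolding scaleR_sum_right[symmetric] by (simp add: scaleR_add_right mult.commute)
    also have "\<dots> = (1 / (h + D y)) *\<^sub>R (h *\<^sub>R y + D y *\<^sub>R (z - h *\<^sub>R ?v))"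
      unfolding sum.distrib scaleR_sum_right[symmetric] scaleR_sum_left[symmetric] \<nu>(3) Dy ..
    finally show ?thesis by (simp add: Z_def)
  qed
  then show ?thesis using h0(1) unfolding Z_def D_def by blast
qed

section \<open>Lower and upper bounds near a vertex\<close>

context weakly_concave_setting
begin

lemma good_complexD:
  assumes "good_complex x0 PP c"
  shows "in_class T \<iota> PP0 PP" "subdivides PP PPb" "{x0} \<in> PP"
    "\<And>\<sigma>. \<sigma> \<in> PP \<Longrightarrow> x0 \<in> \<sigma> \<Longrightarrow> \<sigma> \<subseteq> U" "\<And>\<sigma>. \<sigma> \<in> PP \<Longrightarrow> x0 \<in> \<sigma> \<Longrightarrow> polytope (\<iota> ` \<sigma>)"
    "\<And>j. j \<le> n \<Longrightarrow> minkowski \<iota> PP U (int n - int j) (c j)"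
    "\<And>j \<alpha>. j \<le> n \<Longrightarrow> \<alpha> > 0 \<Longrightarrow> beta_positive T \<iota> PP0 n U PPb b (int n - int j) PP (\<lambda>\<sigma>. \<alpha> * c j \<sigma>)"
    "\<And>j \<sigma>. j \<le> n \<Longrightarrow> \<sigma> \<in> PP \<Longrightarrow> x0 \<in> \<sigma> \<Longrightarrow> pdim \<iota> \<sigma> = int n - int j \<Longrightarrow> c j \<sigma> > 0"
  using assms unfolding good_complex_def by auto

text \<open>The weight off \<open>x0\<close> in a combination of the vertices is at most a constant
  times the distance from \<open>x0\<close>, and it multiplies values of \<open>f\<close> bounded
  below by a finite minimum.\<close>

lemma lower_bound_top_cell:
  assumes g: "good_complex x0 PP c" and s: "\<sigma> \<in> PP" "x0 \<in> \<sigma>" "pdim \<iota> \<sigma> = int n" and eps: "\<epsilon> > 0"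
  shows "\<exists>\<delta>>0. \<forall>y\<in>\<sigma>. \<iota> y \<in> rel_interior (\<iota> ` \<sigma>) \<longrightarrow> dist (\<iota> y) (\<iota> x0) < \<delta> \<longrightarrow> f x0 - \<epsilon> < f y"
proof -
  note gD = good_complexD[OF g]
  note e = in_classD(1)[OF gD(1)]
  have inj: "inj_on \<iota> \<sigma>" by (rule epcD(4)[OF e s(1)])
  obtain V0 where V0: "finite V0" "\<iota> ` \<sigma> = convex hull V0" using gD(5)[OF s(1,2)] by (auto simp: polytope_def)
  \<comment> \<open>Generating points of the polytope, lifted to \<open>\<sigma>\<close>; adding
    \<open>x0\<close> leaves the hull unchanged.\<close>
  define V where "V = insert x0 (\<sigma> \<inter> \<iota> -` V0)"
  have "V0 \<subseteq> \<iota> ` \<sigma>" unfolding V0(2) by (rule hull_subset)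
  then have img: "\<iota> ` V = insert (\<iota> x0) V0" by (auto simp: V_def)
  have hull: "convex hull (\<iota> ` V) = \<iota> ` \<sigma>"
    unfolding img V0(2)[symmetric] using s(2) V0(2) by (subst hull_redundant) auto
  have Vs: "V \<subseteq> \<sigma>" using s(2) by (auto simp: V_def)
  have injV: "inj_on \<iota> V" using inj Vs by (rule inj_on_subset)
  have "finite (\<iota> ` V)" unfolding img using V0(1) by simp
  then have finV: "finite V" using injV by (simp add: finite_image_iff)
  have "is_face \<iota> {x0} \<sigma>" using is_face_iff_subset[OF e s(1) gD(3)] s(2) by simp
  then have fc: "{\<iota> x0} face_of (convex hull (\<iota> ` V))" unfolding hull by (simp add: is_face_def)
  obtain K where K: "K \<ge> 0" "\<And>\<nu>. (\<And>p. p \<in> \<iota> ` V \<Longrightarrow> \<nu> p \<ge> 0) \<Longrightarrow> sum \<nu> (\<iota> ` V) = 1 \<Longrightarrow>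
    1 - \<nu> (\<iota> x0) \<le> K * dist (\<Sum>p\<in>\<iota> ` V. \<nu> p *\<^sub>R p) (\<iota> x0)"
    using vertex_weight_bound[OF finite_imageI[OF finV] fc] by (auto simp: V_def)
  define M where "M = Min (f ` V)"
  have xV: "x0 \<in> V" by (simp add: V_def)
  have M: "M \<le> f p" if "p \<in> V" for p unfolding M_def using finV that by (intro Min_le) auto
  have M0: "M \<le> f x0" by (rule M[OF xV])
  \<comment> \<open>Bounds the loss \<open>K * \<delta> * (f x0 - M)\<close> by \<epsilon>; the two
    summands \<open>1\<close> keep the denominator positive.\<close>
  define \<delta> where "\<delta> = \<epsilon> / ((K + 1) * (f x0 - M + 1))"
  have KM: "(K + 1) * (f x0 - M + 1) > 0" using K(1) M0 by (intro mult_pos_pos) auto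
  show ?thesis
  proof (intro exI[of _ \<delta>] conjI ballI impI)
    show "\<delta> > 0" unfolding \<delta>_def using eps KM by simp
    fix y assume y: "y \<in> \<sigma>" "\<iota> y \<in> rel_interior (\<iota> ` \<sigma>)" "dist (\<iota> y) (\<iota> x0) < \<delta>"
    have "\<iota> y \<in> convex hull (\<iota> ` V)" unfolding hull using y(1) by simp
    then obtain \<nu> where \<nu>: "\<And>p. p \<in> \<iota> ` V \<Longrightarrow> \<nu> p \<ge> 0" "sum \<nu> (\<iota> ` V) = 1" "(\<Sum>p\<in>\<iota> ` V. \<nu> p *\<^sub>R p) = \<iota> y"
      unfolding convex_hull_finite[OF finite_imageI[OF finV]] by blast
    have 1: "1 - \<nu> (\<iota> x0) \<le> K * dist (\<iota> y) (\<iota> x0)" using K(2)[OF \<nu>(1,2)] unfolding \<nu>(3) .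
    have "sum (\<nu> \<circ> \<iota>) V = 1" using \<nu>(2) by (simp add: sum.reindex[OF injV])
    moreover have "(\<Sum>p\<in>V. (\<nu> \<circ> \<iota>) p *\<^sub>R \<iota> p) = \<iota> y" using \<nu>(3) by (simp add: sum.reindex[OF injV])
    ultimately have J: "(\<Sum>p\<in>V. (\<nu> \<circ> \<iota>) p * f p) \<le> f y"
      by (intro jensen_on_top_cell[OF gD(1,2) s(1,3) gD(4)[OF s(1,2)] y(1,2) finV Vs]) (use \<nu>(1) in auto)
    have sum1: "\<nu> (\<iota> x0) + (\<Sum>p\<in>V-{x0}. (\<nu> \<circ> \<iota>) p) = 1"
      using \<open>sum (\<nu> \<circ> \<iota>) V = 1\<close> by (simp add: sum.remove[OF finV xV])
    have "(\<Sum>p\<in>V-{x0}. (\<nu> \<circ> \<iota>) p * M) \<le> (\<Sum>p\<in>V-{x0}. (\<nu> \<circ> \<iota>) p * f p)"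
      using \<nu>(1) M by (intro sum_mono mult_left_mono) auto
    moreover have "(\<Sum>p\<in>V-{x0}. (\<nu> \<circ> \<iota>) p * M) = (1 - \<nu> (\<iota> x0)) * M"
      unfolding sum_distrib_right[symmetric] using sum1 by (simp add: eq_diff_eq add.commute)
    moreover have "(\<Sum>p\<in>V. (\<nu> \<circ> \<iota>) p * f p) = \<nu> (\<iota> x0) * f x0 + (\<Sum>p\<in>V-{x0}. (\<nu> \<circ> \<iota>) p * f p)"
      by (simp add: sum.remove[OF finV xV])
    ultimately have "\<nu> (\<iota> x0) * f x0 + (1 - \<nu> (\<iota> x0)) * M \<le> f y" using J by linarith
    then have low: "f x0 - (1 - \<nu> (\<iota> x0)) * (f x0 - M) \<le> f y" by (simp add: algebra_simps)
    have "(1 - \<nu> (\<iota> x0)) * (f x0 - M) \<le> (K * dist (\<iota> y) (\<iota> x0)) * (f x0 - M)"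
      using 1 M0 by (intro mult_right_mono) auto
    also have "\<dots> \<le> ((K + 1) * dist (\<iota> y) (\<iota> x0)) * (f x0 - M + 1)"
      using K(1) M0 by (intro mult_mono) auto
    also have "\<dots> = ((K + 1) * (f x0 - M + 1)) * dist (\<iota> y) (\<iota> x0)" by simp
    also have "\<dots> < ((K + 1) * (f x0 - M + 1)) * \<delta>" using KM y(3) by (intro mult_strict_left_mono)
    also have "\<dots> = \<epsilon>"
      unfolding \<delta>_def times_divide_eq_right
      by (rule nonzero_mult_div_cancel_left) (rule less_imp_neq[OF KM, symmetric])
    finally show "f x0 - \<epsilon> < f y" using low by linarith
  qed
qed

text \<open>From \<open>y\<close> one goes the same length \<eta> along the normal into every
  coface. Equal lengths make \<open>y\<close> the center by the Minkowski condition, and the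
  induction hypothesis bounds \<open>f\<close> at all moved points, so the same \<delta> serves the
  next lower dimension.\<close>

lemma lower_bound_near_vertex:
  assumes g: "good_complex x0 PP c" and eps: "\<epsilon> > 0" and x0: "x0 \<in> U" and j: "j \<le> n"
  shows "\<exists>\<delta>>0. \<forall>\<sigma>\<in>{\<sigma>\<in>PP. x0 \<in> \<sigma>}. pdim \<iota> \<sigma> = int n - int j \<longrightarrow>
    (\<forall>y\<in>\<sigma>. \<iota> y \<in> rel_interior (\<iota> ` \<sigma>) \<longrightarrow> dist (\<iota> y) (\<iota> x0) < \<delta> \<longrightarrow> f x0 - \<epsilon> < f y)"
  using j
proof (induction j)
  case 0
  note gD = good_complexD[OF g]
  note e = in_classD(1)[OF gD(1)]
  show ?case
  proof (rule finite_uniform_radius[OF finite_star[OF e]])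
    fix \<sigma> assume s: "\<sigma> \<in> {\<sigma>\<in>PP. x0 \<in> \<sigma>}"
    show "\<exists>\<delta>>0. pdim \<iota> \<sigma> = int n - int 0 \<longrightarrow>
      (\<forall>y\<in>\<sigma>. \<iota> y \<in> rel_interior (\<iota> ` \<sigma>) \<longrightarrow> dist (\<iota> y) (\<iota> x0) < \<delta> \<longrightarrow> f x0 - \<epsilon> < f y)"
    proof (cases "pdim \<iota> \<sigma> = int n")
      case True
      then show ?thesis using lower_bound_top_cell[OF g _ _ True eps] s by auto
    qed (auto intro: exI[of _ 1])
  qed (auto dest: less_le_trans)
next
  case (Suc j)
  note gD = good_complexD[OF g]
  note e = in_classD(1)[OF gD(1)]
  have jn: "j \<le> n" using Suc.prems by simp
  obtain \<delta> where \<delta>: "\<delta> > 0" "\<And>\<sigma> y. \<sigma> \<in> PP \<Longrightarrow> x0 \<in> \<sigma> \<Longrightarrow> pdim \<iota> \<sigma> = int n - int j \<Longrightarrow> y \<in> \<sigma> \<Longrightarrow>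
    \<iota> y \<in> rel_interior (\<iota> ` \<sigma>) \<Longrightarrow> dist (\<iota> y) (\<iota> x0) < \<delta> \<Longrightarrow> f x0 - \<epsilon> < f y"
    using Suc.IH[OF jn] by blast
  show ?case
  proof (intro exI[of _ \<delta>] conjI ballI impI)
    show "\<delta> > 0" by (rule \<delta>(1))
    fix \<tau> y assume "\<tau> \<in> {\<sigma> \<in> PP. x0 \<in> \<sigma>}" and dt: "pdim \<iota> \<tau> = int n - int (Suc j)"
      and y: "y \<in> \<tau>" "\<iota> y \<in> rel_interior (\<iota> ` \<tau>)" "dist (\<iota> y) (\<iota> x0) < \<delta>"
    then have t: "\<tau> \<in> PP" "x0 \<in> \<tau>" by auto
    have tne: "\<tau> \<noteq> {}" using t by auto
    have k: "pdim \<iota> \<tau> + 1 = int n - int j" using dt by simp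
    define C where "C = {\<sigma> \<in> PP. \<tau> \<subseteq> \<sigma> \<and> pdim \<iota> \<sigma> = pdim \<iota> \<tau> + 1}"
    have finC: "finite C" unfolding C_def by (rule finite_cofaces[OF e tne])
    have Cne: "C \<noteq> {}"
    proof -
      obtain \<sigma>n where "\<sigma>n \<in> PP" "\<tau> \<subseteq> \<sigma>n" "pdim \<iota> \<sigma>n = int n"
        using pure_in_class(2)[OF e0 pure0 gD(1) t(1) tne] by auto
      then obtain \<sigma>' where "\<sigma>' \<in> PP" "\<tau> \<subseteq> \<sigma>'" "pdim \<iota> \<sigma>' = pdim \<iota> \<tau> + 1"
        using coface_exists[OF e t(1) tne, of \<sigma>n] dt by auto
      then show ?thesis by (auto simp: C_def)
    qed
    have tU: "\<tau> \<inter> U \<noteq> {}" using t x0 by auto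
    have Cs: "\<sigma> \<in> PP" "x0 \<in> \<sigma>" "\<tau> \<subseteq> \<sigma>" "pdim \<iota> \<sigma> = int n - int j" "\<sigma> \<subseteq> U" "c j \<sigma> > 0" if "\<sigma> \<in> C" for \<sigma>
      using that t(2) gD(4)[of \<sigma>] gD(8)[OF jn, of \<sigma>] k by (auto simp: C_def)
    have wall: "wall (\<iota> ` \<sigma>) (\<iota> ` \<tau>)" if "\<sigma> \<in> C" for \<sigma>
      by (rule wall_cells[OF e Cs(1)[OF that] t(1) tne Cs(3)[OF that]]) (use Cs(4)[OF that] k in simp)
    have "\<exists>\<eta>>0. \<forall>\<sigma>\<in>C. \<forall>t. 0 < t \<longrightarrow> t \<le> \<eta> \<longrightarrow> \<iota> y + t *\<^sub>R nvec \<iota> \<sigma> \<tau> \<in> rel_interior (\<iota> ` \<sigma>)"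
    proof (rule finite_uniform_radius[OF finC])
      fix \<sigma> assume "\<sigma> \<in> C"
      from nv_move[OF wall[OF this] y(2)]
      show "\<exists>\<eta>>0. \<forall>t. 0 < t \<longrightarrow> t \<le> \<eta> \<longrightarrow> \<iota> y + t *\<^sub>R nvec \<iota> \<sigma> \<tau> \<in> rel_interior (\<iota> ` \<sigma>)"
        unfolding nvec_eq_nv by blast
    qed auto
    then obtain \<eta>0 where \<eta>0: "\<eta>0 > 0" "\<And>\<sigma> t. \<sigma> \<in> C \<Longrightarrow> 0 < t \<Longrightarrow> t \<le> \<eta>0 \<Longrightarrow> \<iota> y + t *\<^sub>R nvec \<iota> \<sigma> \<tau> \<in> rel_interior (\<iota> ` \<sigma>)"
      by blast
    \<comment> \<open>At most half of the remaining room, so that the moved points stay within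
      \<delta> of \<open>x0\<close>.\<close>
    define \<eta> where "\<eta> = min \<eta>0 ((\<delta> - dist (\<iota> y) (\<iota> x0)) / 2)"
    have \<eta>: "\<eta> > 0" "\<eta> \<le> \<eta>0" "\<eta> < \<delta> - dist (\<iota> y) (\<iota> x0)" using \<eta>0(1) y(3) by (auto simp: \<eta>_def min_def)
    have "\<forall>\<sigma>\<in>C. \<exists>x\<in>\<sigma>. \<iota> x = \<iota> y + \<eta> *\<^sub>R nvec \<iota> \<sigma> \<tau>"
    proof
      fix \<sigma> assume "\<sigma> \<in> C"
      then have "\<iota> y + \<eta> *\<^sub>R nvec \<iota> \<sigma> \<tau> \<in> \<iota> ` \<sigma>" using \<eta>0(2)[OF _ \<eta>(1,2)] rel_interior_subset by blast
      then show "\<exists>x\<in>\<sigma>. \<iota> x = \<iota> y + \<eta> *\<^sub>R nvec \<iota> \<sigma> \<tau>" by (metis imageE)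
    qed
    from bchoice[OF this[unfolded Bex_def]] obtain xs where xs0: "\<forall>\<sigma>\<in>C. xs \<sigma> \<in> \<sigma> \<and> \<iota> (xs \<sigma>) = \<iota> y + \<eta> *\<^sub>R nvec \<iota> \<sigma> \<tau>" by blast
    have xs: "xs \<sigma> \<in> \<sigma>" "\<iota> (xs \<sigma>) = \<iota> y + \<eta> *\<^sub>R nvec \<iota> \<sigma> \<tau>" if "\<sigma> \<in> C" for \<sigma> using xs0 that by auto
    have nn: "norm (nvec \<iota> \<sigma> \<tau>) = 1" if "\<sigma> \<in> C" for \<sigma> using nv_props(2)[OF wall[OF that]] by (simp add: nvec_eq_nv)
    have yU: "y \<in> U" using gD(4)[OF t] y(1) by auto
    have mk: "(\<Sum>\<sigma>\<in>C. c j \<sigma> *\<^sub>R nvec \<iota> \<sigma> \<tau>) = 0"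
    proof -
      have "\<tau> \<in> restr_dim \<iota> PP U (int n - int j - 1)" using t tU dt by (simp add: restr_dim_iff)
      from gD(6)[OF jn, unfolded minkowski_def, rule_format, OF this]
      show ?thesis unfolding cofaces_eq[OF e t(1) tU] C_def k .
    qed
    have "(\<Sum>\<sigma>\<in>C. (c j \<sigma> / \<eta>) * f (xs \<sigma>)) \<le> (\<Sum>\<sigma>\<in>C. c j \<sigma> / \<eta>) * f y"
    proof (rule balanced_inequality[OF gD(1) t(1) y(1) yU _ _ C_def Cne])
      show "minkowski \<iota> PP U (pdim \<iota> \<tau> + 1) (c j)" unfolding k by (rule gD(6)[OF jn])
      show "beta_positive T \<iota> PP0 n U PPb b (pdim \<iota> \<tau> + 1) PP (\<lambda>\<sigma>. \<alpha> * c j \<sigma>)" if "\<alpha> > 0" for \<alpha>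
        unfolding k by (rule gD(7)[OF jn that])
      show "\<sigma> \<subseteq> U \<and> xs \<sigma> \<in> \<sigma> \<and> 0 < c j \<sigma>" if "\<sigma> \<in> C" for \<sigma> using Cs[OF that] xs[OF that] by auto
      show "\<eta> = nvec \<iota> \<sigma> \<tau> \<bullet> (\<iota> (xs \<sigma>) - \<iota> y) \<and> 0 < \<eta>" if "\<sigma> \<in> C" for \<sigma>
        using xs(2)[OF that] nn[OF that] \<eta>(1) by (simp add: norm_eq_1)
      have "(\<Sum>\<sigma>\<in>C. (c j \<sigma> / \<eta>) *\<^sub>R \<iota> (xs \<sigma>)) = (\<Sum>\<sigma>\<in>C. (c j \<sigma> / \<eta>) *\<^sub>R \<iota> y + c j \<sigma> *\<^sub>R nvec \<iota> \<sigma> \<tau>)"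
        by (rule sum.cong[OF refl]) (use \<eta>(1) in \<open>simp add: xs(2) scaleR_add_right\<close>)
      then show "(\<Sum>\<sigma>\<in>C. (c j \<sigma> / \<eta>) *\<^sub>R \<iota> (xs \<sigma>)) = (\<Sum>\<sigma>\<in>C. c j \<sigma> / \<eta>) *\<^sub>R \<iota> y"
        by (simp add: sum.distrib mk scaleR_sum_left)
    qed
    moreover have "(\<Sum>\<sigma>\<in>C. (c j \<sigma> / \<eta>) * (f x0 - \<epsilon>)) < (\<Sum>\<sigma>\<in>C. (c j \<sigma> / \<eta>) * f (xs \<sigma>))"
    proof (rule sum_strict_mono[OF finC Cne])
      fix \<sigma> assume s: "\<sigma> \<in> C"
      have "dist (\<iota> (xs \<sigma>)) (\<iota> x0) \<le> dist (\<iota> (xs \<sigma>)) (\<iota> y) + dist (\<iota> y) (\<iota> x0)" by (rule dist_triangle)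
      also have "dist (\<iota> (xs \<sigma>)) (\<iota> y) = \<eta>" using xs(2)[OF s] nn[OF s] \<eta>(1) by (simp add: dist_norm)
      finally have "dist (\<iota> (xs \<sigma>)) (\<iota> x0) < \<delta>" using \<eta>(3) by simp
      then have "f x0 - \<epsilon> < f (xs \<sigma>)"
        using \<delta>(2)[OF Cs(1,2,4)[OF s] xs(1)[OF s]] \<eta>0(2)[OF s \<eta>(1,2)] xs(2)[OF s] by simp
      then show "(c j \<sigma> / \<eta>) * (f x0 - \<epsilon>) < (c j \<sigma> / \<eta>) * f (xs \<sigma>)"
        using Cs(6)[OF s] \<eta>(1) by (intro mult_strict_left_mono) auto
    qed
    ultimately have "(\<Sum>\<sigma>\<in>C. c j \<sigma> / \<eta>) * (f x0 - \<epsilon>) < (\<Sum>\<sigma>\<in>C. c j \<sigma> / \<eta>) * f y"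
      by (simp add: sum_distrib_right)
    moreover have "(\<Sum>\<sigma>\<in>C. c j \<sigma> / \<eta>) > 0" by (rule sum_pos[OF finC Cne]) (use Cs(6) \<eta>(1) in auto)
    ultimately show "f x0 - \<epsilon> < f y" by (simp add: mult_less_cancel_left_pos)
  qed
qed

text \<open>The point \<open>y\<close> of \<open>\<sigma>\<close> is completed to a balanced convex combination by fixed points in the other
  cofaces of a facet \<open>\<tau>\<close>. Its center \<open>z\<close> lies in \<open>\<tau>\<close>, and as \<open>y\<close> tends to \<open>x0\<close> so does \<open>z\<close>,
  while the coefficient of \<open>y\<close> tends to one.\<close>

lemma upper_bound_step:
  assumes g: "good_complex x0 PP c" and eps: "\<epsilon> > 0" and x0: "x0 \<in> U"
    and s: "\<sigma> \<in> PP" "x0 \<in> \<sigma>" "pdim \<iota> \<sigma> = int m + 1"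
    and d1: "\<delta>1 > 0" "\<And>\<tau> y. \<tau> \<in> PP \<Longrightarrow> x0 \<in> \<tau> \<Longrightarrow> pdim \<iota> \<tau> = int m \<Longrightarrow> y \<in> \<tau> \<Longrightarrow>
      dist (\<iota> y) (\<iota> x0) < \<delta>1 \<Longrightarrow> f y < f x0 + \<epsilon> / 2"
  shows "\<exists>\<delta>>0. \<forall>y\<in>\<sigma>. dist (\<iota> y) (\<iota> x0) < \<delta> \<longrightarrow> f y < f x0 + \<epsilon>"
proof -
  note gD = good_complexD[OF g]
  note e = in_classD(1)[OF gD(1)]
  have mn: "m + 1 \<le> n" using dim_le[OF gD(1) s(1)] s(3) by simp
  define j where "j = n - (m + 1)"
  have jn: "j \<le> n" and jm: "int n - int j = int m + 1" using mn by (auto simp: j_def)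
  have sne: "{\<iota> x0} \<noteq> \<iota> ` \<sigma>"
  proof
    assume "{\<iota> x0} = \<iota> ` \<sigma>"
    then have "pdim \<iota> \<sigma> = 0" by (metis pdim_def aff_dim_sing)
    then show False using s(3) by simp
  qed
  have "is_face \<iota> {x0} \<sigma>" using is_face_iff_subset[OF e s(1) gD(3)] s(2) by simp
  then have "{\<iota> x0} face_of \<iota> ` \<sigma>" by (simp add: is_face_def)
  then obtain F where F: "F facet_of \<iota> ` \<sigma>" "{\<iota> x0} \<subseteq> F"
    using face_of_polyhedron_subset_facet[OF epcD(5)[OF e s(1)] _ _ sne] by blast
  obtain \<tau> where t: "\<tau> \<in> PP" "\<iota> ` \<tau> = F" "\<tau> \<subseteq> \<sigma>" "\<tau> = \<sigma> \<inter> \<iota> -` F"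
    using face_cell[OF e s(1) facet_of_imp_face_of[OF F(1)]] .
  have x0t: "x0 \<in> \<tau>" using t(4) s(2) F(2) by auto
  have dt: "pdim \<iota> \<tau> = int m" using F(1) s(3) by (simp add: facet_of_def pdim_def t(2))
  have tne: "\<tau> \<noteq> {}" using x0t by auto
  have tU: "\<tau> \<inter> U \<noteq> {}" using x0t x0 by auto
  have k: "pdim \<iota> \<tau> + 1 = int n - int j" using dt jm by simp
  define C where "C = {\<sigma> \<in> PP. \<tau> \<subseteq> \<sigma> \<and> pdim \<iota> \<sigma> = pdim \<iota> \<tau> + 1}"
  have finC: "finite C" unfolding C_def by (rule finite_cofaces[OF e tne])
  have sC: "\<sigma> \<in> C" using s t dt by (auto simp: C_def)
  have Cs: "s \<in> PP" "x0 \<in> s" "\<tau> \<subseteq> s" "pdim \<iota> s = int n - int j" "s \<subseteq> U" "c j s > 0" if "s \<in> C" for s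
    using that x0t gD(4)[of s] gD(8)[OF jn, of s] k by (auto simp: C_def)
  have wall: "wall (\<iota> ` s) (\<iota> ` \<tau>)" if "s \<in> C" for s
    by (rule wall_cells[OF e Cs(1)[OF that] t(1) tne Cs(3)[OF that]]) (use Cs(4)[OF that] k in simp)
  let ?v = "\<lambda>s. nvec \<iota> s \<tau>"
  have nn: "norm (?v s) = 1" if "s \<in> C" for s using nv_props(2)[OF wall[OF that]] by (simp add: nvec_eq_nv)
  have vt: "?v s \<bullet> (\<iota> p - \<iota> q) = 0" if "s \<in> C" "p \<in> \<tau>" "q \<in> \<tau>" for s p q
    unfolding nvec_eq_nv by (rule nv_props(3)[OF wall[OF that(1)]]) (use that in \<open>auto intro!: diff_in_dirs\<close>)
  define C' where "C' = C - {\<sigma>}"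
  have finC': "finite C'" using finC by (simp add: C'_def)
  have C'C: "s \<in> C" if "s \<in> C'" for s using that by (simp add: C'_def)
  have splitsum: "(\<Sum>s\<in>C. F s) = F \<sigma> + (\<Sum>s\<in>C'. F s)" for F :: "'a set \<Rightarrow> 'z::comm_monoid_add"
    unfolding C'_def by (rule sum.remove[OF finC sC])
  have mk: "(\<Sum>s\<in>C. c j s *\<^sub>R ?v s) = 0"
  proof -
    have "\<tau> \<in> restr_dim \<iota> PP U (int n - int j - 1)" using t tU dt jm by (simp add: restr_dim_iff)
    from gD(6)[OF jn, unfolded minkowski_def, rule_format, OF this]
    show ?thesis unfolding cofaces_eq[OF e t(1) tU] C_def k .
  qed
  let ?c1 = "c j \<sigma>" and ?v1 = "?v \<sigma>"
  have c1: "?c1 > 0" by (rule Cs(6)[OF sC])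
  have mk': "(\<Sum>s\<in>C'. c j s *\<^sub>R ?v s) = - (?c1 *\<^sub>R ?v1)" using mk unfolding splitsum by (simp add: eq_neg_iff_add_eq_0 add.commute)
  \<comment> \<open>A single unit normal with positive weight cannot balance to zero, so the facet
    has cofaces besides \<open>\<sigma>\<close>.\<close>
  have C'ne: "C' \<noteq> {}"
  proof
    assume "C' = {}"
    then have "?c1 *\<^sub>R ?v1 = 0" using mk' by simp
    then show False using c1 nn[OF sC] by auto
  qed
  define B where "B = (\<Sum>s\<in>C'. c j s)"
  have B: "B > 0" unfolding B_def by (rule sum_pos[OF finC' C'ne]) (use Cs(6) C'C in auto)
  obtain w where w: "w \<in> \<tau>" "\<iota> w \<in> rel_interior (\<iota> ` \<tau>)" using rel_interior_point[OF e t(1) tne] .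
  have "\<exists>\<eta>>0. \<forall>s\<in>C'. \<forall>t. 0 < t \<longrightarrow> t \<le> \<eta> \<longrightarrow> \<iota> w + t *\<^sub>R ?v s \<in> \<iota> ` s"
  proof (rule finite_uniform_radius[OF finC'])
    fix s assume "s \<in> C'"
    from nv_move[OF wall[OF C'C[OF this]] w(2)] rel_interior_subset[of "\<iota> ` s"]
    show "\<exists>\<eta>>0. \<forall>t. 0 < t \<longrightarrow> t \<le> \<eta> \<longrightarrow> \<iota> w + t *\<^sub>R ?v s \<in> \<iota> ` s"
      unfolding nvec_eq_nv by blast
  qed auto
  then obtain \<eta>0 where \<eta>0: "\<eta>0 > 0" "\<And>s t. s \<in> C' \<Longrightarrow> 0 < t \<Longrightarrow> t \<le> \<eta>0 \<Longrightarrow> \<iota> w + t *\<^sub>R ?v s \<in> \<iota> ` s" by blast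
  obtain V where V: "finite V" "\<iota> ` \<sigma> = convex hull V" using gD(5)[OF s(1,2)] by (auto simp: polytope_def)
  define D where "D y = ?v1 \<bullet> (\<iota> y - \<iota> w)" for y
  obtain h0 where h0: "h0 > 0" "\<And>h y. 0 < h \<Longrightarrow> h \<le> h0 \<Longrightarrow> y \<in> \<sigma> \<Longrightarrow>
      (1 / (h + D y)) *\<^sub>R (h *\<^sub>R \<iota> y + D y *\<^sub>R (\<iota> w - h *\<^sub>R ?v1)) \<in> \<iota> ` \<tau>"
    using facet_visibility[OF wall[OF sC] V w(2)] unfolding D_def nvec_eq_nv by blast
  \<comment> \<open>The first bound ensures visibility through the facet, the second that the points
    at height \<eta> exist in the other cofaces.\<close>
  define h where "h = min h0 (\<eta>0 * ?c1 / B)"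
  have h: "h > 0" "h \<le> h0" using h0 \<eta>0(1) c1 B by (auto simp: h_def)
  \<comment> \<open>With this height the fixed points have total coefficient \<open>?c1 / h\<close>
    and weighted mean \<open>\<iota> w - h v\<close>, the viewpoint of
    \<open>facet_visibility\<close>.\<close>
  define \<eta> where "\<eta> = h * B / ?c1"
  have \<eta>: "\<eta> > 0" using h B c1 by (simp add: \<eta>_def)
  have "h \<le> \<eta>0 * ?c1 / B" by (simp add: h_def)
  then have \<eta>le: "\<eta> \<le> \<eta>0" using B c1 by (simp add: \<eta>_def field_simps)
  have Bh: "B / \<eta> = ?c1 / h" using h B c1 by (simp add: \<eta>_def)
  have "\<forall>s\<in>C'. \<exists>x. x \<in> s \<and> \<iota> x = \<iota> w + \<eta> *\<^sub>R ?v s"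
  proof
    fix s assume "s \<in> C'"
    from \<eta>0(2)[OF this \<eta> \<eta>le] show "\<exists>x. x \<in> s \<and> \<iota> x = \<iota> w + \<eta> *\<^sub>R ?v s" by (metis imageE)
  qed
  from bchoice[OF this] obtain q where q0: "\<forall>s\<in>C'. q s \<in> s \<and> \<iota> (q s) = \<iota> w + \<eta> *\<^sub>R ?v s" by blast
  have q: "q s \<in> s" "\<iota> (q s) = \<iota> w + \<eta> *\<^sub>R ?v s" if "s \<in> C'" for s using q0 that by auto
  define N where "N = (\<Sum>s\<in>C'. c j s * f (q s)) / B"
  define w' where "w' = \<iota> w - h *\<^sub>R ?v1"
  \<comment> \<open>\<open>R\<close> bounds the distance of the center from \<open>x0\<close>
    relative to that of \<open>y\<close>, and \<open>Q\<close> bounds \<open>f z - N\<close>; the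
    two terms in \<delta> answer to them.\<close>
  define R where "R = 1 + norm (w' - \<iota> x0) / h"
  define Q where "Q = \<bar>f x0\<bar> + \<epsilon> / 2 + \<bar>N\<bar>"
  have R: "R \<ge> 1" using h by (simp add: R_def)
  have Q: "Q > 0" using eps by (simp add: Q_def add_nonneg_pos add_pos_nonneg)
  define \<delta> where "\<delta> = min (\<delta>1 / R) (\<epsilon> * h / (2 * Q))"
  have \<delta>: "\<delta> > 0" using d1(1) R Q eps h by (auto simp: \<delta>_def)
  have "\<delta>1 * 1 \<le> \<delta>1 * R" using R d1(1) by (intro mult_left_mono) auto
  then have "\<delta>1 / R \<le> \<delta>1" using R by (simp add: divide_le_eq)
  then have \<delta>le: "\<delta> \<le> \<delta>1" by (simp add: \<delta>_def)
  show ?thesis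
  proof (intro exI[of _ \<delta>] conjI ballI impI)
    show "\<delta> > 0" by (rule \<delta>)
    fix y assume y: "y \<in> \<sigma>" "dist (\<iota> y) (\<iota> x0) < \<delta>"
    show "f y < f x0 + \<epsilon>"
    proof (cases "y \<in> \<tau>")
      case True
      have "f y < f x0 + \<epsilon> / 2" by (rule d1(2)[OF t(1) x0t dt True]) (use y(2) \<delta>le in simp)
      then show ?thesis using eps by simp
    next
      case False
      let ?d = "D y"
      have yF: "\<iota> y \<notin> \<iota> ` \<tau>" using False t(2,4) y(1) by auto
      have d: "?d > 0" unfolding D_def nvec_eq_nv by (rule nv_pos[OF wall[OF sC] imageI[OF y(1)] yF imageI[OF w(1)]])
      obtain z where z: "z \<in> \<tau>" "\<iota> z = (1 / (h + ?d)) *\<^sub>R (h *\<^sub>R \<iota> y + ?d *\<^sub>R w')"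
        using h0(2)[OF h y(1)] unfolding w'_def by (metis imageE)
      have hz: "(h + ?d) *\<^sub>R \<iota> z = h *\<^sub>R \<iota> y + ?d *\<^sub>R w'" unfolding z(2) using h d by simp
      have vz: "?v s \<bullet> \<iota> z = ?v s \<bullet> \<iota> w" if "s \<in> C" for s using vt[OF that z(1) w(1)] by (simp add: inner_diff_right)
      let ?x = "\<lambda>s. if s = \<sigma> then y else q s" and ?e = "\<lambda>s. if s = \<sigma> then ?d else \<eta>"
      have zU: "z \<in> U" using gD(4)[OF t(1) x0t] z(1) by auto
      have sum1: "(\<Sum>s\<in>C. c j s / ?e s) = ?c1 / ?d + ?c1 / h"
      proof -
        have "(\<Sum>s\<in>C'. c j s / ?e s) = (\<Sum>s\<in>C'. c j s / \<eta>)" by (rule sum.cong) (auto simp: C'_def)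
        then show ?thesis unfolding splitsum Bh[symmetric] B_def by (simp add: sum_divide_distrib)
      qed
      have "(\<Sum>s\<in>C. (c j s / ?e s) * f (?x s)) \<le> (\<Sum>s\<in>C. c j s / ?e s) * f z"
      proof (rule balanced_inequality[OF gD(1) t(1) z(1) zU _ _ C_def])
        show "C \<noteq> {}" using sC by auto
        show "minkowski \<iota> PP U (pdim \<iota> \<tau> + 1) (c j)" unfolding k by (rule gD(6)[OF jn])
        show "beta_positive T \<iota> PP0 n U PPb b (pdim \<iota> \<tau> + 1) PP (\<lambda>\<sigma>. \<alpha> * c j \<sigma>)" if "\<alpha> > 0" for \<alpha>
          unfolding k by (rule gD(7)[OF jn that])
        show "s \<subseteq> U \<and> ?x s \<in> s \<and> 0 < c j s" if "s \<in> C" for s using Cs[OF that] q(1)[of s] that y(1) by (auto simp: C'_def)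
        show "?e s = nvec \<iota> s \<tau> \<bullet> (\<iota> (?x s) - \<iota> z) \<and> 0 < ?e s" if "s \<in> C" for s
        proof (cases "s = \<sigma>")
          case True
          then show ?thesis using d vz[OF sC] by (simp add: D_def inner_diff_right)
        next
          case False
          then have "s \<in> C'" using that by (simp add: C'_def)
          then show ?thesis using False q(2)[of s] nn[OF that] vz[OF that] \<eta>
            by (simp add: inner_diff_right inner_add_right norm_eq_1)
        qed
        have "(\<Sum>s\<in>C'. (c j s / ?e s) *\<^sub>R \<iota> (?x s)) = (\<Sum>s\<in>C'. (c j s / \<eta>) *\<^sub>R \<iota> w + c j s *\<^sub>R ?v s)"
          by (rule sum.cong[OF refl]) (use \<eta> in \<open>auto simp: C'_def q(2) scaleR_add_right\<close>)
        also have "\<dots> = (?c1 / h) *\<^sub>R \<iota> w - ?c1 *\<^sub>R ?v1"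
          unfolding sum.distrib mk' scaleR_sum_left[symmetric] sum_divide_distrib[symmetric] B_def[symmetric] Bh by simp
        also have "\<dots> = (?c1 / h) *\<^sub>R w'" using h by (simp add: w'_def scaleR_diff_right)
        finally have "(\<Sum>s\<in>C. (c j s / ?e s) *\<^sub>R \<iota> (?x s)) = (?c1 / ?d) *\<^sub>R \<iota> y + (?c1 / h) *\<^sub>R w'"
          unfolding splitsum by simp
        also have "\<dots> = (?c1 / (?d * h)) *\<^sub>R (h *\<^sub>R \<iota> y + ?d *\<^sub>R w')"
          using h d by (simp add: scaleR_add_right)
        also have "\<dots> = (?c1 / (?d * h) * (h + ?d)) *\<^sub>R \<iota> z" unfolding hz[symmetric] by simp
        also have "?c1 / (?d * h) * (h + ?d) = ?c1 / ?d + ?c1 / h" using h d by (simp add: field_simps)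
        finally show "(\<Sum>s\<in>C. (c j s / ?e s) *\<^sub>R \<iota> (?x s)) = (\<Sum>s\<in>C. c j s / ?e s) *\<^sub>R \<iota> z" unfolding sum1 .
      qed
      moreover have "(\<Sum>s\<in>C. (c j s / ?e s) * f (?x s)) = ?c1 / ?d * f y + ?c1 / h * N"
      proof -
        have "(\<Sum>s\<in>C'. (c j s / ?e s) * f (?x s)) = (\<Sum>s\<in>C'. c j s * f (q s) / \<eta>)" by (rule sum.cong) (auto simp: C'_def)
        also have "\<dots> = B / \<eta> * N" unfolding sum_divide_distrib[symmetric] N_def using B by simp
        finally show ?thesis unfolding splitsum Bh by simp
      qed
      ultimately have "?c1 / ?d * f y + ?c1 / h * N \<le> (?c1 / ?d + ?c1 / h) * f z" unfolding sum1 by simp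
      \<comment> \<open>Scaled so that \<open>f y\<close> has coefficient one. The average
        \<open>N\<close> over the fixed points then has coefficient \<open>?d / h\<close>, which
        tends to zero with the height of \<open>y\<close>.\<close>
      then have "(?d / ?c1) * (?c1 / ?d * f y + ?c1 / h * N) \<le> (?d / ?c1) * ((?c1 / ?d + ?c1 / h) * f z)"
        using d c1 by (intro mult_left_mono) auto
      moreover have "(?d / ?c1) * (?c1 / ?d * f y + ?c1 / h * N) = f y + ?d / h * N"
        "(?d / ?c1) * ((?c1 / ?d + ?c1 / h) * f z) = f z + ?d / h * f z" using d c1 by (simp_all add: field_simps)
      ultimately have main: "f y \<le> f z + ?d / h * (f z - N)" by (simp add: right_diff_distrib)
      have dle: "?d \<le> dist (\<iota> y) (\<iota> x0)"
      proof -
        have "?d = ?v1 \<bullet> (\<iota> y - \<iota> x0)" using vt[OF sC x0t w(1)] by (simp add: D_def inner_diff_right)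
        also have "\<dots> \<le> norm ?v1 * norm (\<iota> y - \<iota> x0)" by (rule norm_cauchy_schwarz)
        finally show ?thesis using nn[OF sC] by (simp add: dist_norm)
      qed
      have "dist (\<iota> z) (\<iota> x0) < \<delta>1"
      proof -
        have hR: "h * (dist (\<iota> y) (\<iota> x0) * R) = h * dist (\<iota> y) (\<iota> x0) + dist (\<iota> y) (\<iota> x0) * norm (w' - \<iota> x0)"
          using h(1) by (simp add: R_def distrib_left)
        have "(h + ?d) *\<^sub>R (\<iota> z - \<iota> x0) = h *\<^sub>R (\<iota> y - \<iota> x0) + ?d *\<^sub>R (w' - \<iota> x0)"
          unfolding scaleR_diff_right hz by (simp add: algebra_simps)
        then have "norm ((h + ?d) *\<^sub>R (\<iota> z - \<iota> x0)) \<le> h * norm (\<iota> y - \<iota> x0) + ?d * norm (w' - \<iota> x0)"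
          using norm_triangle_ineq[of "h *\<^sub>R (\<iota> y - \<iota> x0)" "?d *\<^sub>R (w' - \<iota> x0)"] h d by simp
        moreover have "norm ((h + ?d) *\<^sub>R (\<iota> z - \<iota> x0)) = (h + ?d) * norm (\<iota> z - \<iota> x0)" using h d by simp
        moreover have "h * norm (\<iota> z - \<iota> x0) \<le> (h + ?d) * norm (\<iota> z - \<iota> x0)" using d by (intro mult_right_mono) auto
        moreover have "?d * norm (w' - \<iota> x0) \<le> dist (\<iota> y) (\<iota> x0) * norm (w' - \<iota> x0)" using dle by (intro mult_right_mono) auto
        ultimately have "h * norm (\<iota> z - \<iota> x0) \<le> h * (dist (\<iota> y) (\<iota> x0) * R)"
          unfolding hR unfolding dist_norm by linarith
        then have "dist (\<iota> z) (\<iota> x0) \<le> dist (\<iota> y) (\<iota> x0) * R" using h by (simp add: dist_norm)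
        also have "\<dots> < \<delta> * R" using y(2) R by (intro mult_strict_right_mono) auto
        also have "\<dots> \<le> \<delta>1 / R * R" using R by (intro mult_right_mono) (auto simp: \<delta>_def)
        finally show ?thesis using R by simp
      qed
      then have fz: "f z < f x0 + \<epsilon> / 2" by (rule d1(2)[OF t(1) x0t dt z(1)])
      have "?d / h * (f z - N) \<le> ?d / h * Q" using fz d h by (intro mult_left_mono) (auto simp: Q_def)
      also have "\<dots> \<le> \<delta> / h * Q" using dle y(2) h Q by (intro mult_right_mono divide_right_mono) auto
      also have "\<dots> \<le> (\<epsilon> * h / (2 * Q)) / h * Q" using h Q by (intro mult_right_mono divide_right_mono) (auto simp: \<delta>_def)
      also have "\<dots> = \<epsilon> / 2" using h Q by simp
      finally show ?thesis using main fz by linarith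
    qed
  qed
qed

text \<open>Every dimension costs half of the tolerance, so the induction leaves \<epsilon> free. It
  starts at the vertex, the only cell of dimension 0 through \<open>x0\<close>.\<close>

lemma upper_bound_near_vertex:
  assumes g: "good_complex x0 PP c" and eps: "\<epsilon> > 0" and x0: "x0 \<in> U"
  shows "\<exists>\<delta>>0. \<forall>\<sigma>\<in>{\<sigma>\<in>PP. x0 \<in> \<sigma>}. pdim \<iota> \<sigma> = int m \<longrightarrow>
    (\<forall>y\<in>\<sigma>. dist (\<iota> y) (\<iota> x0) < \<delta> \<longrightarrow> f y < f x0 + \<epsilon>)"
  using eps
proof (induction m arbitrary: \<epsilon>)
  case 0
  note gD = good_complexD[OF g]
  note e = in_classD(1)[OF gD(1)]
  have "\<sigma> = {x0}" if "\<sigma> \<in> PP" "x0 \<in> \<sigma>" "pdim \<iota> \<sigma> = 0" for \<sigma>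
    using cell_eqI[OF e that(1) gD(3)] that by (simp add: pdim_def aff_dim_sing)
  then have "f y < f x0 + \<epsilon>" if "\<sigma> \<in> PP" "x0 \<in> \<sigma>" "pdim \<iota> \<sigma> = 0" "y \<in> \<sigma>" for \<sigma> y
    using that 0 by fastforce
  then show ?case by (intro exI[of _ 1]) auto
next
  case (Suc m)
  note gD = good_complexD[OF g]
  note e = in_classD(1)[OF gD(1)]
  have "\<epsilon> / 2 > 0" using Suc.prems by simp
  from Suc.IH[OF this] obtain \<delta>1 where d1: "\<delta>1 > 0" "\<And>\<tau> y. \<tau> \<in> PP \<Longrightarrow> x0 \<in> \<tau> \<Longrightarrow> pdim \<iota> \<tau> = int m \<Longrightarrow> y \<in> \<tau> \<Longrightarrow>
      dist (\<iota> y) (\<iota> x0) < \<delta>1 \<Longrightarrow> f y < f x0 + \<epsilon> / 2" by blast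
  show ?case
  proof (rule finite_uniform_radius[OF finite_star[OF e]])
    fix \<sigma> assume s: "\<sigma> \<in> {\<sigma>\<in>PP. x0 \<in> \<sigma>}"
    show "\<exists>\<delta>>0. pdim \<iota> \<sigma> = int (Suc m) \<longrightarrow> (\<forall>y\<in>\<sigma>. dist (\<iota> y) (\<iota> x0) < \<delta> \<longrightarrow> f y < f x0 + \<epsilon>)"
    proof (cases "pdim \<iota> \<sigma> = int (Suc m)")
      case True
      then have "\<exists>\<delta>>0. \<forall>y\<in>\<sigma>. dist (\<iota> y) (\<iota> x0) < \<delta> \<longrightarrow> f y < f x0 + \<epsilon>"
        by (intro upper_bound_step[OF g Suc.prems x0 _ _ _ d1]) (use s in auto)
      then show ?thesis by blast
    qed (auto intro: exI[of _ 1])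
  qed (auto dest: less_le_trans)
qed

section \<open>From the bounds at a vertex to continuity\<close>

lemma continuous_at_point:
  assumes x0: "x0 \<in> U" and eps: "\<epsilon> > 0"
  obtains W where "openin T W" "x0 \<in> W" "\<And>y. y \<in> W \<Longrightarrow> \<bar>f y - f x0\<bar> < \<epsilon>"
proof -
  obtain PP c where g: "good_complex x0 PP c" using good_complex_exists[OF x0] by auto
  note gD = good_complexD[OF g]
  note e = in_classD(1)[OF gD(1)]
  have "\<exists>\<delta>>0. \<forall>j\<in>{..n}. \<forall>\<sigma>\<in>{\<sigma>\<in>PP. x0 \<in> \<sigma>}. pdim \<iota> \<sigma> = int n - int j \<longrightarrow>
    (\<forall>y\<in>\<sigma>. \<iota> y \<in> rel_interior (\<iota> ` \<sigma>) \<longrightarrow> dist (\<iota> y) (\<iota> x0) < \<delta> \<longrightarrow> f x0 - \<epsilon> < f y)"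
    by (rule finite_uniform_radius) (use lower_bound_near_vertex[OF g eps x0] in \<open>auto dest: less_le_trans\<close>)
  then obtain \<delta> where \<delta>: "\<delta> > 0" "\<And>j \<sigma> y. j \<le> n \<Longrightarrow> \<sigma> \<in> PP \<Longrightarrow> x0 \<in> \<sigma> \<Longrightarrow> pdim \<iota> \<sigma> = int n - int j \<Longrightarrow> y \<in> \<sigma> \<Longrightarrow>
    \<iota> y \<in> rel_interior (\<iota> ` \<sigma>) \<Longrightarrow> dist (\<iota> y) (\<iota> x0) < \<delta> \<Longrightarrow> f x0 - \<epsilon> < f y" by blast
  have "\<exists>\<delta>>0. \<forall>m\<in>{..n}. \<forall>\<sigma>\<in>{\<sigma>\<in>PP. x0 \<in> \<sigma>}. pdim \<iota> \<sigma> = int m \<longrightarrow>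
    (\<forall>y\<in>\<sigma>. dist (\<iota> y) (\<iota> x0) < \<delta> \<longrightarrow> f y < f x0 + \<epsilon>)"
    by (rule finite_uniform_radius) (use upper_bound_near_vertex[OF g eps x0] in \<open>auto dest: less_le_trans\<close>)
  then obtain \<delta>' where \<delta>': "\<delta>' > 0" "\<And>m \<sigma> y. m \<le> n \<Longrightarrow> \<sigma> \<in> PP \<Longrightarrow> x0 \<in> \<sigma> \<Longrightarrow> pdim \<iota> \<sigma> = int m \<Longrightarrow> y \<in> \<sigma> \<Longrightarrow>
    dist (\<iota> y) (\<iota> x0) < \<delta>' \<Longrightarrow> f y < f x0 + \<epsilon>" by blast
  have xT: "x0 \<in> topspace T" using openin_subset[OF openU] x0 by auto
  have "min \<delta> \<delta>' > 0" using \<delta>(1) \<delta>'(1) by simp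
  then obtain V where V: "openin T V" "x0 \<in> V" "\<And>\<sigma>. \<sigma> \<in> PP \<Longrightarrow> \<sigma> \<inter> V \<noteq> {} \<Longrightarrow> x0 \<in> \<sigma>"
    "\<And>y. y \<in> V \<Longrightarrow> dist (\<iota> y) (\<iota> x0) < min \<delta> \<delta>'"
    using small_star_nbhd[OF e xT] by metis
  show ?thesis
  proof (rule that[OF V(1,2)])
    fix y assume y: "y \<in> V"
    have yT: "y \<in> topspace T" using openin_subset[OF V(1)] y by auto
    \<comment> \<open>The lower bound concerns relative interior points, so the cell is chosen
      minimal at \<open>y\<close>; it contains \<open>x0\<close> because \<open>V\<close> meets only
      cells of the star.\<close>
    obtain \<tau> where t: "\<tau> \<in> PP" "y \<in> \<tau>" "\<iota> y \<in> rel_interior (\<iota> ` \<tau>)" using cell_min_point[OF e yT] .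
    have x0t: "x0 \<in> \<tau>" using V(3)[OF t(1)] y t(2) by auto
    have d: "0 \<le> pdim \<iota> \<tau>" "pdim \<iota> \<tau> \<le> int n" using pdim_nonneg[of \<tau> \<iota>] t(2) dim_le[OF gD(1) t(1)] by auto
    define m where "m = nat (pdim \<iota> \<tau>)"
    have m: "pdim \<iota> \<tau> = int m" "m \<le> n" using d by (auto simp: m_def)
    have "f y < f x0 + \<epsilon>" by (rule \<delta>'(2)[OF m(2) t(1) x0t m(1) t(2)]) (use V(4)[OF y] in simp)
    \<comment> \<open>The lower bound counts dimensions downwards from \<open>n\<close>, hence the
      index \<open>n - m\<close>.\<close>
    moreover have "f x0 - \<epsilon> < f y"
      by (rule \<delta>(2)[of "n - m", OF _ t(1) x0t _ t(2,3)]) (use V(4)[OF y] m in auto)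
    ultimately show "\<bar>f y - f x0\<bar> < \<epsilon>" by auto
  qed
qed

lemma continuous: "continuous_map (subtopology T U) euclideanreal f"
proof -
  have top: "topspace (subtopology T U) = U" using openin_subset[OF openU] by auto
  have op: "openin (subtopology T U) W \<longleftrightarrow> openin T W \<and> W \<subseteq> U" for W
    using openU openin_open_subtopology by blast
  have "openin T {x \<in> U. f x > a}" "openin T {x \<in> U. f x < a}" for a
  proof -
    show "openin T {x \<in> U. f x > a}"
    proof (subst openin_subopen, intro ballI)
      fix x assume x: "x \<in> {x \<in> U. f x > a}"
      then obtain W where W: "openin T W" "x \<in> W" "\<And>y. y \<in> W \<Longrightarrow> \<bar>f y - f x\<bar> < f x - a"
        using continuous_at_point[of x "f x - a"] by auto
      have "W \<inter> U \<subseteq> {x \<in> U. f x > a}"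
      proof
        fix y assume "y \<in> W \<inter> U"
        then show "y \<in> {x \<in> U. f x > a}" using W(3)[of y] by auto
      qed
      then show "\<exists>W. openin T W \<and> x \<in> W \<and> W \<subseteq> {x \<in> U. f x > a}"
        using openin_Int[OF W(1) openU] W(2) x by (intro exI[of _ "W \<inter> U"]) auto
    qed
    show "openin T {x \<in> U. f x < a}"
    proof (subst openin_subopen, intro ballI)
      fix x assume x: "x \<in> {x \<in> U. f x < a}"
      then obtain W where W: "openin T W" "x \<in> W" "\<And>y. y \<in> W \<Longrightarrow> \<bar>f y - f x\<bar> < a - f x"
        using continuous_at_point[of x "a - f x"] by auto
      have "W \<inter> U \<subseteq> {x \<in> U. f x < a}"
      proof
        fix y assume "y \<in> W \<inter> U"
        then show "y \<in> {x \<in> U. f x < a}" using W(3)[of y] by auto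
      qed
      then show "\<exists>W. openin T W \<and> x \<in> W \<and> W \<subseteq> {x \<in> U. f x < a}"
        using openin_Int[OF W(1) openU] W(2) x by (intro exI[of _ "W \<inter> U"]) auto
    qed
  qed
  then show ?thesis unfolding continuous_map_upper_lower_semicontinuous_lt top op by auto
qed

end

theorem theorem6p2:
  fixes T :: "'a topology" and \<iota> :: "'a \<Rightarrow> 'v::euclidean_space"
    and PP0 PPb :: "'a set set" and n :: nat and U :: "'a set"
    and b :: "'a set \<Rightarrow> real" and f :: "'a \<Rightarrow> real"
  assumes "euclidean_polyhedral_space T \<iota> PP0"
    and "pure_dimension \<iota> PP0 n"
    and "openin T U"
    and "balancing T \<iota> PP0 n U PPb b"
    and "weakly_concave T \<iota> PP0 n U PPb b f"
  shows "continuous_map (subtopology T U) euclideanreal f"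
proof -
  obtain a \<beta> where h: "\<beta> \<noteq> 0" "\<iota> ` topspace T \<subseteq> {y. a \<bullet> y = \<beta>}" and e0: "epc_complex T \<iota> PP0"
    using assms(1) unfolding euclidean_polyhedral_space_def by auto
  interpret weakly_concave_setting T \<iota> PP0 PPb n U b f a \<beta>
    by unfold_locales (use h e0 assms in auto)
  show ?thesis by (rule continuous)
qed

end
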